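(* Let $a,b_1,b_2\in\mathbb{R}$ and consider the differential operator on $G_2$-structures $$P(\varphi)=(-\mathrm{Rc}+a\,\mathcal{L}_{\mathsf{V}T}g)\diamond\varphi+(b_1\,\mathrm{div}\,T+b_2\,\mathrm{div}\,T^t)\lrcorner\psi,$$ where $b_1+b_2\ne0$ and $b_1\ne a(b_1+b_2)$. Then for any $G_2$-structure $\varphi$ on a $7$-manifold $M$, any $x\in M$ and any nonzero $\xi\in T_x^*M$, $$\ker\big(\sigma_\xi(D_\varphi P)\big)=\mathrm{im}\big(\sigma_\xi(\delta^* )\big).$$ Moreover, if $b_1+b_2=1$ and $a=-b_2$, then for every $(h,X)\in\ker(\tilde B)$ we have $$\sigma_\xi(D_\varphi P)(h,X)=|\xi|^2(h,X).$$ In particular, in this special case $\sigma_\xi(D_\varphi P)$ preserves $\ker(\tilde B)$. This choice of $a,b_1,b_2$ corresponds to operators of the form $P(\varphi)=(-\mathrm{Rc}+a\,\mathcal{L}_{\mathsf{V}T}g)\diamond\varphi+((1+a)\,\mathrm{div}\,T-a\,\mathrm{div}\,T^t)\lrcorner\psi$.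
   Context: A $G_2$-structure on a smooth $7$-manifold $M$ is a smooth $3$-form $\varphi$ which is nondegenerate: it determines a Riemannian metric $g$ and volume form $\mathrm{vol}$ by $(X\lrcorner\varphi)\wedge(Y\lrcorner\varphi)\wedge\varphi=-6\,g(X,Y)\,\mathrm{vol}$. Let $\nabla$ be the Levi-Civita connection of $g$ and $\psi=\star\varphi$. Indices refer to a local $g$-orthonormal frame, repeated indices are summed, and $\varphi_{ijk}\varphi_{abk}=g_{ia}g_{jb}-g_{ib}g_{ja}-\psi_{ijab}$. Vectors and covectors are identified by $g$. The torsion is the unique $2$-tensor $T$ with $\nabla_m\varphi_{ijk}=T_{mp}\psi_{pijk}$; $(T^t)_{ij}=T_{ji}$; $(\mathsf{V}T)_k=T_{ij}\varphi_{ijk}$; $(\mathrm{div}\,T)_k=\nabla_iT_{ik}$, $(\mathrm{div}\,T^t)_k=\nabla_iT_{ki}$; $\mathrm{Rc}$ is the Ricci tensor of $g$. For a $2$-tensor $A$, $(A\diamond\varphi)_{ijk}=A_{ip}\varphi_{pjk}+A_{jp}\varphi_{ipk}+A_{kp}\varphi_{ijp}$; $(X\lrcorner\psi)_{ijk}=X_m\psi_{mijk}$. Given $\varphi$, the map $(h,X)\mapsto h\diamond\varphi+X\lrcorner\psi$ identifies $\mathrm{Sym}^2(T^*M)\oplus T^*M$ with $\Lambda^3(T^*M)$, and linear operators from or to $\Omega^3$ are written in terms of pairs $(h,X)$. $G_2$-structures form an open subset of $\Omega^3$, and $D_\varphi P$ is the linearization of $P$ at $\varphi$: $D_\varphi P(h,X)=\frac{d}{ds}\big|_{s=0}P(\varphi_s)$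 with $\frac{d}{ds}|_{s=0}\varphi_s=h\diamond\varphi+X\lrcorner\psi$. The principal symbol $\sigma_\xi(L)$ of a linear operator $L$ of order $m$ is obtained by keeping only the $m$-th order terms and replacing $\nabla_{i_1}\cdots\nabla_{i_m}$ by $\xi_{i_1}\cdots\xi_{i_m}$. The operator $\delta^*:\mathfrak{X}(M)\to\Omega^3$ is $\delta^*W=\mathcal{L}_W\varphi$; its symbol has image $\mathrm{im}(\sigma_\xi(\delta^* ))=\{(\tfrac12(\xi\otimes V+V\otimes\xi),-\tfrac12\,\xi\times V):V\in T_x^*M\}$, $(\xi\times V)_k=\xi_pV_q\varphi_{pqk}$. The linear map $\tilde B:\mathrm{Sym}^2(T_x^*M)\oplus T_x^*M\to T_x^*M$ is $\tilde B(h,X)_k=\xi_ah_{ak}-\tfrac12\xi_k\,\mathrm{tr}\,h-a\,\sigma_\xi(D_\varphi\mathsf{V}T)(h,X)_k$, where $\sigma_\xi(D_\varphi\mathsf{V}T)(h,X)_k=\xi_k\,\mathrm{tr}\,h-\xi_ah_{ak}+\xi_aX_b\varphi_{abk}$ is the principal symbol of the linearization of $\varphi\mapsto\mathsf{V}T$. *)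

theory Defs
  imports "HOL-Analysis.Analysis"
begin

text \<open>
  Tensors on an open subset of \<open>real^7\<close> are given by their components in the coordinate frame, all
  indices lowered: a covector is a \<open>real^7\<close>, a 2-tensor a \<open>real^7^7\<close>, and so on.  Where the
  orthonormal-frame formulas contract two indices, the coordinate formulas insert the inverse metric.
\<close>

type_synonym vec7 = "real^7"
type_synonym ten2 = "real^7^7"
type_synonym ten3 = "real^7^7^7"
type_synonym ten4 = "real^7^7^7^7"
type_synonym pair7 = "ten2 \<times> vec7"

definition pd :: "7 \<Rightarrow> (vec7 \<Rightarrow> 'b::real_normed_vector) \<Rightarrow> vec7 \<Rightarrow> 'b" where
  "pd i f y = frechet_derivative f (at y) (axis i 1)"

fun pds :: "7 list \<Rightarrow> (vec7 \<Rightarrow> 'b::real_normed_vector) \<Rightarrow> vec7 \<Rightarrow> 'b" where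
  "pds [] f = f"
| "pds (i # l) f = pd i (pds l f)"

text \<open>\<open>smooth_on\<close> is only meant for open \<open>U\<close>.\<close>

definition smooth_on :: "vec7 set \<Rightarrow> (vec7 \<Rightarrow> 'b::real_normed_vector) \<Rightarrow> bool" where
  "smooth_on U f \<longleftrightarrow> (\<forall>l. \<forall>y\<in>U. pds l f differentiable (at y))"

type_synonym 'm chart = "'m set \<times> ('m \<Rightarrow> vec7)"

abbreviation chart_image :: "'m chart \<Rightarrow> vec7 set" where
  "chart_image c \<equiv> snd c ` fst c"

definition transition :: "'m chart \<Rightarrow> 'm chart \<Rightarrow> vec7 \<Rightarrow> vec7" where
  "transition c d = snd d \<circ> inv_into (fst c) (snd c)"

definition smooth_atlas :: "'m::{t2_space, second_countable_topology} chart set \<Rightarrow> bool" where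
  "smooth_atlas \<A> \<longleftrightarrow>
     (\<Union>c\<in>\<A>. fst c) = UNIV \<and>
     (\<forall>c\<in>\<A>. open (fst c) \<and> open (chart_image c) \<and>
        (\<exists>k. homeomorphism (fst c) (chart_image c) (snd c) k)) \<and>
     (\<forall>c\<in>\<A>. \<forall>d\<in>\<A>. smooth_on (snd c ` (fst c \<inter> fst d)) (transition c d))"

definition alternating3 :: "ten3 \<Rightarrow> bool" where
  "alternating3 p \<longleftrightarrow> (\<forall>i j k. p$i$j$k = - p$j$i$k \<and> p$i$j$k = - p$i$k$j)"

text \<open>
  The coefficient of \<open>dx\<^sup>1 \<and> \<dots> \<and> dx\<^sup>7\<close> in \<open>(X \<lrcorner> p) \<and> (Y \<lrcorner> p) \<and> p\<close> for the \<open>i\<close>-th and \<open>j\<close>-th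
  coordinate vectors \<open>X, Y\<close>; here \<open>24 = 2! 2! 3!\<close>.
\<close>

definition wedge_form :: "ten3 \<Rightarrow> 7 \<Rightarrow> 7 \<Rightarrow> real" where
  "wedge_form p i j =
     (\<Sum>s | s permutes (UNIV :: 7 set).
        of_int (sign s) * p$i$(s 1)$(s 2) * p$j$(s 3)$(s 4) * p$(s 5)$(s 6)$(s 7)) / 24"

text \<open>
  \<open>g\<close> is an inner product and \<open>v\<close> is the coefficient of one of its two volume forms; the sign of
  \<open>v\<close> is the orientation, which is determined by \<open>p\<close> as well.
\<close>

definition determines :: "ten3 \<Rightarrow> ten2 \<Rightarrow> real \<Rightarrow> bool" where
  "determines p g v \<longleftrightarrow>
     transpose g = g \<and> (\<forall>X. X \<noteq> 0 \<longrightarrow> X \<bullet> (g *v X) > 0) \<and> \<bar>v\<bar> = sqrt (det g) \<and>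
     (\<forall>i j. wedge_form p i j = - 6 * g$i$j * v)"

definition nondegenerate :: "ten3 \<Rightarrow> bool" where
  "nondegenerate p \<longleftrightarrow> (\<exists>g v. determines p g v)"

definition metric :: "ten3 \<Rightarrow> ten2" where
  "metric p = (THE g. \<exists>v. determines p g v)"

definition vol :: "ten3 \<Rightarrow> real" where
  "vol p = (THE v. \<exists>g. determines p g v)"

definition ginv :: "ten3 \<Rightarrow> ten2" where
  "ginv p = matrix_inv (metric p)"

definition raise3 :: "ten3 \<Rightarrow> ten3" where
  "raise3 p = (\<chi> i j k. \<Sum>a\<in>UNIV. \<Sum>b\<in>UNIV. \<Sum>c\<in>UNIV.
     ginv p$i$a * ginv p$j$b * ginv p$k$c * p$a$b$c)"

text \<open>
  The Hodge dual \<open>\<psi> = \<star>p\<close>, that is \<open>\<psi>\<^sub>a\<^sub>b\<^sub>c\<^sub>d = 1/3! p\<^sup>i\<^sup>j\<^sup>k vol\<^sub>i\<^sub>j\<^sub>k\<^sub>a\<^sub>b\<^sub>c\<^sub>d\<close>.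
\<close>

definition psi :: "ten3 \<Rightarrow> ten4" where
  "psi p = (\<chi> a b c d. vol p / 6 *
     (\<Sum>s | s permutes (UNIV :: 7 set) \<and> s 4 = a \<and> s 5 = b \<and> s 6 = c \<and> s 7 = d.
        of_int (sign s) * raise3 p$(s 1)$(s 2)$(s 3)))"

definition diamond :: "ten2 \<Rightarrow> ten3 \<Rightarrow> ten3" where
  "diamond A p = (\<chi> i j k. \<Sum>q\<in>UNIV. \<Sum>r\<in>UNIV. ginv p$q$r *
     (A$i$q * p$r$j$k + A$j$q * p$i$r$k + A$k$q * p$i$j$r))"

definition hook_psi :: "vec7 \<Rightarrow> ten3 \<Rightarrow> ten3" where
  "hook_psi X p = (\<chi> i j k. \<Sum>m\<in>UNIV. \<Sum>n\<in>UNIV. ginv p$m$n * X$n * psi p$m$i$j$k)"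

definition sym_pairs :: "pair7 set" where
  "sym_pairs = {(h, X). transpose h = h}"

definition of_pair :: "ten3 \<Rightarrow> pair7 \<Rightarrow> ten3" where
  "of_pair p u = diamond (fst u) p + hook_psi (snd u) p"

definition to_pair :: "ten3 \<Rightarrow> ten3 \<Rightarrow> pair7" where
  "to_pair p \<eta> = (THE u. u \<in> sym_pairs \<and> of_pair p u = \<eta>)"

definition G2_form_on :: "vec7 set \<Rightarrow> (vec7 \<Rightarrow> ten3) \<Rightarrow> bool" where
  "G2_form_on U \<phi> \<longleftrightarrow>
     smooth_on U \<phi> \<and> (\<forall>y\<in>U. alternating3 (\<phi> y) \<and> nondegenerate (\<phi> y))"

text \<open>
  A \<open>G\<^sub>2\<close>-structure on a manifold is the family of its coordinate expressions in the charts of the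
  atlas, any two of which are related by pullback along the transition map.
\<close>

definition G2_structure :: "'m::{t2_space, second_countable_topology} chart set \<Rightarrow>
    ('m chart \<Rightarrow> vec7 \<Rightarrow> ten3) \<Rightarrow> bool" where
  "G2_structure \<A> \<Phi> \<longleftrightarrow>
     (\<forall>c\<in>\<A>. G2_form_on (chart_image c) (\<Phi> c)) \<and>
     (\<forall>c\<in>\<A>. \<forall>d\<in>\<A>. \<forall>y \<in> snd c ` (fst c \<inter> fst d). \<forall>i j k.
        \<Phi> c y$i$j$k = (\<Sum>p\<in>UNIV. \<Sum>q\<in>UNIV. \<Sum>r\<in>UNIV.
          pd i (transition c d) y$p * pd j (transition c d) y$q * pd k (transition c d) y$r *
          \<Phi> d (transition c d y)$p$q$r))"

text \<open>\<open>christoffel \<phi> y $ k $ i $ j\<close> is \<open>\<Gamma>\<^sup>k\<^sub>i\<^sub>j\<close>.\<close>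

definition christoffel :: "(vec7 \<Rightarrow> ten3) \<Rightarrow> vec7 \<Rightarrow> ten3" where
  "christoffel \<phi> y = (let g = (\<lambda>z. metric (\<phi> z)) in
     \<chi> k i j. (1/2) * (\<Sum>l\<in>UNIV. ginv (\<phi> y)$k$l *
       (pd i g y$j$l + pd j g y$i$l - pd l g y$i$j)))"

text \<open>The first index of a covariant derivative is the direction of differentiation.\<close>

definition nabla2 :: "(vec7 \<Rightarrow> ten3) \<Rightarrow> (vec7 \<Rightarrow> ten2) \<Rightarrow> vec7 \<Rightarrow> ten3" where
  "nabla2 \<phi> t y = (let \<Gamma> = christoffel \<phi> y in
     \<chi> m i j. pd m t y$i$j - (\<Sum>p\<in>UNIV. \<Gamma>$p$m$i * t y$p$j + \<Gamma>$p$m$j * t y$i$p))"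

definition nabla3 :: "(vec7 \<Rightarrow> ten3) \<Rightarrow> (vec7 \<Rightarrow> ten3) \<Rightarrow> vec7 \<Rightarrow> ten4" where
  "nabla3 \<phi> t y = (let \<Gamma> = christoffel \<phi> y in
     \<chi> m i j k. pd m t y$i$j$k -
       (\<Sum>p\<in>UNIV. \<Gamma>$p$m$i * t y$p$j$k + \<Gamma>$p$m$j * t y$i$p$k + \<Gamma>$p$m$k * t y$i$j$p))"

definition torsion :: "(vec7 \<Rightarrow> ten3) \<Rightarrow> vec7 \<Rightarrow> ten2" where
  "torsion \<phi> y = (THE T. \<forall>m i j k. nabla3 \<phi> \<phi> y$m$i$j$k =
     (\<Sum>p\<in>UNIV. \<Sum>q\<in>UNIV. T$m$p * ginv (\<phi> y)$p$q * psi (\<phi> y)$q$i$j$k))"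

definition VT :: "(vec7 \<Rightarrow> ten3) \<Rightarrow> vec7 \<Rightarrow> vec7" where
  "VT \<phi> y = (\<chi> k. \<Sum>i\<in>UNIV. \<Sum>j\<in>UNIV. \<Sum>a\<in>UNIV. \<Sum>b\<in>UNIV.
     ginv (\<phi> y)$i$a * ginv (\<phi> y)$j$b * torsion \<phi> y$i$j * \<phi> y$a$b$k)"

definition divergence :: "(vec7 \<Rightarrow> ten3) \<Rightarrow> (vec7 \<Rightarrow> ten2) \<Rightarrow> vec7 \<Rightarrow> vec7" where
  "divergence \<phi> t y = (\<chi> k. \<Sum>i\<in>UNIV. \<Sum>j\<in>UNIV. ginv (\<phi> y)$i$j * nabla2 \<phi> t y$i$j$k)"

text \<open>
  \<open>R\<^sub>j\<^sub>k = \<partial>\<^sub>i \<Gamma>\<^sup>i\<^sub>j\<^sub>k - \<partial>\<^sub>j \<Gamma>\<^sup>i\<^sub>i\<^sub>k + \<Gamma>\<^sup>i\<^sub>i\<^sub>p \<Gamma>\<^sup>p\<^sub>j\<^sub>k - \<Gamma>\<^sup>i\<^sub>j\<^sub>p \<Gamma>\<^sup>p\<^sub>i\<^sub>k\<close>, which is positive on round spheres.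
\<close>

definition ricci :: "(vec7 \<Rightarrow> ten3) \<Rightarrow> vec7 \<Rightarrow> ten2" where
  "ricci \<phi> y = (let \<Gamma> = christoffel \<phi> y in
     \<chi> j k. (\<Sum>i\<in>UNIV. pd i (christoffel \<phi>) y$i$j$k - pd j (christoffel \<phi>) y$i$i$k) +
       (\<Sum>i\<in>UNIV. \<Sum>p\<in>UNIV. \<Gamma>$i$i$p * \<Gamma>$p$j$k - \<Gamma>$i$j$p * \<Gamma>$p$i$k))"

text \<open>
  Lie derivatives along a vector field \<open>W\<close> (contravariant components).  For the covector field \<open>VT\<close>
  the corresponding vector field is \<open>sharp \<phi> (VT \<phi>)\<close>.
\<close>

definition sharp :: "(vec7 \<Rightarrow> ten3) \<Rightarrow> (vec7 \<Rightarrow> vec7) \<Rightarrow> vec7 \<Rightarrow> vec7" where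
  "sharp \<phi> w y = ginv (\<phi> y) *v w y"

definition lie2 :: "(vec7 \<Rightarrow> vec7) \<Rightarrow> (vec7 \<Rightarrow> ten2) \<Rightarrow> vec7 \<Rightarrow> ten2" where
  "lie2 W t y = (\<chi> i j. \<Sum>m\<in>UNIV.
     W y$m * pd m t y$i$j + pd i W y$m * t y$m$j + pd j W y$m * t y$i$m)"

definition lie3 :: "(vec7 \<Rightarrow> vec7) \<Rightarrow> (vec7 \<Rightarrow> ten3) \<Rightarrow> vec7 \<Rightarrow> ten3" where
  "lie3 W t y = (\<chi> i j k. \<Sum>m\<in>UNIV.
     W y$m * pd m t y$i$j$k + pd i W y$m * t y$m$j$k + pd j W y$m * t y$i$m$k +
     pd k W y$m * t y$i$j$m)"

definition lie_VT_metric :: "(vec7 \<Rightarrow> ten3) \<Rightarrow> vec7 \<Rightarrow> ten2" where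
  "lie_VT_metric \<phi> = lie2 (sharp \<phi> (VT \<phi>)) (\<lambda>z. metric (\<phi> z))"

abbreviation div_torsion :: "(vec7 \<Rightarrow> ten3) \<Rightarrow> vec7 \<Rightarrow> vec7" where
  "div_torsion \<phi> \<equiv> divergence \<phi> (torsion \<phi>)"

abbreviation div_torsion_t :: "(vec7 \<Rightarrow> ten3) \<Rightarrow> vec7 \<Rightarrow> vec7" where
  "div_torsion_t \<phi> \<equiv> divergence \<phi> (\<lambda>z. transpose (torsion \<phi> z))"

definition G2_operator :: "real \<Rightarrow> real \<Rightarrow> real \<Rightarrow> (vec7 \<Rightarrow> ten3) \<Rightarrow> vec7 \<Rightarrow> ten3" where
  "G2_operator a b1 b2 \<phi> y =
     diamond (- ricci \<phi> y + a *\<^sub>R lie_VT_metric \<phi> y) (\<phi> y) +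
     hook_psi (b1 *\<^sub>R div_torsion \<phi> y + b2 *\<^sub>R div_torsion_t \<phi> y) (\<phi> y)"

definition delta_star :: "(vec7 \<Rightarrow> ten3) \<Rightarrow> (vec7 \<Rightarrow> vec7) \<Rightarrow> vec7 \<Rightarrow> pair7" where
  "delta_star \<phi> W y = to_pair (\<phi> y) (lie3 W \<phi> y)"

text \<open>
  The value at \<open>y\<close> of the linearization at \<open>\<phi>\<close>, in the direction of the pair field \<open>u\<close>.  For fixed
  \<open>y\<close> the form \<open>\<phi> + s (h \<diamondop> \<phi> + X \<lrcorner> \<psi>)\<close> is nondegenerate near \<open>y\<close> when \<open>s\<close> is small, and only its
  germ at \<open>y\<close> matters.
\<close>

definition linearization :: "((vec7 \<Rightarrow> ten3) \<Rightarrow> vec7 \<Rightarrow> 'b::real_normed_vector) \<Rightarrow>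
    (vec7 \<Rightarrow> ten3) \<Rightarrow> (vec7 \<Rightarrow> pair7) \<Rightarrow> vec7 \<Rightarrow> 'b" where
  "linearization F \<phi> u y =
     vector_derivative (\<lambda>s. F (\<lambda>z. \<phi> z + s *\<^sub>R of_pair (\<phi> z) (u z)) y) (at 0)"

text \<open>
  \<open>principal_symbol m U E L x \<xi> v\<close> is the symbol at \<open>x\<close>, in direction \<open>\<xi>\<close>, applied to \<open>v \<in> E\<close>, of
  a linear differential operator \<open>L\<close> of order \<open>m\<close> on sections over \<open>U\<close> of the trivial bundle with
  fibre \<open>E\<close>: one writes \<open>L u x = \<Sum>\<^sub>l A\<^sub>l (\<partial>\<^sub>l u x)\<close>, keeps the terms of order \<open>m\<close>, and replaces
  \<open>\<partial>\<^sub>i\<^sub>1 \<dots> \<partial>\<^sub>i\<^sub>m\<close> by \<open>\<xi>\<^sub>i\<^sub>1 \<dots> \<xi>\<^sub>i\<^sub>m\<close>.  Covariant and partial derivatives differ by terms of lower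
  order and hence give the same symbol.  The coefficients \<open>A\<^sub>l\<close> themselves are not unique (mixed
  partial derivatives commute, and \<open>A\<^sub>l\<close> is arbitrary on a complement of \<open>E\<close>), but the symbol on \<open>E\<close> is.
\<close>

definition principal_symbol :: "nat \<Rightarrow> vec7 set \<Rightarrow> 'a::real_normed_vector set \<Rightarrow>
    ((vec7 \<Rightarrow> 'a) \<Rightarrow> vec7 \<Rightarrow> 'b::real_normed_vector) \<Rightarrow> vec7 \<Rightarrow> vec7 \<Rightarrow> 'a \<Rightarrow> 'b" where
  "principal_symbol m U E L x \<xi> v = (THE w. \<exists>A :: 7 list \<Rightarrow> 'a \<Rightarrow> 'b.
     (\<forall>l. linear (A l)) \<and>
     (\<forall>u. smooth_on U u \<and> (\<forall>y\<in>U. u y \<in> E) \<longrightarrow>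
        L u x = (\<Sum>l | length l \<le> m. A l (pds l u x))) \<and>
     w = (\<Sum>l | length l = m. (\<Prod>i\<leftarrow>l. \<xi>$i) *\<^sub>R A l v))"

definition symbol_DP :: "real \<Rightarrow> real \<Rightarrow> real \<Rightarrow> vec7 set \<Rightarrow> (vec7 \<Rightarrow> ten3) \<Rightarrow>
    vec7 \<Rightarrow> vec7 \<Rightarrow> pair7 \<Rightarrow> pair7" where
  "symbol_DP a b1 b2 U \<phi> = principal_symbol 2 U sym_pairs
     (\<lambda>u y. to_pair (\<phi> y) (linearization (G2_operator a b1 b2) \<phi> u y))"

definition symbol_DVT :: "vec7 set \<Rightarrow> (vec7 \<Rightarrow> ten3) \<Rightarrow> vec7 \<Rightarrow> vec7 \<Rightarrow> pair7 \<Rightarrow> vec7" where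
  "symbol_DVT U \<phi> = principal_symbol 1 U sym_pairs (linearization VT \<phi>)"

definition symbol_delta_star :: "vec7 set \<Rightarrow> (vec7 \<Rightarrow> ten3) \<Rightarrow> vec7 \<Rightarrow> vec7 \<Rightarrow> vec7 \<Rightarrow> pair7" where
  "symbol_delta_star U \<phi> = principal_symbol 1 U UNIV (delta_star \<phi>)"

definition B_tilde :: "real \<Rightarrow> vec7 set \<Rightarrow> (vec7 \<Rightarrow> ten3) \<Rightarrow> vec7 \<Rightarrow> vec7 \<Rightarrow> pair7 \<Rightarrow> vec7" where
  "B_tilde a U \<phi> x \<xi> u =
     (\<chi> k. (\<Sum>i\<in>UNIV. \<Sum>j\<in>UNIV. ginv (\<phi> x)$i$j * \<xi>$i * fst u$j$k)
          - (1/2) * \<xi>$k * (\<Sum>i\<in>UNIV. \<Sum>j\<in>UNIV. ginv (\<phi> x)$i$j * fst u$i$j)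
          - a * symbol_DVT U \<phi> x \<xi> u$k)"

definition conorm_sq :: "ten3 \<Rightarrow> vec7 \<Rightarrow> real" where
  "conorm_sq p \<xi> = \<xi> \<bullet> (ginv p *v \<xi>)"

definition kernel_on_pairs :: "(pair7 \<Rightarrow> 'b::zero) \<Rightarrow> pair7 set" where
  "kernel_on_pairs \<sigma> = {u \<in> sym_pairs. \<sigma> u = 0}"

end

(* A nondegenerate 3-form is linearly equivalent to the standard one phi0: for its metric choose
   orthonormal e1, e2, e3 at which p(e1, e2, e3) is maximal, which kills p(ei, ej, -) outside their
   span; nondegeneracy then makes the three remaining 4 x 4 blocks a quaternionic triple of
   (anti-)self-dual forms, and a last rotation normalizes them. All algebraic identities are
   checked for phi0 and transported by naturality. The metric and the volume are smooth
   functions of the form, so P is a smooth function of its 2-jet, affine along second-order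
   directions, and its symbol is the derivative in such a direction. With B = B_tilde(h, X) and
   n = |xi|^2, its kernel is given by
     n h = xi B + B xi  and  b1 (xi x (xi.h) + n X) + b2 <xi, X> xi = 0.
   The first equation forces h = (xi w + w xi)/2 for some w; writing X = -(xi x w)/2 + Y, what
   remains is a (xi x Y) = 0 and b1 n Y + b2 <xi, Y> xi = 0, which has only the solution Y = 0. *)
theory Submission
  imports Defs
begin

text \<open>Metric, volume, torsion and the splitting of a 3-form into a pair are definite
  descriptions, which cannot be differentiated as they stand. Each is matched with a formula: an odd
  root of a determinant for the volume, which keeps the sign and hence the orientation; a left
  inverse built from psi for the torsion; a linear left inverse for the splitting. The formula for
  the metric serves smoothness but is unwieldy for the derivative. That comes from linear algebra:
  along \<open>act (mat 1 + t *\<^sub>R K) p\<close> naturality gives the metric in closed form, and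
  every 3-form is tangent to such a path, because the psi part is an infinitesimal rotation. The
  hypotheses on the constants divide the work: \<open>b1 + b2 \<noteq> 0\<close> kills the component
  of Y along \<xi>, and \<open>b1 \<noteq> a * (b1 + b2)\<close> guarantees that \<open>a\<close>
  and \<open>b1\<close> do not both vanish, which kills the rest.\<close>

lemma exhaust_7: fixes x :: 7
  shows "x = 1 \<or> x = 2 \<or> x = 3 \<or> x = 4 \<or> x = 5 \<or> x = 6 \<or> x = 7"
proof (induct x)
  case (of_int z)
  then have "0 \<le> z" "z < 7" by simp_all
  then have "z = 0 \<or> z = 1 \<or> z = 2 \<or> z = 3 \<or> z = 4 \<or> z = 5 \<or> z = 6" by arith
  then show ?case by auto
qed

lemma forall_7: "(\<forall>i::7. P i) \<longleftrightarrow> P 1 \<and> P 2 \<and> P 3 \<and> P 4 \<and> P 5 \<and> P 6 \<and> P 7"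
  by (metis exhaust_7)

lemma UNIV_7: "(UNIV::7 set) = {1, 2, 3, 4, 5, 6, 7}"
  using exhaust_7 by auto

lemma sum_7: "sum f (UNIV::7 set) = f 1 + f 2 + f 3 + f 4 + f 5 + f 6 + (f 7 :: 'a::comm_monoid_add)"
  unfolding UNIV_7 by (simp add: ac_simps)

lemma prod_7: "prod f (UNIV::7 set) = f 1 * f 2 * f 3 * f 4 * f 5 * f 6 * (f 7 :: 'a::comm_monoid_mult)"
  unfolding UNIV_7 by (simp add: ac_simps)

subsection \<open>Acting with a matrix on the slots of a tensor\<close>

text \<open>A tensor is a nested vector, so \<open>slot\<close> acts on its outermost index only and
  \<open>vmap\<close> carries an operation one level inwards. Operations at different depths commute
  (\<open>slot_vmap\<close>), which yields the composition laws without index sums.\<close>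

definition slot :: "real^7^7 \<Rightarrow> 'a::real_vector^7 \<Rightarrow> 'a^7" where
  "slot M t = (\<chi> i. \<Sum>a\<in>UNIV. M$i$a *\<^sub>R t$a)"

definition vmap :: "('a \<Rightarrow> 'b) \<Rightarrow> 'a^7 \<Rightarrow> 'b^7" where
  "vmap L t = (\<chi> i. L (t$i))"

definition act2 :: "real^7^7 \<Rightarrow> ten2 \<Rightarrow> ten2" where
  "act2 M t = slot M (vmap (slot M) t)"

definition act :: "real^7^7 \<Rightarrow> ten3 \<Rightarrow> ten3" where
  "act M t = slot M (vmap (act2 M) t)"

definition act4 :: "real^7^7 \<Rightarrow> ten4 \<Rightarrow> ten4" where
  "act4 M t = slot M (vmap (act M) t)"

lemma slot_nth: "slot M t $ i = (\<Sum>a\<in>UNIV. M$i$a *\<^sub>R t$a)"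
  by (simp add: slot_def)

lemma vmap_nth [simp]: "vmap L t $ i = L (t $ i)"
  by (simp add: vmap_def)

lemma vmap_vmap [simp]: "vmap f (vmap g t) = vmap (\<lambda>x. f (g x)) t"
  by (simp add: vmap_def)

lemma slot_vec: "slot M (t::vec7) = M *v t"
  by (simp add: slot_def matrix_vector_mult_def)

lemma linear_slot: "linear (slot M)"
  by (rule linearI)
     (simp_all add: vec_eq_iff slot_nth scaleR_right_distrib sum.distrib scaleR_right.sum ac_simps)

lemma linear_vmap: "linear L \<Longrightarrow> linear (vmap L)"
  by (rule linearI) (simp_all add: vec_eq_iff linear_add linear_scale)

lemma linear_act2: "linear (act2 M)"
  unfolding act2_def[abs_def]
  using linear_compose[OF linear_vmap[OF linear_slot] linear_slot] by (simp add: o_def)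

lemma linear_act: "linear (act M)"
  unfolding act_def[abs_def]
  using linear_compose[OF linear_vmap[OF linear_act2] linear_slot] by (simp add: o_def)

lemma slot_vmap: "linear L \<Longrightarrow> slot M (vmap L t) = vmap L (slot M t)"
  by (simp add: vec_eq_iff slot_nth linear_sum linear_scale)

lemma slot_slot: "slot M (slot N t) = slot (M ** N) t"
proof -
  have "(\<Sum>a\<in>UNIV. M $ i $ a *\<^sub>R (\<Sum>b\<in>UNIV. N $ a $ b *\<^sub>R t $ b)) =
        (\<Sum>b\<in>UNIV. (\<Sum>a\<in>UNIV. M $ i $ a * N $ a $ b) *\<^sub>R t $ b)" for i
    unfolding scaleR_right.sum scaleR_scaleR scaleR_left.sum by (rule sum.swap)
  then show ?thesis by (simp add: vec_eq_iff slot_nth matrix_matrix_mult_def)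
qed

lemma slot_1 [simp]: "slot (mat 1) t = t"
  by (simp add: vec_eq_iff slot_nth mat_def if_distrib[of "\<lambda>x. x *\<^sub>R _"] cong: if_cong)

lemma slot_add_left: "slot (M + N) t = slot M t + slot N t"
  by (simp add: vec_eq_iff slot_nth scaleR_left_distrib sum.distrib)

lemma slot_scaleR_left: "slot (c *\<^sub>R M) t = c *\<^sub>R slot M t"
  by (simp add: vec_eq_iff slot_nth scaleR_right.sum)

lemma act2_act2: "act2 M (act2 N t) = act2 (M ** N) t"
  by (simp add: act2_def slot_vmap[OF linear_slot, symmetric] slot_slot)

lemma act_act: "act M (act N t) = act (M ** N) t"
  by (simp add: act_def slot_vmap[OF linear_act2, symmetric] slot_slot act2_act2)

lemma act2_1 [simp]: "act2 (mat 1) t = t"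
  by (simp add: act2_def vec_eq_iff)

lemma act_1 [simp]: "act (mat 1) t = t"
  by (simp add: act_def vec_eq_iff)

lemma act2_matrix: "act2 M t = M ** t ** transpose M"
  by (simp add: act2_def vec_eq_iff slot_nth matrix_matrix_mult_def transpose_def
      sum_distrib_left sum_distrib_right)
     (subst sum.swap, simp add: mult_ac)

lemma act2_nth: "act2 M t $ i $ j = (\<Sum>a\<in>UNIV. \<Sum>b\<in>UNIV. M$i$a * M$j$b * t$a$b)"
  by (simp add: act2_def slot_nth sum_distrib_left mult_ac)

lemma act_nth: "act M t $ i $ j $ k =
   (\<Sum>a\<in>UNIV. \<Sum>b\<in>UNIV. \<Sum>c\<in>UNIV. M$i$a * M$j$b * M$k$c * t$a$b$c)"
  by (simp add: act_def act2_nth slot_nth sum_distrib_left mult_ac)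

lemma act_slice: "act M t $ i = (\<Sum>a\<in>UNIV. M$i$a *\<^sub>R act2 M (t$a))"
  by (simp add: act_def slot_nth)

lemma act_inverse: "N ** M = mat 1 \<Longrightarrow> act N (act M t) = t"
  by (simp add: act_act)

lemma act_alternating: assumes "alternating3 p" shows "alternating3 (act M p)"
proof -
  have A: "p$i$j$k = - p$j$i$k" "p$i$j$k = - p$i$k$j" for i j k
    using assms unfolding alternating3_def by blast+
  have "act M p $ j $ i $ k = - act M p $ i $ j $ k" for i j k
  proof -
    have "act M p $ j $ i $ k = (\<Sum>a\<in>UNIV. \<Sum>b\<in>UNIV. \<Sum>c\<in>UNIV. M$j$b * M$i$a * M$k$c * p$b$a$c)"
      unfolding act_nth by (rule sum.swap)
    also have "\<dots> = (\<Sum>a\<in>UNIV. \<Sum>b\<in>UNIV. \<Sum>c\<in>UNIV. - (M$i$a * M$j$b * M$k$c * p$a$b$c))"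
      by (intro sum.cong refl, subst A(1)) (simp only: mult.commute mult.left_commute mult_minus_right)
    finally show ?thesis by (simp add: act_nth sum_negf)
  qed
  moreover have "act M p $ i $ k $ j = - act M p $ i $ j $ k" for i j k
  proof -
    have "act M p $ i $ k $ j = (\<Sum>a\<in>UNIV. \<Sum>b\<in>UNIV. \<Sum>c\<in>UNIV. M$i$a * M$k$c * M$j$b * p$a$c$b)"
      unfolding act_nth by (rule sum.cong[OF refl], rule sum.swap)
    also have "\<dots> = (\<Sum>a\<in>UNIV. \<Sum>b\<in>UNIV. \<Sum>c\<in>UNIV. - (M$i$a * M$j$b * M$k$c * p$a$b$c))"
      by (intro sum.cong refl, subst A(2)) (simp only: mult.commute mult.left_commute mult_minus_right)
    finally show ?thesis by (simp add: act_nth sum_negf)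
  qed
  ultimately show ?thesis unfolding alternating3_def by (metis minus_minus)
qed

subsection \<open>Alternating sums\<close>

text \<open>Seven index values packed as a map, so that seven nested sums become one sum over maps
  and can be compared with a determinant.\<close>

definition tuple7 :: "'a \<Rightarrow> 'a \<Rightarrow> 'a \<Rightarrow> 'a \<Rightarrow> 'a \<Rightarrow> 'a \<Rightarrow> 'a \<Rightarrow> 7 \<Rightarrow> 'a" where
  "tuple7 a b c d e f g i = (if i = 1 then a else if i = 2 then b else if i = 3 then c
     else if i = 4 then d else if i = 5 then e else if i = 6 then f else g)"

lemma tuple7_simps [simp]:
  "tuple7 a b c d e f g 1 = a" "tuple7 a b c d e f g 2 = b" "tuple7 a b c d e f g 3 = c"
  "tuple7 a b c d e f g 4 = d" "tuple7 a b c d e f g 5 = e" "tuple7 a b c d e f g 6 = f"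
  "tuple7 a b c d e f g 7 = g"
  by (simp_all add: tuple7_def)

lemma tuple7_eta: "tuple7 (y 1) (y 2) (y 3) (y 4) (y 5) (y 6) (y 7) = y"
  by (simp add: fun_eq_iff forall_7)

lemma sum_tuple7:
  "(\<Sum>a\<in>UNIV. \<Sum>b\<in>UNIV. \<Sum>c\<in>UNIV. \<Sum>d\<in>UNIV. \<Sum>e\<in>UNIV. \<Sum>f\<in>UNIV. \<Sum>g\<in>UNIV. F (tuple7 a b c d e f g))
     = (\<Sum>y\<in>UNIV. F (y :: 7 \<Rightarrow> 'a::finite) :: real)"
proof -
  have "(\<Sum>y\<in>UNIV. F (y :: 7 \<Rightarrow> 'a)) = (\<Sum>(a,b,c,d,e,f,g)\<in>UNIV. F (tuple7 a b c d e f g))"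
    by (rule sum.reindex_bij_witness[where j = "\<lambda>y. (y 1, y 2, y 3, y 4, y 5, y 6, y 7)"
          and i = "\<lambda>(a,b,c,d,e,f,g). tuple7 a b c d e f g"])
       (auto simp: tuple7_eta)
  then show ?thesis
    by (simp add: UNIV_Times_UNIV[symmetric] sum.cartesian_product[symmetric] del: UNIV_Times_UNIV)
qed

text \<open>A self-map of a finite index set is either a permutation or repeats a row.\<close>

lemma det_rows_image:
  fixes M :: "real^'n^'n"
  shows "det (\<chi> i. M $ (b i)) = (if b permutes UNIV then of_int (sign b) * det M else 0)"
proof (cases "inj b")
  case True
  then have "bij b" by (simp add: finite_UNIV_inj_surj bij_def)
  then have "b permutes UNIV" by (metis UNIV_I bij_imp_permutes)
  then show ?thesis using det_permute_rows[of b M] by simp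
next
  case False
  then obtain i j where "i \<noteq> j" "b i = b j" by (auto simp: inj_def)
  then have "det (\<chi> i. M $ (b i)) = 0"
    by (intro det_identical_rows[of i j]) (auto simp: row_def)
  with False show ?thesis using permutes_inj by auto
qed

lemma sum_sign_rows:
  fixes M :: "real^7^7"
  shows "(\<Sum>s | s permutes UNIV. of_int (sign s) * (\<Prod>i\<in>UNIV. M$(b i)$(s i))) =
    (if b permutes UNIV then of_int (sign b) * det M else 0)"
  unfolding det_rows_image[symmetric] by (simp add: det_def)

lemma sum_sign_columns:
  fixes M :: "real^7^7"
  shows "(\<Sum>s | s permutes UNIV. of_int (sign s) * (\<Prod>i\<in>UNIV. M$(s i)$(b i))) =
    (if b permutes UNIV then of_int (sign b) * det M else 0)"
  using sum_sign_rows[of "transpose M" b] unfolding det_transpose by (simp add: transpose_def)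

text \<open>For 2-forms \<open>q\<close>, \<open>r\<close> and a 3-form \<open>p\<close> this is 24
  times the coefficient of the top form. The factors are kept apart because linearity in each one is
  what a change of frame uses.\<close>

definition wedge :: "ten2 \<Rightarrow> ten2 \<Rightarrow> ten3 \<Rightarrow> real" where
  "wedge q r p = (\<Sum>s | s permutes (UNIV :: 7 set).
     of_int (sign s) * q$(s 1)$(s 2) * r$(s 3)$(s 4) * p$(s 5)$(s 6)$(s 7))"

lemma wedge_form_wedge: "wedge_form p i j = wedge (p$i) (p$j) p / 24"
  by (simp add: wedge_form_def wedge_def)

lemma act_product:
  "act2 M q $ a $ b * act2 M r $ c $ d * act M p $ e $ f $ g =
   (\<Sum>y\<in>(UNIV::(7\<Rightarrow>7) set). (M$a$(y 1) * M$b$(y 2) * M$c$(y 3) * M$d$(y 4) * M$e$(y 5) * M$f$(y 6) * M$g$(y 7)) *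
      (q$(y 1)$(y 2) * r$(y 3)$(y 4) * p$(y 5)$(y 6)$(y 7)))"
  unfolding sum_tuple7[symmetric] tuple7_simps act2_nth act_nth
  by (simp only: mult.assoc, simp only: sum_distrib_right, simp only: sum_distrib_left)
     (simp only: mult_ac)

lemma wedge_act:
  "wedge (act2 M q) (act2 M r) (act M p) = det M * wedge q r p"
proof -
  have "of_int (sign s) * act2 M q$(s 1)$(s 2) * act2 M r$(s 3)$(s 4) * act M p$(s 5)$(s 6)$(s 7) =
     (\<Sum>y\<in>UNIV. (q$(y 1)$(y 2) * r$(y 3)$(y 4) * p$(y 5)$(y 6)$(y 7)) *
       (of_int (sign s) * (\<Prod>i\<in>UNIV. M$(s i)$(y i))))" for s :: "7 \<Rightarrow> 7"
  proof -
    have "of_int (sign s) * act2 M q$(s 1)$(s 2) * act2 M r$(s 3)$(s 4) * act M p$(s 5)$(s 6)$(s 7) =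
      of_int (sign s) * (act2 M q$(s 1)$(s 2) * act2 M r$(s 3)$(s 4) * act M p$(s 5)$(s 6)$(s 7))"
      by (simp only: mult.assoc)
    also have "\<dots> = (\<Sum>y\<in>UNIV. (q$(y 1)$(y 2) * r$(y 3)$(y 4) * p$(y 5)$(y 6)$(y 7)) *
       (of_int (sign s) * (\<Prod>i\<in>UNIV. M$(s i)$(y i))))"
      unfolding act_product sum_distrib_left prod_7
      by (rule sum.cong, rule refl) (simp only: mult.assoc mult.commute mult.left_commute)
    finally show ?thesis .
  qed
  then have "wedge (act2 M q) (act2 M r) (act M p) =
     (\<Sum>s | s permutes (UNIV :: 7 set). \<Sum>y\<in>UNIV. (q$(y 1)$(y 2) * r$(y 3)$(y 4) * p$(y 5)$(y 6)$(y 7)) *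
       (of_int (sign s) * (\<Prod>i\<in>UNIV. M$(s i)$(y i))))"
    unfolding wedge_def by simp
  \<comment> \<open>For a fixed multi-index \<open>y\<close> the signed sum over \<open>s\<close> is
    the determinant of the columns chosen by \<open>y\<close>; it survives only when
    \<open>y\<close> is a permutation.\<close>
  also have "\<dots> = (\<Sum>y\<in>UNIV. (q$(y 1)$(y 2) * r$(y 3)$(y 4) * p$(y 5)$(y 6)$(y 7)) *
       (if y permutes UNIV then of_int (sign y) * det M else 0))"
    by (subst sum.swap) (simp only: sum_distrib_left[symmetric] sum_sign_columns)
  also have "\<dots> = (\<Sum>y | y permutes UNIV. (q$(y 1)$(y 2) * r$(y 3)$(y 4) * p$(y 5)$(y 6)$(y 7)) *
       (of_int (sign y) * det M))"
    by (simp add: sum.If_cases if_distrib cong: if_cong)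
  also have "\<dots> = det M * wedge q r p"
    by (simp add: wedge_def sum_distrib_left mult_ac)
  finally show ?thesis .
qed

lemma wedge_sum_left: "wedge (\<Sum>a\<in>A. c a *\<^sub>R q a) r p = (\<Sum>a\<in>A. c a * wedge (q a) r p)"
  unfolding wedge_def sum_distrib_left
  by (subst sum.swap) (simp add: sum_distrib_left sum_distrib_right mult_ac)

lemma wedge_sum_mid: "wedge q (\<Sum>a\<in>A. c a *\<^sub>R r a) p = (\<Sum>a\<in>A. c a * wedge q (r a) p)"
  unfolding wedge_def sum_distrib_left
  by (subst sum.swap) (simp add: sum_distrib_left sum_distrib_right mult_ac)

definition wmat :: "ten3 \<Rightarrow> ten2" where
  "wmat p = (\<chi> i j. wedge_form p i j)"

text \<open>The two contracted slots transform by \<open>M\<close> and the top form by its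
  determinant. The laws for metric and volume come from separating these two factors.\<close>

lemma wmat_act: "wmat (act M p) = det M *\<^sub>R (M ** wmat p ** transpose M)"
proof -
  have "wedge_form (act M p) i j =
      det M * (\<Sum>a\<in>UNIV. \<Sum>b\<in>UNIV. M$i$a * M$j$b * wedge_form p a b)" for i j
    unfolding wedge_form_wedge act_slice wedge_sum_left unfolding wedge_sum_mid wedge_act
    by (simp add: sum_distrib_left sum_divide_distrib mult_ac)
  then show ?thesis
    unfolding act2_matrix[symmetric] by (simp add: vec_eq_iff wmat_def act2_nth)
qed

lemma wedge_commute: "wedge q r p = wedge r q p"
proof -
  \<comment> \<open>The slot pairs 1, 2 and 3, 4 trade places; these are two transpositions, so no
    sign appears.\<close>
  define t where "t = Transposition.transpose 1 3 \<circ> Transposition.transpose 2 (4::7)"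
  have t: "t permutes UNIV" "sign t = 1"
    unfolding t_def by (auto intro!: permutes_compose permutes_swap_id simp: sign_compose
        permutation_swap_id sign_swap_id)
  have tv: "t 1 = 3" "t 2 = 4" "t 3 = 1" "t 4 = 2" "t 5 = 5" "t 6 = 6" "t 7 = 7"
    by (simp_all add: t_def Transposition.transpose_def)
  have perm: "permutation s" if "s permutes (UNIV::7 set)" for s
    using that by (auto simp: permutation_permutes)
  have "wedge q r p = (\<Sum>s | s permutes (UNIV :: 7 set). of_int (sign (s \<circ> t)) *
      q$((s \<circ> t) 1)$((s \<circ> t) 2) * r$((s \<circ> t) 3)$((s \<circ> t) 4) * p$((s \<circ> t) 5)$((s \<circ> t) 6)$((s \<circ> t) 7))"
    unfolding wedge_def by (rule sum_permutations_compose_right) (rule t)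
  also have "\<dots> = wedge r q p"
    unfolding wedge_def using perm t
    by (intro sum.cong) (auto simp: tv sign_compose mult_ac)
  finally show ?thesis .
qed

lemma wmat_sym: "transpose (wmat p) = wmat p"
  unfolding vec_eq_iff wmat_def wedge_form_wedge transpose_def by (simp, metis wedge_commute)

subsection \<open>Naturality under linear maps\<close>

text \<open>The dual without its volume factor: a contraction with the permutation symbol. It knows
  nothing of the metric, so its behaviour under matrices is pure determinant algebra.\<close>

definition hodge :: "ten3 \<Rightarrow> ten4" where
  "hodge R = (\<chi> a b c d. \<Sum>s | s permutes (UNIV :: 7 set) \<and> s 4 = a \<and> s 5 = b \<and> s 6 = c \<and> s 7 = d.
     of_int (sign s) * R$(s 1)$(s 2)$(s 3))"

lemma psi_hodge: "psi p = (vol p / 6) *\<^sub>R hodge (act (ginv p) p)"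
proof -
  have "raise3 p = act (ginv p) p"
    by (simp add: vec_eq_iff act_nth raise3_def)
  then show ?thesis by (simp add: vec_eq_iff psi_def hodge_def)
qed

lemma act4_nth: "act4 M t $ a $ b $ c $ d = (\<Sum>a'\<in>UNIV. \<Sum>b'\<in>UNIV. \<Sum>c'\<in>UNIV. \<Sum>d'\<in>UNIV.
    M$a$a' * M$b$b' * M$c$c' * M$d$d' * t$a'$b'$c'$d')"
  by (simp add: act4_def slot_nth act_nth sum_distrib_left mult_ac)

lemma hodge_nth_sum:
  "(\<Sum>a\<in>UNIV. \<Sum>b\<in>UNIV. \<Sum>c\<in>UNIV. \<Sum>d\<in>UNIV. F a b c d * hodge R $ a $ b $ c $ d) =
   (\<Sum>s | s permutes (UNIV :: 7 set). of_int (sign s) * R$(s 1)$(s 2)$(s 3) * F (s 4) (s 5) (s 6) (s 7))"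
proof -
  let ?f = "\<lambda>s. of_int (sign s) * R$(s 1)$(s 2)$(s 3) * F (s 4) (s 5) (s 6) (s 7)"
  let ?g = "\<lambda>s::7\<Rightarrow>7. (s 4, s 5, s 6, s 7)"
  have "(\<Sum>s | s permutes (UNIV :: 7 set). ?f s) =
      (\<Sum>z\<in>UNIV. sum ?f {s \<in> {s. s permutes (UNIV :: 7 set)}. ?g s = z})"
    by (rule sum.group[symmetric]) (auto simp: finite_permutations)
  also have "\<dots> = (\<Sum>(a,b,c,d)\<in>UNIV. F a b c d * hodge R $ a $ b $ c $ d)"
    by (rule sum.cong) (auto simp: hodge_def sum_distrib_left intro!: sum.cong)
  finally show ?thesis
    by (simp add: UNIV_Times_UNIV[symmetric] sum.cartesian_product[symmetric] del: UNIV_Times_UNIV)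
qed

text \<open>The transposed matrices on the three contracted slots can be moved onto the permutation
  symbol, which then carries \<open>M\<close> in all seven slots and reproduces itself times
  \<open>det M\<close>.\<close>

lemma hodge_act: "act4 M (hodge (act (transpose M) R)) = det M *\<^sub>R hodge R"
proof -
  have "act4 M (hodge (act (transpose M) R)) $ a $ b $ c $ d = det M * hodge R $ a $ b $ c $ d" for a b c d
  proof -
    \<comment> \<open>A choice of rows: the three contracted indices followed by the four free
      ones.\<close>
    define T where "T = (\<lambda>i j k. tuple7 i j k a b c d)"
    have "act4 M (hodge (act (transpose M) R)) $ a $ b $ c $ d =
      (\<Sum>s | s permutes (UNIV :: 7 set). of_int (sign s) * act (transpose M) R$(s 1)$(s 2)$(s 3) *
        (M$a$(s 4) * M$b$(s 5) * M$c$(s 6) * M$d$(s 7)))"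
      unfolding act4_nth by (rule hodge_nth_sum)
    also have "\<dots> = (\<Sum>s | s permutes (UNIV :: 7 set). \<Sum>i\<in>UNIV. \<Sum>j\<in>UNIV. \<Sum>k\<in>UNIV.
        R$i$j$k * (of_int (sign s) * (\<Prod>l\<in>UNIV. M$(T i j k l)$(s l))))"
      unfolding act_nth
      by (intro sum.cong refl)
         (simp add: sum_distrib_left sum_distrib_right prod_7 T_def transpose_def mult_ac)
    also have "\<dots> = (\<Sum>i\<in>UNIV. \<Sum>j\<in>UNIV. \<Sum>k\<in>UNIV. \<Sum>s | s permutes (UNIV :: 7 set).
        R$i$j$k * (of_int (sign s) * (\<Prod>l\<in>UNIV. M$(T i j k l)$(s l))))"
      by (subst sum.swap, intro sum.cong refl, subst sum.swap, intro sum.cong refl, rule sum.swap)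
    also have "\<dots> = (\<Sum>i\<in>UNIV. \<Sum>j\<in>UNIV. \<Sum>k\<in>UNIV. R$i$j$k *
        (if T i j k permutes UNIV then of_int (sign (T i j k)) * det M else 0))"
      by (simp only: sum_distrib_left[symmetric] sum_sign_rows)
    also have "\<dots> = det M * (\<Sum>i\<in>UNIV. \<Sum>j\<in>UNIV. \<Sum>k\<in>UNIV.
        if T i j k permutes UNIV then of_int (sign (T i j k)) * R$i$j$k else 0)"
      unfolding sum_distrib_left by (intro sum.cong refl) simp
    also have "(\<Sum>i\<in>UNIV. \<Sum>j\<in>UNIV. \<Sum>k\<in>UNIV.
        if T i j k permutes UNIV then of_int (sign (T i j k)) * R$i$j$k else 0) =
      (\<Sum>(i,j,k)\<in>UNIV. if T i j k permutes UNIV then of_int (sign (T i j k)) * R$i$j$k else 0)"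
      by (simp add: UNIV_Times_UNIV[symmetric] sum.cartesian_product[symmetric] del: UNIV_Times_UNIV)
    also have "\<dots> = (\<Sum>(i,j,k) | T i j k permutes UNIV. of_int (sign (T i j k)) * R$i$j$k)"
      by (rule sum.mono_neutral_cong_right) (auto split: if_splits)
    also have "\<dots> = hodge R $ a $ b $ c $ d"
      unfolding hodge_def
      by (simp, rule sum.reindex_bij_witness[where j = "\<lambda>(i,j,k). T i j k" and i = "\<lambda>s. (s 1, s 2, s 3)"])
         (auto simp: T_def tuple7_eta)
    finally show ?thesis .
  qed
  then show ?thesis by (simp add: vec_eq_iff)
qed

lemma determines_act:
  assumes "determines p g v" "det M \<noteq> 0"
  shows "determines (act M p) (M ** g ** transpose M) (det M * v)"
proof -
  note d = assms(1)[unfolded determines_def]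
  have inv: "transpose M *v X \<noteq> 0" if "X \<noteq> 0" for X
    using that assms(2) by (metis det_transpose invertible_det_nz matrix_left_invertible_ker
        invertible_def)
  have "wmat p = (- 6 * v) *\<^sub>R g" using d by (simp add: vec_eq_iff wmat_def)
  then have "wmat (act M p) = (- 6 * (det M * v)) *\<^sub>R (M ** g ** transpose M)"
    unfolding wmat_act by (simp only: matrix_scalar_ac scalar_matrix_assoc[symmetric] scaleR_scaleR mult_ac)
  then have "wedge_form (act M p) i j = - 6 * (M ** g ** transpose M)$i$j * (det M * v)" for i j
    unfolding vec_eq_iff wmat_def by simp
  moreover have "X \<bullet> ((M ** g ** transpose M) *v X) > 0" if "X \<noteq> 0" for X
  proof -
    have "X \<bullet> ((M ** g ** transpose M) *v X) = (transpose M *v X) \<bullet> (g *v (transpose M *v X))"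
      by (simp add: matrix_vector_mul_assoc[symmetric] dot_lmul_matrix[symmetric] 
          vector_transpose_matrix transpose_matrix_vector)
    then show ?thesis using d inv[OF that] by simp
  qed
  moreover have "\<bar>det M * v\<bar> = sqrt (det (M ** g ** transpose M))"
    using d by (simp add: det_mul abs_mult real_sqrt_mult)
  moreover have "transpose (M ** g ** transpose M) = M ** g ** transpose M"
    using d by (simp add: matrix_transpose_mul matrix_mul_assoc)
  ultimately show ?thesis unfolding determines_def by blast
qed

lemma pos_def_det_pos:
  fixes g :: ten2
  assumes "determines p g v"
  shows "det g > 0" "v \<noteq> 0"
proof -
  note d = assms[unfolded determines_def]
  have "invertible g"
    unfolding invertible_left_inverse matrix_left_invertible_ker using d by (metis inner_zero_right less_irrefl)
  then have "det g \<noteq> 0" by (simp add: invertible_det_nz)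
  moreover have "det g \<ge> 0" using d by (metis abs_ge_zero real_sqrt_ge_0_iff)
  ultimately show "det g > 0" by simp
  then show "v \<noteq> 0" using d by auto
qed

lemma det_scaleR: "det (c *\<^sub>R A) = c ^ CARD('n) * det (A :: real^'n^'n)"
  unfolding det_def
  by (simp add: sum_distrib_left prod.distrib algebra_simps)

text \<open>Seven factors \<open>v\<close> come from scaling a 7 x 7 matrix and two from
  \<open>det g = v^2\<close>. The power 9 is odd, so \<open>v\<close> is recovered together with its
  sign, and then \<open>g\<close>.\<close>

lemma determines_wmat:
  assumes "determines p g v"
  shows "wmat p = (- 6 * v) *\<^sub>R g" "det (wmat p) = (- 6)^7 * v ^ 9"
    "v = root 9 (det (wmat p) / (- 6)^7)" "g = (- 1 / (6 * v)) *\<^sub>R wmat p"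
proof -
  note d = assms[unfolded determines_def]
  show w: "wmat p = (- 6 * v) *\<^sub>R g" using d by (simp add: vec_eq_iff wmat_def)
  have "det g = v^2" using d pos_def_det_pos[OF assms]
    by (metis less_imp_le power2_abs real_sqrt_pow2)
  then show dw: "det (wmat p) = (- 6)^7 * v ^ 9"
    unfolding w det_scaleR by (simp add: power_mult_distrib)
  then show "v = root 9 (det (wmat p) / (- 6)^7)"
    by (simp add: odd_real_root_unique)
  show "g = (- 1 / (6 * v)) *\<^sub>R wmat p"
    using w pos_def_det_pos[OF assms] by simp
qed

lemma determines_unique:
  assumes "determines p g v" "determines p g' v'" shows "g = g'" "v = v'"
  using determines_wmat(3,4)[OF assms(1)] determines_wmat(3,4)[OF assms(2)] by metis+

lemma metric_eqI: "determines p g v \<Longrightarrow> metric p = g"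
  unfolding metric_def using determines_unique(1) by (intro the_equality) blast+

lemma vol_eqI: "determines p g v \<Longrightarrow> vol p = v"
  unfolding vol_def using determines_unique(2) by (intro the_equality) blast+

lemma nondegenerate_determines: "nondegenerate p \<Longrightarrow> determines p (metric p) (vol p)"
  unfolding nondegenerate_def using metric_eqI vol_eqI by fastforce

lemma nondegenerate_act: "nondegenerate p \<Longrightarrow> det M \<noteq> 0 \<Longrightarrow> nondegenerate (act M p)"
  using determines_act unfolding nondegenerate_def by blast

lemma metric_act: "nondegenerate p \<Longrightarrow> det M \<noteq> 0 \<Longrightarrow> metric (act M p) = M ** metric p ** transpose M"
  using determines_act nondegenerate_determines metric_eqI by blast

lemma vol_act: "nondegenerate p \<Longrightarrow> det M \<noteq> 0 \<Longrightarrow> vol (act M p) = det M * vol p"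
  using determines_act nondegenerate_determines vol_eqI by blast

lemma ginv_inverse:
  assumes "nondegenerate p" shows "ginv p ** metric p = mat 1" "metric p ** ginv p = mat 1"
proof -
  have "invertible (metric p)"
    using pos_def_det_pos[OF nondegenerate_determines[OF assms]] by (simp add: invertible_det_nz)
  then show "ginv p ** metric p = mat 1" "metric p ** ginv p = mat 1"
    unfolding ginv_def matrix_inv_def invertible_def by (metis (mono_tags, lifting) someI_ex)+
qed

lemma metric_sym: "nondegenerate p \<Longrightarrow> transpose (metric p) = metric p"
  using nondegenerate_determines unfolding determines_def by blast

lemma ginv_unique: assumes "nondegenerate p" "metric p ** A = mat 1" shows "ginv p = A"
  by (metis assms ginv_inverse(1) matrix_mul_assoc matrix_mul_lid matrix_mul_rid)

lemma ginv_sym: assumes "nondegenerate p" shows "transpose (ginv p) = ginv p"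
  by (metis assms ginv_inverse ginv_unique matrix_transpose_mul metric_sym transpose_mat)

lemma ginv_act:
  assumes "nondegenerate p" "N ** M = mat 1"
  shows "ginv (act M p) = transpose N ** ginv p ** N"
proof (rule ginv_unique)
  have d: "det M \<noteq> 0" using assms(2) by (metis invertible_det_nz invertible_left_inverse)
  have MN: "M ** N = mat 1" using assms(2) matrix_left_right_inverse by blast
  show "nondegenerate (act M p)" using nondegenerate_act[OF assms(1) d] .
  have "M ** metric p ** transpose M ** (transpose N ** ginv p ** N) =
    M ** (metric p ** (transpose (N ** M) ** (ginv p ** N)))"
    by (simp add: matrix_mul_assoc matrix_transpose_mul)
  also have "\<dots> = mat 1"
    using MN by (simp add: assms(2) transpose_mat) (simp add: matrix_mul_assoc ginv_inverse[OF assms(1)])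
  finally show "metric (act M p) ** (transpose N ** ginv p ** N) = mat 1"
    using metric_act[OF assms(1) d] by simp
qed

text \<open>On raised components \<open>act M\<close> becomes the action of the inverse transpose,
  which is the shape that \<open>hodge_act\<close> expects; its determinant is the one by which the
  volume scales.\<close>

lemma psi_act:
  assumes "nondegenerate p" "det M \<noteq> 0" shows "psi (act M p) = act4 M (psi p)"
proof -
  obtain N where N: "N ** M = mat 1"
    using assms(2) by (metis invertible_det_nz invertible_left_inverse)
  have "act (ginv (act M p)) (act M p) = act (transpose N) (act (ginv p) p)"
    unfolding ginv_act[OF assms(1) N] act_act
    by (metis N matrix_mul_assoc matrix_mul_rid)
  then have eq: "act (ginv p) p = act (transpose M) (act (ginv (act M p)) (act M p))"
    by (simp add: act_act) (metis N act_1 act_act matrix_transpose_mul transpose_mat)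
  have lin: "act4 M (c *\<^sub>R t) = c *\<^sub>R act4 M t" for c t
    unfolding act4_def by (simp add: linear_scale linear_slot linear_vmap linear_act)
  show ?thesis
    unfolding psi_hodge[of "act M p"] psi_hodge[of p] lin vol_act[OF assms]
    by (subst eq) (simp add: hodge_act mult_ac)
qed

subsection \<open>Expanding alternating sums\<close>

text \<open>In the type \<open>7\<close> numerals are residues and 7 equals 0, so the order 1, ...,
  7 is imposed by hand. It guards the sorting rules below: a swap fires only on a misplaced pair,
  hence rewriting terminates.\<close>

definition rk :: "7 \<Rightarrow> nat" where
  "rk = tuple7 1 2 3 4 5 6 7"

lemma rk_simps [simp]: "rk 1 = 1" "rk 2 = 2" "rk 3 = 3" "rk 4 = 4" "rk 5 = 5" "rk 6 = 6" "rk 7 = 7"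
  by (simp_all add: rk_def)

definition alt2 :: "(7 \<Rightarrow> 7 \<Rightarrow> real) \<Rightarrow> bool" where
  "alt2 q \<longleftrightarrow> (\<forall>i j. q i j = - q j i)"

definition alt3 :: "(7 \<Rightarrow> 7 \<Rightarrow> 7 \<Rightarrow> real) \<Rightarrow> bool" where
  "alt3 p \<longleftrightarrow> (\<forall>i j k. p i j k = - p j i k \<and> p i j k = - p i k j)"

lemma alt2_sort: assumes "alt2 q"
  shows "q i i = 0" "rk b < rk a \<Longrightarrow> q a b = - q b a"
proof -
  show "q a b = - q b a" for a b using assms unfolding alt2_def by blast
  from this[of i i] show "q i i = 0" by simp
qed

lemma alt3_sort: assumes "alt3 p"
  shows "p i i k = 0" "p i k k = 0" "p i k i = 0" "rk b < rk a \<Longrightarrow> p a b k = - p b a k"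
    "rk b < rk a \<Longrightarrow> p i a b = - p i b a"
proof -
  have *: "p i j k = - p j i k" "p i j k = - p i k j" for i j k
    using assms unfolding alt3_def by blast+
  show 0: "p i i k = 0" for i k using *(1)[of i i k] by simp
  show "p i k k = 0" using *(2)[of i k k] by simp
  show "p i k i = 0" using *(2)[of i k i] 0 by simp
  show "p a b k = - p b a k" by (rule *)
  show "p i a b = - p i b a" by (rule *)
qed

text \<open>Each permutation of the larger set is uniquely a permutation of \<open>S\<close>
  followed by the swap of \<open>a\<close> with its image; the swap is odd unless it is
  trivial.\<close>

lemma sum_permutes_insert:
  fixes F :: "(7 \<Rightarrow> 7) \<Rightarrow> real"
  assumes "a \<notin> S"
  shows "(\<Sum>s | s permutes insert a S. of_int (sign s) * F s) =
    (\<Sum>s | s permutes S. of_int (sign s) * F s) +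
    (\<Sum>b\<in>S. - (\<Sum>s | s permutes S. of_int (sign s) * F (Transposition.transpose a b \<circ> s)))"
proof -
  have fin: "finite S" by simp
  have perm: "permutation s" if "s permutes S" for s
    using that fin by (auto simp: permutation_permutes)
  have sgn: "sign (Transposition.transpose a b \<circ> s) = (if a = b then 1 else - 1) * sign s"
    if "s permutes S" for b s
    using perm[OF that] by (simp add: sign_compose permutation_swap_id sign_swap_id)
  have "(\<Sum>s | s permutes insert a S. of_int (sign s) * F s) =
    (\<Sum>b\<in>insert a S. \<Sum>s | s permutes S. of_int (sign (Transposition.transpose a b \<circ> s)) *
       F (Transposition.transpose a b \<circ> s))"
    by (rule sum_over_permutations_insert[OF fin assms])
  also have "\<dots> = (\<Sum>s | s permutes S. of_int (sign s) * F s) +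
    (\<Sum>b\<in>S. \<Sum>s | s permutes S. of_int (sign (Transposition.transpose a b \<circ> s)) *
       F (Transposition.transpose a b \<circ> s))"
    using assms by simp
  also have "(\<Sum>b\<in>S. \<Sum>s | s permutes S. of_int (sign (Transposition.transpose a b \<circ> s)) *
       F (Transposition.transpose a b \<circ> s)) = 
    (\<Sum>b\<in>S. - (\<Sum>s | s permutes S. of_int (sign s) * F (Transposition.transpose a b \<circ> s)))"
    unfolding sum_negf[symmetric] using assms by (intro sum.cong refl) (auto simp: sgn)
  finally show ?thesis .
qed

lemma sum_permutes_567:
  assumes "alt3 p"
  shows "(\<Sum>s | s permutes {5, 6, 7}. of_int (sign s) * p (s 5) (s 6) (s (7::7))) = 6 * p (5::7) 6 7"
  by (simp add: sum_permutes_insert[of 5 "{6, 7}"] sum_permutes_insert[of 6 "{7}"] sign_id permutes_sing)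
    (simp add: Transposition.transpose_def alt3_sort[OF assms])

text \<open>A component of the 5-form r wedge p: one signed term for each of the ten ways to hand
  two of the five indices to \<open>r\<close>.\<close>

definition wedge5 :: "(7 \<Rightarrow> 7 \<Rightarrow> real) \<Rightarrow> (7 \<Rightarrow> 7 \<Rightarrow> 7 \<Rightarrow> real) \<Rightarrow> 7 \<Rightarrow> 7 \<Rightarrow> 7 \<Rightarrow> 7 \<Rightarrow> 7 \<Rightarrow> real" where
  "wedge5 r p a b c d e =
     r a b * p c d e - r a c * p b d e + r a d * p b c e - r a e * p b c d
     + r b c * p a d e - r b d * p a c e + r b e * p a c d
     + r c d * p a b e - r c e * p a b d + r d e * p a b c"

lemma wedge5_sort:
  assumes "alt2 r" "alt3 p" "rk y < rk x"
  shows "wedge5 r p x y c d e = - wedge5 r p y x c d e"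
    "wedge5 r p a x y d e = - wedge5 r p a y x d e"
    "wedge5 r p a b x y e = - wedge5 r p a b y x e"
    "wedge5 r p a b c x y = - wedge5 r p a b c y x"
proof -
  have "r x y = - r y x" "p x y z = - p y x z" "p z x y = - p z y x" "p x z y = - p y z x" for z
    using assms(1,2) unfolding alt2_def alt3_def by (metis minus_minus)+
  then show "wedge5 r p x y c d e = - wedge5 r p y x c d e"
    "wedge5 r p a x y d e = - wedge5 r p a y x d e"
    "wedge5 r p a b x y e = - wedge5 r p a b y x e"
    "wedge5 r p a b c x y = - wedge5 r p a b c y x"
    unfolding wedge5_def by (simp_all add: algebra_simps)
qed

text \<open>12 = 2! 3! counts the permutations that only reorder indices inside one factor.\<close>

lemma sum_permutes_34567:
  assumes "alt2 r" "alt3 p"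
  shows "(\<Sum>s | s permutes {3, 4, 5, 6, 7}. of_int (sign s) * (r (s 3) (s 4) * p (s 5) (s 6) (s (7::7)))) =
     12 * wedge5 r p (3::7) 4 5 6 7"
proof -
  have fix_s: "s 3 = 3" "s 4 = 4" if "s permutes {5, 6, 7::7}" for s
    using that by (auto simp: permutes_not_in)
  \<comment> \<open>The relabelling \<open>f\<close> is needed because the swaps peeled off on the
    outside act on the values of the remaining permutation.\<close>
  have L: "(\<Sum>s | s permutes {5, 6, 7}. of_int (sign s) * (r (f (s 3)) (f (s 4)) * p (f (s 5)) (f (s 6)) (f (s 7)))) =
     6 * (r (f 3) (f 4) * p (f 5) (f 6) (f 7))" for f :: "7 \<Rightarrow> 7"
  proof -
    have "(\<Sum>s | s permutes {5, 6, 7}. of_int (sign s) * (r (f (s 3)) (f (s 4)) * p (f (s 5)) (f (s 6)) (f (s 7)))) =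
      r (f 3) (f 4) * (\<Sum>s | s permutes {5, 6, 7}. of_int (sign s) * p (f (s 5)) (f (s 6)) (f (s 7)))"
      unfolding sum_distrib_left by (intro sum.cong refl) (simp add: fix_s)
    also have "\<dots> = r (f 3) (f 4) * (6 * p (f 5) (f 6) (f 7))"
    proof -
      have "alt3 (\<lambda>i j k. p (f i) (f j) (f k))" using assms(2) unfolding alt3_def by blast
      from sum_permutes_567[OF this] show ?thesis by simp
    qed
    finally show ?thesis by simp
  qed
  show ?thesis
    using L[of "\<lambda>x. x"]
    by (simp add: sum_permutes_insert[of 3 "{4, 5, 6, 7}"] sum_permutes_insert[of 4 "{5, 6, 7}"]
        L[of "Transposition.transpose _ _"] L[of "\<lambda>x. Transposition.transpose _ _ (Transposition.transpose _ _ x)"])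
      (simp add: Transposition.transpose_def alt2_sort[OF assms(1)]
       alt3_sort[OF assms(2)] wedge5_def)
qed

text \<open>Only shuffles remain: 21 pairs for \<open>q\<close> times ten for \<open>r\<close>,
  instead of 5040 permutations, with 24 = 2! 2! 3! collected in front. All later component
  computations with \<open>wedge\<close> rest on this.\<close>

lemma wedge_expand:
  fixes q r :: ten2 and p :: ten3
  assumes "alt2 (\<lambda>i j. q$i$j)" "alt2 (\<lambda>i j. r$i$j)" "alternating3 p"
  defines "W \<equiv> wedge5 (\<lambda>i j. r$i$j) (\<lambda>i j k. p$i$j$k)"
  shows "wedge q r p = 24 *
    (q$1$2 * W 3 4 5 6 7 - q$1$3 * W 2 4 5 6 7 + q$1$4 * W 2 3 5 6 7 - q$1$5 * W 2 3 4 6 7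
     + q$1$6 * W 2 3 4 5 7 - q$1$7 * W 2 3 4 5 6 + q$2$3 * W 1 4 5 6 7 - q$2$4 * W 1 3 5 6 7
     + q$2$5 * W 1 3 4 6 7 - q$2$6 * W 1 3 4 5 7 + q$2$7 * W 1 3 4 5 6 + q$3$4 * W 1 2 5 6 7
     - q$3$5 * W 1 2 4 6 7 + q$3$6 * W 1 2 4 5 7 - q$3$7 * W 1 2 4 5 6 + q$4$5 * W 1 2 3 6 7
     - q$4$6 * W 1 2 3 5 7 + q$4$7 * W 1 2 3 5 6 + q$5$6 * W 1 2 3 4 7 - q$5$7 * W 1 2 3 4 6
     + q$6$7 * W 1 2 3 4 5)"
proof -
  have alt: "alt3 (\<lambda>i j k. p$i$j$k)" using assms(3) unfolding alt3_def alternating3_def by blast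
  have fix_s: "s 1 = 1" "s 2 = 2" if "s permutes {3, 4, 5, 6, 7::7}" for s
    using that by (auto simp: permutes_not_in)
  let ?F = "\<lambda>f s. q$(f (s 1))$(f (s 2)) * (r$(f (s 3))$(f (s 4)) * p$(f (s 5))$(f (s 6))$(f (s 7)))"
  have L: "(\<Sum>s | s permutes {3, 4, 5, 6, 7}. of_int (sign s) * ?F f s) =
     12 * (q$(f 1)$(f 2) * W (f 3) (f 4) (f 5) (f 6) (f 7))" for f :: "7 \<Rightarrow> 7"
  proof -
    have "(\<Sum>s | s permutes {3, 4, 5, 6, 7}. of_int (sign s) * ?F f s) =
      q$(f 1)$(f 2) * (\<Sum>s | s permutes {3, 4, 5, 6, 7}. of_int (sign s) *
         (r$(f (s 3))$(f (s 4)) * p$(f (s 5))$(f (s 6))$(f (s 7))))"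
      unfolding sum_distrib_left by (intro sum.cong refl) (simp add: fix_s)
    also have "\<dots> = q$(f 1)$(f 2) * (12 * W (f 3) (f 4) (f 5) (f 6) (f 7))"
    proof -
      have "alt3 (\<lambda>i j k. p$(f i)$(f j)$(f k))" using alt unfolding alt3_def by blast
      moreover have "alt2 (\<lambda>i j. r$(f i)$(f j))" using assms(2) unfolding alt2_def by blast
      ultimately show ?thesis
        using sum_permutes_34567[of "\<lambda>i j. r$(f i)$(f j)" "\<lambda>i j k. p$(f i)$(f j)$(f k)"]
        by (simp add: W_def wedge5_def)
    qed
    finally show ?thesis by simp
  qed
  have "wedge q r p = (\<Sum>s | s permutes {1, 2, 3, 4, 5, 6, 7}. of_int (sign s) * ?F (\<lambda>x. x) s)"
    unfolding wedge_def UNIV_7 by (simp add: mult.assoc)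
  then show ?thesis
    using L[of "\<lambda>x. x"]
    by (simp add: sum_permutes_insert[of 1 "{2, 3, 4, 5, 6, 7}"] sum_permutes_insert[of 2 "{3, 4, 5, 6, 7}"]
        L[of "Transposition.transpose _ _"] L[of "\<lambda>x. Transposition.transpose _ _ (Transposition.transpose _ _ x)"])
      (simp add: Transposition.transpose_def alt2_sort[OF assms(1)]
       wedge5_sort[OF assms(2) alt, folded W_def])
qed

subsection \<open>Orthonormal frames\<close>

text \<open>Gram-Schmidt by a dimension count: a vector that is Euclidean-orthogonal to all
  \<open>g *v e j\<close> is g-orthogonal to all \<open>e j\<close>.\<close>

lemma orthonormal_extension:
  fixes g :: ten2 and e :: "7 \<Rightarrow> vec7"
  assumes sym: "transpose g = g" and pos: "\<And>X. X \<noteq> 0 \<Longrightarrow> X \<bullet> (g *v X) > 0"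
    and "\<And>i j. i \<in> S \<Longrightarrow> j \<in> S \<Longrightarrow> e i \<bullet> (g *v e j) = (if i = j then 1 else 0)"
  shows "\<exists>e'. (\<forall>i\<in>S. e' i = e i) \<and> (\<forall>i j. e' i \<bullet> (g *v e' j) = (if i = j then 1 else 0))"
  using assms(3)
proof (induction "card (- S)" arbitrary: S e)
  case 0
  then have "S = UNIV" by auto
  with 0 show ?case by auto
next
  case (Suc n)
  then obtain i where i: "i \<notin> S" by (metis card.empty compl_bot_eq ComplI UNIV_eq_I nat.distinct(1) double_complement)
  have "dim ((\<lambda>j. g *v e j) ` S) < DIM(vec7)"
  proof -
    have "dim ((\<lambda>j. g *v e j) ` S) \<le> card S"
      by (meson card_image_le dim_le_card' finite finite_imageI order_trans)
    also have "\<dots> < card (UNIV :: 7 set)" using i by (intro psubset_card_mono) auto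
    finally show ?thesis by simp
  qed
  then obtain x where x: "x \<noteq> 0" "\<And>y. y \<in> span ((\<lambda>j. g *v e j) ` S) \<Longrightarrow> orthogonal x y"
    using orthogonal_to_subspace_exists by blast
  define z where "z = (1 / sqrt (x \<bullet> (g *v x))) *\<^sub>R x"
  have z1: "z \<bullet> (g *v z) = 1"
    using pos[OF x(1)] by (simp add: z_def matrix_vector_mult_scaleR real_sqrt_mult_self)
  have z0: "z \<bullet> (g *v e j) = 0" if "j \<in> S" for j
    using x(2)[OF span_base, of "g *v e j"] that by (simp add: z_def orthogonal_def)
  have comm: "X \<bullet> (g *v Y) = Y \<bullet> (g *v X)" for X Y
    by (metis dot_lmul_matrix inner_commute sym transpose_matrix_vector)
  let ?e = "e(i := z)"
  have "n = card (- insert i S)" using Suc.hyps(2) i by (simp add: Compl_insert card_Diff_singleton)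
  moreover have "?e j \<bullet> (g *v ?e k) = (if j = k then 1 else 0)" if "j \<in> insert i S" "k \<in> insert i S" for j k
    using that z1 z0 Suc.prems comm i by (auto split: if_splits)
  ultimately obtain e' where "\<forall>j\<in>insert i S. e' j = ?e j" "\<forall>i j. e' i \<bullet> (g *v e' j) = (if i = j then 1 else 0)"
    using Suc.hyps(1)[of "insert i S" ?e] by auto
  with i show ?case by (metis fun_upd_other insertCI)
qed

lemma row_congruence: "((\<chi> i. e i) ** g ** transpose (\<chi> i. e i)) $ i $ j = e i \<bullet> (g *v (e j :: vec7))"
  unfolding dot_lmul_matrix[symmetric]
  by (simp add: matrix_matrix_mult_def inner_vec_def vector_matrix_mult_def transpose_def mult_ac)

lemma congruent_identity:
  fixes e :: "7 \<Rightarrow> vec7"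
  assumes "\<forall>i j. e i \<bullet> (g *v e j) = (if i = j then 1 else 0)"
  shows "(\<chi> i. e i) ** g ** transpose (\<chi> i. e i) = mat 1"
  using assms by (simp add: vec_eq_iff row_congruence mat_def)

text \<open>The covector p(x, y, -) of two vectors. No metric enters; in an orthonormal frame it is
  their cross product.\<close>

definition crs :: "ten3 \<Rightarrow> vec7 \<Rightarrow> vec7 \<Rightarrow> vec7" where
  "crs p x y = (\<chi> k. \<Sum>a\<in>UNIV. \<Sum>b\<in>UNIV. x$a * y$b * p$a$b$k)"

lemma sum_rotate: "(\<Sum>a\<in>A. \<Sum>b\<in>B. \<Sum>c\<in>C. f a b c) = (\<Sum>c\<in>C. \<Sum>a\<in>A. \<Sum>b\<in>B. f a b c)"
proof -
  have "(\<Sum>a\<in>A. \<Sum>b\<in>B. \<Sum>c\<in>C. f a b c) = (\<Sum>a\<in>A. \<Sum>c\<in>C. \<Sum>b\<in>B. f a b c)"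
    by (rule sum.cong[OF refl], rule sum.swap)
  also have "\<dots> = (\<Sum>c\<in>C. \<Sum>a\<in>A. \<Sum>b\<in>B. f a b c)" by (rule sum.swap)
  finally show ?thesis .
qed

lemma crs_inner: "crs p x y \<bullet> z = (\<Sum>a\<in>UNIV. \<Sum>b\<in>UNIV. \<Sum>c\<in>UNIV. x$a * y$b * z$c * p$a$b$c)"
  by (subst sum_rotate) (simp add: crs_def inner_vec_def sum_distrib_left sum_distrib_right mult_ac)

lemma act_rows: "act (\<chi> i. e i) p $ i $ j $ k = crs p (e i) (e j) \<bullet> e k"
  by (simp add: act_nth crs_inner)

lemma alternating3_alt3: "alternating3 p \<Longrightarrow> alt3 (\<lambda>i j k. p$i$j$k)"
  unfolding alternating3_def alt3_def by blast

lemma crs_cyclic: assumes "alternating3 p" shows "crs p x y \<bullet> z = crs p y z \<bullet> x"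
proof -
  have *: "p$a$b$c = p$b$c$a" for a b c
    using assms unfolding alternating3_def by (metis minus_minus)
  have "crs p x y \<bullet> z = (\<Sum>a\<in>UNIV. \<Sum>b\<in>UNIV. \<Sum>c\<in>UNIV. x$a * y$b * z$c * p$b$c$a)"
    unfolding crs_inner by (intro sum.cong refl) (subst *, rule refl)
  also have "\<dots> = crs p y z \<bullet> x"
    unfolding crs_inner by (subst sum_rotate[symmetric]) (simp only: mult_ac)
  finally show ?thesis .
qed

lemma crs_commute: assumes "alternating3 p" shows "crs p x y = - crs p y x"
proof -
  have *: "p$a$b$c = - p$b$a$c" for a b c
    using assms unfolding alternating3_def by blast
  have "crs p x y $ k = (\<Sum>a\<in>UNIV. \<Sum>b\<in>UNIV. x$a * y$b * - p$b$a$k)" for k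
    unfolding crs_def vec_lambda_beta by (intro sum.cong refl) (subst *, rule refl)
  also have "\<dots> k = - crs p y x $ k" for k
    unfolding crs_def by (subst sum.swap) (simp add: sum_negf mult_ac)
  finally show ?thesis by (simp add: vec_eq_iff)
qed

lemma crs_orthogonal: assumes "alternating3 p" shows "crs p x y \<bullet> x = 0" "crs p x y \<bullet> y = 0"
proof -
  have z: "crs p x x = 0" for x using crs_commute[OF assms, of x x] by (simp add: eq_neg_iff_add_eq_0 flip: scaleR_2)
  show "crs p x y \<bullet> y = 0" unfolding crs_cyclic[OF assms, of x y] using z by simp
  then show "crs p x y \<bullet> x = 0" for x y using crs_commute[OF assms, of x y] crs_cyclic[OF assms, of y x] z by simp
qed

text \<open>The form attains its comass on an associative triple.\<close>

lemma exists_adapted_triple: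
  assumes alt: "alternating3 p" and "p \<noteq> 0"
  obtains e :: "7 \<Rightarrow> vec7" and l where "l > 0" "\<forall>i j. e i \<bullet> e j = (if i = j then 1 else 0)"
    "crs p (e 1) (e 2) = l *\<^sub>R e 3" "crs p (e 2) (e 3) = l *\<^sub>R e 1" "crs p (e 3) (e 1) = l *\<^sub>R e 2"
proof -
  \<comment> \<open>Maximizing over orthonormal pairs is enough: the third vector of the triple will
    be the direction of \<open>crs p x y\<close>.\<close>
  define K where "K = {z :: vec7 \<times> vec7. fst z \<bullet> fst z = 1 \<and> snd z \<bullet> snd z = 1 \<and> fst z \<bullet> snd z = 0}"
  have "compact K"
  proof (rule compact_eq_bounded_closed[THEN iffD2], rule conjI)
    have "norm z \<le> 2" if "z \<in> K" for z
      using that norm_Pair_le[of "fst z" "snd z"] unfolding K_def by (simp add: norm_eq_sqrt_inner)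
    then show "bounded K" unfolding bounded_iff by blast
    show "closed K" unfolding K_def
      by (intro closed_Collect_conj closed_Collect_eq continuous_intros)
  qed
  moreover have "(axis 1 1, axis 2 1) \<in> K" by (simp add: K_def inner_axis_axis)
  then have "K \<noteq> {}" by blast
  moreover have "continuous_on K (\<lambda>z. norm (crs p (fst z) (snd z)))"
    unfolding crs_def by (intro continuous_intros)
  ultimately obtain z where z: "z \<in> K" "\<And>w. w \<in> K \<Longrightarrow> norm (crs p (fst w) (snd w)) \<le> norm (crs p (fst z) (snd z))"
    using continuous_attains_sup[of K "\<lambda>z. norm (crs p (fst z) (snd z))"] by blast
  define x y where "x = fst z" and "y = snd z"
  define l where "l = norm (crs p x y)"
  have max: "norm (crs p u v) \<le> l" if "u \<bullet> u = 1" "v \<bullet> v = 1" "u \<bullet> v = 0" for u v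
    using z(2)[of "(u, v)"] that by (simp add: K_def l_def x_def y_def)
  have xy: "x \<bullet> x = 1" "y \<bullet> y = 1" "x \<bullet> y = 0" using z(1) by (simp_all add: K_def x_def y_def)
  have "l \<noteq> 0"
  proof
    assume l: "l = 0"
    have "crs p (axis i 1) (axis j 1) $ k = p$i$j$k" for i j k
      by (simp add: crs_def axis_def if_distrib[of "\<lambda>c. c * _"] if_distrib[of "\<lambda>c. _ * c"] cong: if_cong)
    moreover have "crs p (axis i 1) (axis j 1) = 0" for i j
    proof (cases "i = j")
      case True
      then show ?thesis using crs_commute[OF alt, of "axis i 1" "axis j 1"] by (simp add: eq_neg_iff_add_eq_0 flip: scaleR_2)
    next
      case False
      then show ?thesis using max[of "axis i 1" "axis j 1"] l by (simp add: inner_axis_axis)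
    qed
    ultimately have "p = 0" unfolding vec_eq_iff by (metis zero_index)
    with assms show False by simp
  qed
  then have l: "l > 0" by (simp add: l_def)
  define w where "w = (1 / l) *\<^sub>R crs p x y"
  have w: "crs p x y = l *\<^sub>R w" using l by (simp add: w_def)
  have ww: "w \<bullet> w = 1" using l by (simp add: w_def l_def dot_square_norm power2_eq_square)
  have wx: "w \<bullet> x = 0" "w \<bullet> y = 0" by (simp_all add: w_def crs_orthogonal[OF alt])
  \<comment> \<open>The equality case of Cauchy-Schwarz. Maximality bounds the norm of
    \<open>crs p y w\<close> by \<open>l\<close>, while its component along \<open>x\<close> is
    already \<open>l\<close> by cyclicity, so nothing is left for the other directions.\<close>
  have eq: "v = l *\<^sub>R u" if "norm v \<le> l" "v \<bullet> u = l" "u \<bullet> u = 1" for u v :: vec7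
  proof -
    have "v \<bullet> v \<le> l * l" using that(1) l by (simp add: dot_square_norm power2_eq_square mult_mono)
    moreover have "(v - l *\<^sub>R u) \<bullet> (v - l *\<^sub>R u) = v \<bullet> v - l * l"
      using that(2,3) by (simp add: inner_diff_left inner_diff_right inner_commute)
    ultimately have "(v - l *\<^sub>R u) \<bullet> (v - l *\<^sub>R u) \<le> 0" by simp
    then have "v - l *\<^sub>R u = 0" by (metis inner_eq_zero_iff inner_ge_zero order_antisym)
    then show ?thesis by simp
  qed
  have yw: "crs p y w = l *\<^sub>R x"
    by (rule eq) (use max[of y w] xy ww wx crs_cyclic[OF alt, of x y w] w in \<open>simp_all add: inner_commute\<close>)
  have wx': "crs p w x = l *\<^sub>R y"
    by (rule eq) (use max[of w x] xy ww wx crs_cyclic[OF alt, of w x y] w in \<open>simp_all add: inner_commute\<close>)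
  define e where "e = (\<lambda>i::7. if i = 1 then x else if i = 2 then y else w)"
  have "e i \<bullet> (mat 1 *v e j) = (if i = j then 1 else 0)" if "i \<in> {1, 2, 3}" "j \<in> {1, 2, 3}" for i j
    using that xy ww wx by (auto simp: e_def inner_commute)
  then obtain e' where e': "\<forall>i\<in>{1, 2, 3}. e' i = e i" "\<forall>i j. e' i \<bullet> (mat 1 *v e' j) = (if i = j then 1 else 0)"
    using orthonormal_extension[of "mat 1" "{1, 2, 3}" e] by (auto simp: transpose_mat)
  show ?thesis
    by (rule that[of l e']) (use l e' w yw wx' in \<open>auto simp: e_def\<close>)
qed

subsection \<open>The normal form of a nondegenerate 3-form\<close>

text \<open>Leaves the 35 increasing triples to compare instead of 343 components.\<close>

lemma alternating3_eqI:
  assumes "alternating3 p" "alternating3 q"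
    and "\<And>i j k. rk i < rk j \<Longrightarrow> rk j < rk k \<Longrightarrow> p$i$j$k = q$i$j$k"
  shows "p = q"
proof -
  note sp = alt3_sort[OF alternating3_alt3[OF assms(1)]]
  note sq = alt3_sort[OF alternating3_alt3[OF assms(2)]]
  have inj: "i = j" if "rk i = rk j" for i j
    using that exhaust_7[of i] exhaust_7[of j] by (auto simp: rk_def tuple7_def split: if_splits)
  have 1: "p$i$j$k = q$i$j$k" if "rk i < rk j" for i j k
  proof -
    consider "rk j < rk k" | "j = k" | "rk k < rk j" "rk i < rk k" | "i = k" | "rk k < rk i"
      using inj by (metis linorder_neqE_nat)
    then show ?thesis
    proof cases
      case 3 then show ?thesis using assms(3)[of i k j] sp(5)[of k j i] sq(5)[of k j i] that by simp
    next
      case 5 then show ?thesis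
        using assms(3)[of k i j] sp(5)[of k j i] sq(5)[of k j i] sp(4)[of k i j] sq(4)[of k i j] that by simp
    qed (use assms(3) that sp sq in auto)
  qed
  have "p$i$j$k = q$i$j$k" for i j k
    using 1[of i j k] 1[of j i k] sp(1)[of i k] sq(1)[of i k] sp(4)[of j i k] sq(4)[of j i k] inj[of i j]
    by (cases "rk i" "rk j" rule: linorder_cases) auto
  then show ?thesis by (simp add: vec_eq_iff)
qed

text \<open>The 3 x 3 determinant of Kronecker deltas, that is, the components of a basic
  decomposable 3-form.\<close>

definition basis3 :: "7 \<Rightarrow> 7 \<Rightarrow> 7 \<Rightarrow> ten3" where
  "basis3 a b c = (\<chi> i j k. let d = (\<lambda>x y. if x = y then 1 else 0) in
     d i a * (d j b * d k c - d j c * d k b) - d i b * (d j a * d k c - d j c * d k a)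
     + d i c * (d j a * d k b - d j b * d k a))"

lemma alternating3_basis3: "alternating3 (basis3 a b c)"
  unfolding alternating3_def basis3_def Let_def vec_lambda_beta by (simp add: algebra_simps)

lemma alternating3D: "alternating3 p \<Longrightarrow> p$j$i$k = - p$i$j$k" "alternating3 p \<Longrightarrow> p$i$k$j = - p$i$j$k"
  unfolding alternating3_def by blast+

lemma alternating3_add: assumes "alternating3 p" "alternating3 q" shows "alternating3 (p + q)"
  unfolding alternating3_def vector_add_component
proof (intro allI conjI)
  fix i j k
  show "p$i$j$k + q$i$j$k = - (p$j$i$k + q$j$i$k)"
    using alternating3D(1)[OF assms(1), of i j k] alternating3D(1)[OF assms(2), of i j k] by linarith
  show "p$i$j$k + q$i$j$k = - (p$i$k$j + q$i$k$j)"
    using alternating3D(2)[OF assms(1), of i k j] alternating3D(2)[OF assms(2), of i k j] by linarith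
qed

lemma alternating3_scaleR: assumes "alternating3 p" shows "alternating3 (c *\<^sub>R p)"
  unfolding alternating3_def vector_scaleR_component
proof (intro allI conjI)
  fix i j k
  show "c *\<^sub>R p$i$j$k = - (c *\<^sub>R p$j$i$k)"
    using alternating3D(1)[OF assms, of i j k] by simp
  show "c *\<^sub>R p$i$j$k = - (c *\<^sub>R p$i$k$j)"
    using alternating3D(2)[OF assms, of i k j] by simp
qed

lemma alternating3_diff: "alternating3 p \<Longrightarrow> alternating3 q \<Longrightarrow> alternating3 (p - q)"
  using alternating3_add[of p "(- 1) *\<^sub>R q"] alternating3_scaleR[of q "- 1"] by simp

text \<open>This is e123 + e1 w1 + e2 w2 + e3 w3 with the anti-self-dual triple w1 = e45 - e67, w2 =
  e46 + e57, w3 = e47 - e56 on the span of e4, ..., e7. Contracting w1, w2, w3 with e4 gives e5, e6,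
  e7.\<close>

definition phi0 :: ten3 where
  "phi0 = basis3 1 2 3 + basis3 1 4 5 + basis3 2 4 6 + basis3 3 4 7
     - basis3 1 6 7 + basis3 2 5 7 - basis3 3 5 6"

lemma alternating3_phi0: "alternating3 phi0"
  unfolding phi0_def by (intro alternating3_add alternating3_diff alternating3_basis3)

text \<open>A pair of a skew \<open>4 \<times> 4\<close> matrix \<open>W\<close> and its Hodge dual \<open>S\<close> satisfies \<open>W S = S W = - Pf W\<close>.\<close>

definition skew4 :: "real \<Rightarrow> real \<Rightarrow> real \<Rightarrow> real \<Rightarrow> real \<Rightarrow> real \<Rightarrow> real^4^4" where
  "skew4 a b c d e f = (\<chi> i j.
     if i = 1 then (if j = 1 then 0 else if j = 2 then a else if j = 3 then b else c)
     else if i = 2 then (if j = 1 then - a else if j = 2 then 0 else if j = 3 then d else e)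
     else if i = 3 then (if j = 1 then - b else if j = 2 then - d else if j = 3 then 0 else f)
     else (if j = 1 then - c else if j = 2 then - e else if j = 3 then - f else 0))"

lemma skew4_dual:
  "skew4 a b c d e f ** skew4 f' (- e') d' c' (- b') a' + skew4 a' b' c' d' e' f' ** skew4 f (- e) d c (- b) a
     = - (a * f' + f * a' - b * e' - e * b' + c * d' + d * c') *\<^sub>R mat 1"
  by (simp add: vec_eq_iff forall_4 matrix_matrix_mult_def sum_4 skew4_def mat_def algebra_simps)

text \<open>Multiplying the triple product by \<open>S1\<close> ties \<open>S1\<close> to
  \<open>S3 ** W2\<close>, whose square is the scalar \<open>- m\<^sup>2\<close> by the
  anticommutation rule. So \<open>S1 ** S1\<close> is a scalar, and multiplying it by
  \<open>W1\<close> trades one \<open>S1\<close> for a multiple of \<open>W1\<close>.\<close>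

lemma selfdual_of_quaternionic:
  fixes W1 W2 W3 S1 S2 S3 :: "real^4^4"
  assumes "W1 ** S1 = - m *\<^sub>R mat 1" "S1 ** W1 = - m *\<^sub>R mat 1"
    and "S2 ** W2 = - m *\<^sub>R mat 1" "S3 ** W3 = - m *\<^sub>R mat 1"
    and "W2 ** S3 = - (W3 ** S2)" "W1 ** S3 ** W2 = k *\<^sub>R mat 1" "k\<^sup>2 = 1" "m \<noteq> 0"
  shows "S1 = m ^ 3 *\<^sub>R W1"
proof -
  have neg: "A ** (- B) = - (A ** B)" "(- A) ** B = - (A ** B)" for A B :: "real^4^4"
    by (simp_all add: vec_eq_iff matrix_matrix_mult_def sum_negf)
  have "k *\<^sub>R S1 = S1 ** (W1 ** S3 ** W2)" by (simp add: assms matrix_scalar_ac)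
  also have "\<dots> = (S1 ** W1) ** (S3 ** W2)" by (simp only: matrix_mul_assoc)
  also have "\<dots> = - m *\<^sub>R (S3 ** W2)" unfolding assms by (simp add: neg flip: scalar_matrix_assoc)
  finally have kS: "k *\<^sub>R S1 = - m *\<^sub>R (S3 ** W2)" .
  have "(S3 ** W2) ** (S3 ** W2) = S3 ** (W2 ** S3) ** W2" by (simp only: matrix_mul_assoc)
  also have "\<dots> = - ((S3 ** W3) ** (S2 ** W2))" unfolding assms(5) by (simp add: neg matrix_mul_assoc)
  also have "\<dots> = - (m\<^sup>2 *\<^sub>R mat 1)" unfolding assms by (simp add: neg matrix_scalar_ac power2_eq_square flip: scalar_matrix_assoc)
  finally have sq: "(S3 ** W2) ** (S3 ** W2) = - (m\<^sup>2 *\<^sub>R mat 1)" .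
  have "S1 ** S1 = k\<^sup>2 *\<^sub>R (S1 ** S1)" using assms by simp
  also have "\<dots> = (k *\<^sub>R S1) ** (k *\<^sub>R S1)"
    by (simp add: matrix_scalar_ac power2_eq_square flip: scalar_matrix_assoc)
  also have "\<dots> = m\<^sup>2 *\<^sub>R ((S3 ** W2) ** (S3 ** W2))"
    unfolding kS by (simp add: neg matrix_scalar_ac power2_eq_square flip: scalar_matrix_assoc)
  finally have "S1 ** S1 = - (m ^ 4) *\<^sub>R mat 1" unfolding sq by (simp add: power2_eq_square power4_eq_xxxx)
  then have "- (m ^ 4) *\<^sub>R W1 = W1 ** (S1 ** S1)" by (simp add: neg matrix_scalar_ac)
  also have "\<dots> = (W1 ** S1) ** S1" by (simp only: matrix_mul_assoc)
  also have "\<dots> = - m *\<^sub>R S1" unfolding assms by (simp add: neg flip: scalar_matrix_assoc)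
  finally have "m *\<^sub>R S1 = m *\<^sub>R (m ^ 3 *\<^sub>R W1)" by (simp add: power4_eq_xxxx power3_eq_cube mult_ac)
  with assms(8) show ?thesis by (metis scaleR_left_imp_eq)
qed

text \<open>The form in an orthonormal frame that begins with the maximizing triple. The sign of
  \<open>v\<close> stays open, because the orientation belongs to the form and cannot be
  prescribed.\<close>

locale adapted_form =
  fixes p :: ten3 and l v :: real
  assumes alt: "alternating3 p" and l: "l > 0"
    and p123: "p$1$2$3 = l" and p12: "p$1$2$4 = 0" "p$1$2$5 = 0" "p$1$2$6 = 0" "p$1$2$7 = 0"
    and p13: "p$1$3$4 = 0" "p$1$3$5 = 0" "p$1$3$6 = 0" "p$1$3$7 = 0"
    and p23: "p$2$3$4 = 0" "p$2$3$5 = 0" "p$2$3$6 = 0" "p$2$3$7 = 0"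
    and w: "wmat p = (- 6 * v) *\<^sub>R mat 1" and v: "v\<^sup>2 = 1"
begin

lemmas sort = alt3_sort[OF alternating3_alt3[OF alt]]
lemmas zeros = p123 p12 p13 p23

text \<open>Contracting the form with e_i leaves a skew block on e4, ..., e7. \<open>W i\<close> is
  this block, \<open>S i\<close> its Hodge dual and \<open>pf i j\<close> the polarized Pfaffian,
  normalized so that \<open>pf i i\<close> is twice the Pfaffian.\<close>

definition "W i = skew4 (p$i$4$5) (p$i$4$6) (p$i$4$7) (p$i$5$6) (p$i$5$7) (p$i$6$7)"
definition "S i = skew4 (p$i$6$7) (- p$i$5$7) (p$i$5$6) (p$i$4$7) (- p$i$4$6) (p$i$4$5)"
definition "pf i j = p$i$4$5 * p$j$6$7 + p$i$6$7 * p$j$4$5 - p$i$4$6 * p$j$5$7 - p$i$5$7 * p$j$4$6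
   + p$i$4$7 * p$j$5$6 + p$i$5$6 * p$j$4$7"

text \<open>144 = 6 * 24: the constant in the metric equation times the normalization of
  \<open>wedge\<close>.\<close>

lemma expand: "wedge (p$i) (p$j) p = (if i = j then - 144 * v else 0)"
proof -
  have "wmat p $ i $ j = wedge (p$i) (p$j) p / 24" by (simp add: wmat_def wedge_form_wedge)
  then show ?thesis unfolding w by (simp add: mat_def split: if_splits)
qed

lemma alt2_slice: "alt2 (\<lambda>j k. p$i$j$k)"
  using alt unfolding alt2_def alternating3_def by blast

lemmas poly = expand[unfolded wedge_expand[OF alt2_slice alt2_slice alt] wedge5_def zeros, simplified]

text \<open>When both contractions are along the triple, e1, e2, e3 can be supplied in three ways,
  each giving \<open>l\<close> times the product of two blocks. Dividing the 6 of the metric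
  equation by three leaves 2.\<close>

lemma pf_diag: "l * pf 1 1 = - 2 * v" "l * pf 2 2 = - 2 * v" "l * pf 3 3 = - 2 * v"
  subgoal using poly[of 1 1] by (simp add: sort zeros pf_def algebra_simps)
  subgoal using poly[of 2 2] by (simp add: sort zeros pf_def algebra_simps)
  subgoal using poly[of 3 3] by (simp add: sort zeros pf_def algebra_simps)
  done

lemma pf_off: "l * pf 1 2 = 0" "l * pf 1 3 = 0" "l * pf 2 3 = 0"
  subgoal using poly[of 1 2] by (simp add: sort zeros pf_def algebra_simps)
  subgoal using poly[of 1 3] by (simp add: sort zeros pf_def algebra_simps)
  subgoal using poly[of 2 3] by (simp add: sort zeros pf_def algebra_simps)
  done

text \<open>The equations mixing e1 with e4, ..., e7 say that the block of e1 annihilates the vector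
  dual to the part of the form on e4, ..., e7. Its Pfaffian \<open>P\<close> is nonzero, so the
  block is invertible; multiplying by the dual block produces the multiples of \<open>P\<close>
  below.\<close>

lemma tau: "p$4$5$6 = 0" "p$4$5$7 = 0" "p$4$6$7 = 0" "p$5$6$7 = 0"
proof -
  define P where "P = p$1$4$5 * p$1$6$7 - p$1$4$6 * p$1$5$7 + p$1$4$7 * p$1$5$6"
  have "l * (2 * P) = - 2 * v" using pf_diag(1) by (simp add: pf_def P_def algebra_simps)
  then have "l * P \<noteq> 0" using v by auto
  then have P: "P \<noteq> 0" by simp
  have "l * (p$1$4$5 * p$4$6$7 - p$1$4$6 * p$4$5$7 + p$1$4$7 * p$4$5$6) = 0"
    "l * (p$1$4$5 * p$5$6$7 - p$1$5$6 * p$4$5$7 + p$1$5$7 * p$4$5$6) = 0"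
    "l * (p$1$4$6 * p$5$6$7 - p$1$5$6 * p$4$6$7 + p$1$6$7 * p$4$5$6) = 0"
    "l * (p$1$4$7 * p$5$6$7 - p$1$5$7 * p$4$6$7 + p$1$6$7 * p$4$5$7) = 0"
    subgoal using poly[of 1 4] by (simp add: sort zeros algebra_simps)
    subgoal using poly[of 1 5] by (simp add: sort zeros algebra_simps)
    subgoal using poly[of 1 6] by (simp add: sort zeros algebra_simps)
    subgoal using poly[of 1 7] by (simp add: sort zeros algebra_simps)
    done
  then have e: "p$1$4$5 * p$4$6$7 - p$1$4$6 * p$4$5$7 + p$1$4$7 * p$4$5$6 = 0"
    "p$1$4$5 * p$5$6$7 - p$1$5$6 * p$4$5$7 + p$1$5$7 * p$4$5$6 = 0"
    "p$1$4$6 * p$5$6$7 - p$1$5$6 * p$4$6$7 + p$1$6$7 * p$4$5$6 = 0"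
    "p$1$4$7 * p$5$6$7 - p$1$5$7 * p$4$6$7 + p$1$6$7 * p$4$5$7 = 0"
    using l by auto
  have "P * p$4$5$6 = 0" "P * p$4$5$7 = 0" "P * p$4$6$7 = 0" "P * p$5$6$7 = 0"
    using e unfolding P_def by algebra+
  then show "p$4$5$6 = 0" "p$4$5$7 = 0" "p$4$6$7 = 0" "p$5$6$7 = 0" using P by simp_all
qed

lemmas poly' = poly[unfolded tau, simplified]

lemma WS: "W i ** S j + W j ** S i = - pf i j *\<^sub>R mat 1"
  unfolding W_def S_def pf_def by (rule skew4_dual)

lemma skew4_nth: "skew4 a b c d e f $ 1 $ 1 = 0" "skew4 a b c d e f $ 1 $ 2 = a" "skew4 a b c d e f $ 1 $ 3 = b" "skew4 a b c d e f $ 1 $ 4 = c"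
  "skew4 a b c d e f $ 2 $ 1 = - a" "skew4 a b c d e f $ 2 $ 2 = 0" "skew4 a b c d e f $ 2 $ 3 = d" "skew4 a b c d e f $ 2 $ 4 = e"
  "skew4 a b c d e f $ 3 $ 1 = - b" "skew4 a b c d e f $ 3 $ 2 = - d" "skew4 a b c d e f $ 3 $ 3 = 0" "skew4 a b c d e f $ 3 $ 4 = f"
  "skew4 a b c d e f $ 4 $ 1 = - c" "skew4 a b c d e f $ 4 $ 2 = - e" "skew4 a b c d e f $ 4 $ 3 = - f" "skew4 a b c d e f $ 4 $ 4 = 0"
  by (simp_all add: skew4_def)

lemmas entry_simps = matrix_matrix_mult_def sum_4 W_def S_def skew4_nth vector_add_component
  vector_minus_component vec_lambda_beta simp_thms if_True if_False one_eq_numeral_iff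

text \<open>The part of the metric equation with both indices among 4, ..., 7. There each of the
  three factors supplies exactly one of e1, e2, e3, which gives the alternating sum over the six
  assignments.\<close>

lemma antisym_sum:
  "W 1 ** S 3 ** W 2 - W 1 ** S 2 ** W 3 + W 2 ** S 1 ** W 3 - W 2 ** S 3 ** W 1
     + W 3 ** S 2 ** W 1 - W 3 ** S 1 ** W 2 = (- 6 * v) *\<^sub>R mat 1" (is "?A = _")
proof -
  have "(\<forall>i j. A $ i $ j = (if i = j then - 6 * v else 0)) \<Longrightarrow> A = (- 6 * v) *\<^sub>R mat 1" for A :: "real^4^4"
    by (simp add: vec_eq_iff mat_def)
  moreover have "\<forall>i j. ?A $ i $ j = (if i = j then - 6 * v else 0)" (is "\<forall>i j. ?P i j")
  proof -
    have "?P 1 1" "?P 1 2" "?P 1 3" "?P 1 4" "?P 2 1" "?P 2 2" "?P 2 3" "?P 2 4"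
      "?P 3 1" "?P 3 2" "?P 3 3" "?P 3 4" "?P 4 1" "?P 4 2" "?P 4 3" "?P 4 4"
  subgoal using poly'[of 4 4] 
    by (simp add: sort zeros tau, simp add: algebra_simps, simp only: entry_simps, algebra)
  subgoal using poly'[of 4 5] 
    by (simp add: sort zeros tau, simp add: algebra_simps, simp only: entry_simps, algebra)
  subgoal using poly'[of 4 6] 
    by (simp add: sort zeros tau, simp add: algebra_simps, simp only: entry_simps, algebra)
  subgoal using poly'[of 4 7] 
    by (simp add: sort zeros tau, simp add: algebra_simps, simp only: entry_simps, algebra)
  subgoal using poly'[of 5 4] 
    by (simp add: sort zeros tau, simp add: algebra_simps, simp only: entry_simps, algebra)
  subgoal using poly'[of 5 5] 
    by (simp add: sort zeros tau, simp add: algebra_simps, simp only: entry_simps, algebra)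
  subgoal using poly'[of 5 6] 
    by (simp add: sort zeros tau, simp add: algebra_simps, simp only: entry_simps, algebra)
  subgoal using poly'[of 5 7] 
    by (simp add: sort zeros tau, simp add: algebra_simps, simp only: entry_simps, algebra)
  subgoal using poly'[of 6 4] 
    by (simp add: sort zeros tau, simp add: algebra_simps, simp only: entry_simps, algebra)
  subgoal using poly'[of 6 5] 
    by (simp add: sort zeros tau, simp add: algebra_simps, simp only: entry_simps, algebra)
  subgoal using poly'[of 6 6] 
    by (simp add: sort zeros tau, simp add: algebra_simps, simp only: entry_simps, algebra)
  subgoal using poly'[of 6 7] 
    by (simp add: sort zeros tau, simp add: algebra_simps, simp only: entry_simps, algebra)
  subgoal using poly'[of 7 4] 
    by (simp add: sort zeros tau, simp add: algebra_simps, simp only: entry_simps, algebra)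
  subgoal using poly'[of 7 5] 
    by (simp add: sort zeros tau, simp add: algebra_simps, simp only: entry_simps, algebra)
  subgoal using poly'[of 7 6] 
    by (simp add: sort zeros tau, simp add: algebra_simps, simp only: entry_simps, algebra)
  subgoal using poly'[of 7 7] 
    by (simp add: sort zeros tau, simp add: algebra_simps, simp only: entry_simps, algebra)
      done
    then show ?thesis by (simp add: forall_4)
  qed
  ultimately show ?thesis by blast
qed

end

context adapted_form begin

lemma dual: "S i = (- v / l) ^ 3 *\<^sub>R W i" if "i \<in> {1, 2, 3}"
proof -
  \<comment> \<open>The common Pfaffian of the three blocks.\<close>
  define m where "m = - v / l"
  have v0: "v \<noteq> 0" using v by auto
  have pfm: "pf 1 1 = 2 * m" "pf 2 2 = 2 * m" "pf 3 3 = 2 * m" "pf 1 2 = 0" "pf 1 3 = 0" "pf 2 3 = 0"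
    using pf_diag pf_off l by (simp_all add: m_def field_simps)
  have SW: "S i ** W j + S j ** W i = - pf i j *\<^sub>R mat 1" for i j
    using skew4_dual[of "p$i$6$7" "- p$i$5$7" "p$i$5$6" "p$i$4$7" "- p$i$4$6" "p$i$4$5"
        "p$j$4$5" "- p$j$4$6" "p$j$4$7" "p$j$5$6" "- p$j$5$7" "p$j$6$7"]
    unfolding W_def S_def pf_def by (simp add: algebra_simps)
  have half: "A = - m *\<^sub>R mat 1" if "A + A = - (2 * m) *\<^sub>R (mat 1 :: real^4^4)" for A
  proof -
    have "2 *\<^sub>R A = 2 *\<^sub>R (- m *\<^sub>R mat 1)" using that by (simp add: scaleR_2)
    then show ?thesis by (metis scaleR_left_imp_eq zero_neq_numeral)
  qed
  have WSd: "W i ** S i = - m *\<^sub>R mat 1" "S i ** W i = - m *\<^sub>R mat 1" if "i \<in> {1, 2, 3}" for i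
  proof -
    have "2 * m = pf i i" using that pfm by auto
    note eq = this half
    show "W i ** S i = - m *\<^sub>R mat 1" by (rule half, subst eq(1), rule WS)
    show "S i ** W i = - m *\<^sub>R mat 1" by (rule half, subst eq(1), rule SW)
  qed
  have WSo: "W i ** S j = - (W j ** S i)" "S i ** W j = - (S j ** W i)"
    if "i \<in> {1, 2, 3}" "j \<in> {1, 2, 3}" "i \<noteq> j" for i j
  proof -
    have "pf 2 1 = pf 1 2" "pf 3 1 = pf 1 3" "pf 3 2 = pf 2 3" by (simp_all add: pf_def)
    then have "pf i j = 0" using that pfm by auto
    then show "W i ** S j = - (W j ** S i)" "S i ** W j = - (S j ** W i)"
      using WS[of i j] SW[of i j] by (simp_all add: eq_neg_iff_add_eq_0)
  qed
  have neg: "A ** (- B) = - (A ** B)" "(- A) ** B = - (A ** B)" for A B :: "real^4^4"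
    by (simp_all add: vec_eq_iff matrix_matrix_mult_def sum_negf)
  let ?M = "W 1 ** S 3 ** W 2"
  have eqs: "W 1 ** S 2 ** W 3 = - ?M" "W 2 ** S 3 ** W 1 = - ?M" "W 3 ** S 1 ** W 2 = - ?M"
    "W 2 ** S 1 ** W 3 = ?M" "W 3 ** S 2 ** W 1 = ?M"
  proof -
    show 1: "W 1 ** S 2 ** W 3 = - ?M"
      using WSo(2)[of 2 3] by (simp add: neg matrix_mul_assoc[symmetric])
    show 2: "W 3 ** S 1 ** W 2 = - ?M" using WSo(1)[of 3 1] by (simp add: neg)
    show 3: "W 2 ** S 1 ** W 3 = ?M" using WSo(1)[of 2 1] 1 by (simp add: neg)
    show 4: "W 3 ** S 2 ** W 1 = ?M"
      using WSo(2)[of 2 1] 2 by (simp add: neg matrix_mul_assoc[symmetric])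
    show "W 2 ** S 3 ** W 1 = - ?M" using WSo(1)[of 2 3] 4 by (simp add: neg)
  qed
  have M: "?M = - v *\<^sub>R mat 1"
  proof -
    \<comment> \<open>By the off-diagonal relations all six products equal one and the same product
      up to sign, and the signs conspire.\<close>
    have "A - (- A) + A - (- A) + A - (- A) = 6 *\<^sub>R A" for A :: "real^4^4" by (simp add: vec_eq_iff)
    then have "6 *\<^sub>R ?M = 6 *\<^sub>R (- v *\<^sub>R mat 1)"
      using antisym_sum unfolding eqs by simp
    then show ?thesis by (metis scaleR_left_imp_eq zero_neq_numeral)
  qed
  have v1: "(- v)\<^sup>2 = 1" "m \<noteq> 0" using v v0 l by (simp_all add: m_def)
  note d = WSd[of 1] WSd[of 2] WSd[of 3]
  have "S 1 = m ^ 3 *\<^sub>R W 1"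
    by (rule selfdual_of_quaternionic[of _ _ _ "S 2" "W 2" "S 3" "W 3" "- v"])
       (use d WSo(1)[of 2 3] M v1 in simp_all)
  moreover have "S 2 = m ^ 3 *\<^sub>R W 2"
    by (rule selfdual_of_quaternionic[of _ _ _ "S 3" "W 3" "S 1" "W 1" "- v"])
       (use d WSo(1)[of 3 1] M eqs v1 in simp_all)
  moreover have "S 3 = m ^ 3 *\<^sub>R W 3"
    by (rule selfdual_of_quaternionic[of _ _ _ "S 1" "W 1" "S 2" "W 2" "- v"])
       (use d WSo(1)[of 1 2] M eqs v1 in simp_all)
  ultimately show ?thesis using that by (auto simp: m_def)
qed

text \<open>Dualizing twice is the identity, so \<open>n * n = 1\<close>, because the block of e1 is
  not zero. Since \<open>n\<close> is the cube of \<open>- v / l\<close>, this forces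
  \<open>l ^ 6 = 1\<close>.\<close>

lemma l1: "l = 1"
proof -
  define n where "n = (- v / l) ^ 3"
  have W1: "p$1$6$7 = n * p$1$4$5" "- p$1$5$7 = n * p$1$4$6" "p$1$5$6 = n * p$1$4$7"
    "p$1$4$7 = n * p$1$5$6" "- p$1$4$6 = n * p$1$5$7" "p$1$4$5 = n * p$1$6$7"
  proof -
    have e: "S 1 $ a $ b = n * W 1 $ a $ b" for a b using dual[of 1] by (simp add: n_def)
    show "p$1$6$7 = n * p$1$4$5" "- p$1$5$7 = n * p$1$4$6" "p$1$5$6 = n * p$1$4$7"
      "p$1$4$7 = n * p$1$5$6" "- p$1$4$6 = n * p$1$5$7" "p$1$4$5 = n * p$1$6$7"
      using e[of 1 2] e[of 1 3] e[of 1 4] e[of 2 3] e[of 2 4] e[of 3 4]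
      unfolding S_def W_def skew4_nth by blast+
  qed
  have "n * n = 1"
  proof (rule ccontr)
    assume n: "n * n \<noteq> 1"
    have "x = 0" if "x = n * y" "y = n * x" for x y
      using that n by (metis mult.assoc mult_cancel_right1 mult.commute)
    from this[OF W1(6) W1(1)] this[OF _ W1(2)] this[OF W1(4) W1(3)] W1(5)
    have "p$1$4$5 = 0" "p$1$4$6 = 0" "p$1$4$7 = 0" by auto
    then show False using pf_diag(1) v by (auto simp: pf_def)
  qed
  moreover have "n * n * l ^ 6 = v\<^sup>2 ^ 3" using l by (simp add: n_def field_simps power_mult[symmetric])
  ultimately have "l ^ 6 = 1" using v by simp
  then show "l = 1" using l power_eq_imp_eq_base[of l 6 1] by simp
qed

lemma selfdual: "i \<in> {1, 2, 3} \<Longrightarrow> p$i$6$7 = - v * p$i$4$5" "i \<in> {1, 2, 3} \<Longrightarrow> p$i$5$7 = v * p$i$4$6"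
  "i \<in> {1, 2, 3} \<Longrightarrow> p$i$5$6 = - v * p$i$4$7"
proof -
  assume i: "i \<in> {1, 2, 3}"
  have "(- v / l) ^ 3 = - v" using v l1 by (simp add: power3_eq_cube power2_eq_square)
  then have e: "S i $ a $ b = - v * W i $ a $ b" for a b using dual[OF i] by simp
  show "p$i$6$7 = - v * p$i$4$5" "p$i$5$7 = v * p$i$4$6" "p$i$5$6 = - v * p$i$4$7"
    using e[of 1 2] e[of 1 3] e[of 1 4] unfolding S_def W_def skew4_nth by simp_all
qed

definition "dot i j = p$i$4$5 * p$j$4$5 + p$i$4$6 * p$j$4$6 + p$i$4$7 * p$j$4$7"

text \<open>Self-duality expresses \<open>pf\<close> through the rows p(e_i, e4, -) alone, so the
  Pfaffian relations become orthonormality of these rows. Their determinant is read off the (4, 4)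
  entry of the metric equation.\<close>

lemma frame: "dot 1 1 = 1" "dot 2 2 = 1" "dot 3 3 = 1" "dot 1 2 = 0" "dot 1 3 = 0" "dot 2 3 = 0"
  "p$1$4$5 * (p$2$4$6 * p$3$4$7 - p$2$4$7 * p$3$4$6) - p$1$4$6 * (p$2$4$5 * p$3$4$7 - p$2$4$7 * p$3$4$5)
     + p$1$4$7 * (p$2$4$5 * p$3$4$6 - p$2$4$6 * p$3$4$5) = v"
proof -
  have v0: "v \<noteq> 0" using v by auto
  have pf: "pf i j = - 2 * v * dot i j" if "i \<in> {1, 2, 3}" "j \<in> {1, 2, 3}" for i j
    unfolding pf_def dot_def using selfdual[OF that(1)] selfdual[OF that(2)] by (simp add: algebra_simps)
  show "dot 1 1 = 1" "dot 2 2 = 1" "dot 3 3 = 1" "dot 1 2 = 0" "dot 1 3 = 0" "dot 2 3 = 0"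
    using pf_diag pf_off v0 unfolding l1 by (simp_all add: pf)
  show "p$1$4$5 * (p$2$4$6 * p$3$4$7 - p$2$4$7 * p$3$4$6) - p$1$4$6 * (p$2$4$5 * p$3$4$7 - p$2$4$7 * p$3$4$5)
     + p$1$4$7 * (p$2$4$5 * p$3$4$6 - p$2$4$6 * p$3$4$5) = v"
    using poly'[of 4 4] by (simp add: sort zeros tau algebra_simps)
qed

text \<open>The new e5, e6, e7 are the products of e1, e2, e3 with e4, as they are for
  \<open>phi0\<close>. The determinant is \<open>v\<close>, so this matrix absorbs the orientation
  and one normal form suffices.\<close>

definition "rot = (\<chi> i. tuple7 (axis 1 1) (axis 2 1) (axis 3 1) (axis 4 1) (p$1$4) (p$2$4) (p$3$4) i)"

lemma row4: "p$1$4$1 = 0" "p$1$4$2 = 0" "p$1$4$3 = 0" "p$2$4$1 = 0" "p$2$4$2 = 0" "p$2$4$3 = 0"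
  "p$3$4$1 = 0" "p$3$4$2 = 0" "p$3$4$3 = 0" "p$i$4$4 = 0"
  by (simp_all add: sort zeros)

lemma rot_row: "rot $ 1 = axis 1 1" "rot $ 2 = axis 2 1" "rot $ 3 = axis 3 1" "rot $ 4 = axis 4 1"
  "rot $ 5 = p$1$4" "rot $ 6 = p$2$4" "rot $ 7 = p$3$4"
  by (simp_all add: rot_def)

lemma sum_axis: "(\<Sum>a\<in>UNIV. axis i 1 $ a * f a) = (f (i::7) :: real)"
proof -
  have "axis i 1 $ a * f a = (if a = i then f a else 0)" for a by (simp add: axis_def)
  then show ?thesis by simp
qed

lemma sum_row4:
  "(\<Sum>a\<in>UNIV. p$1$4$a * f a) = p$1$4$5 * f 5 + p$1$4$6 * f 6 + p$1$4$7 * f 7"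
  "(\<Sum>a\<in>UNIV. p$2$4$a * f a) = p$2$4$5 * f 5 + p$2$4$6 * f 6 + p$2$4$7 * f 7"
  "(\<Sum>a\<in>UNIV. p$3$4$a * f a) = p$3$4$5 * f 5 + p$3$4$6 * f 6 + p$3$4$7 * f 7"
  by (simp_all add: sum_7 row4)

lemma act_rot: "act rot p $ i $ j $ k =
    (\<Sum>a\<in>UNIV. rot$i$a * (\<Sum>b\<in>UNIV. rot$j$b * (\<Sum>c\<in>UNIV. rot$k$c * p$a$b$c)))"
  by (simp add: act_nth sum_distrib_left mult_ac)

lemmas act_rot_simps = act_rot rot_row sum_axis sum_row4 sort zeros tau l1

lemma normal_form: "act rot p = phi0"
proof (rule alternating3_eqI)
  show "alternating3 (act rot p)" "alternating3 phi0"
    using alt by (simp_all add: act_alternating alternating3_phi0)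
  note d = frame[unfolded dot_def] v[unfolded power2_eq_square]
  have "\<forall>i j k. rk i < rk j \<longrightarrow> rk j < rk k \<longrightarrow> act rot p $ i $ j $ k = phi0 $ i $ j $ k"
    apply (simp add: forall_7 phi0_def basis3_def Let_def)
    apply (simp add: act_rot_simps)
    apply (simp add: selfdual)
    apply (intro conjI)
                       apply (algebra | (use d(1-6) in \<open>simp add: mult_ac\<close>; fail) | (use d(7,8) in algebra) | (use d in algebra))+
    done
  then show "act rot p $ i $ j $ k = phi0 $ i $ j $ k" if "rk i < rk j" "rk j < rk k" for i j k
    using that by blast
qed

lemma det_rot: "det rot \<noteq> 0"
proof -
  have "rot ** transpose rot = mat 1"
    using frame by (simp add: vec_eq_iff forall_7 matrix_matrix_mult_def sum_7 transpose_def rot_def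
        axis_def mat_def row4 dot_def algebra_simps)
  then have "det rot * det rot = 1" by (metis det_I det_mul det_transpose)
  then show ?thesis by auto
qed

end

section \<open>Metric and volume of the standard form, and reduction to it\<close>

lemma phi0_nth: "phi0$1$2$3 = 1" "phi0$1$2$4 = 0" "phi0$1$2$5 = 0" "phi0$1$2$6 = 0" "phi0$1$2$7 = 0" "phi0$1$3$4 = 0" "phi0$1$3$5 = 0" "phi0$1$3$6 = 0" "phi0$1$3$7 = 0" "phi0$1$4$5 = 1" "phi0$1$4$6 = 0" "phi0$1$4$7 = 0" "phi0$1$5$6 = 0" "phi0$1$5$7 = 0" "phi0$1$6$7 = - 1" "phi0$2$3$4 = 0" "phi0$2$3$5 = 0" "phi0$2$3$6 = 0" "phi0$2$3$7 = 0" "phi0$2$4$5 = 0" "phi0$2$4$6 = 1" "phi0$2$4$7 = 0" "phi0$2$5$6 = 0" "phi0$2$5$7 = 1" "phi0$2$6$7 = 0" "phi0$3$4$5 = 0" "phi0$3$4$6 = 0" "phi0$3$4$7 = 1" "phi0$3$5$6 = - 1" "phi0$3$5$7 = 0" "phi0$3$6$7 = 0" "phi0$4$5$6 = 0" "phi0$4$5$7 = 0" "phi0$4$6$7 = 0" "phi0$5$6$7 = 0"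
  by (simp_all add: phi0_def basis3_def)

lemmas phi0_sort = alt3_sort[OF alternating3_alt3[OF alternating3_phi0]]

lemma alternating3_alt2: "alternating3 p \<Longrightarrow> alt2 (\<lambda>j k. p$i$j$k)"
  unfolding alternating3_def alt2_def by blast

lemma determines_phi0: "determines phi0 (mat 1) 1"
proof -
  have "wedge_form phi0 i j = - 6 * mat 1 $ i $ j" (is "?P i j") for i j
  proof -
    note w = wedge_form_wedge wedge_expand[OF alternating3_alt2[OF alternating3_phi0]
        alternating3_alt2[OF alternating3_phi0] alternating3_phi0] wedge5_def
    have "\<forall>i j. rk i \<le> rk j \<longrightarrow> ?P i j"
      by (simp add: forall_7 mat_def) (simp add: w phi0_sort phi0_nth)
    moreover have "wedge_form phi0 i j = wedge_form phi0 j i"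
      by (simp add: wedge_form_wedge wedge_commute)
    moreover have "mat 1 $ i $ j = (mat 1 $ j $ i :: real)" by (simp add: mat_def)
    ultimately show ?thesis by (metis linear)
  qed
  then show ?thesis by (simp add: determines_def transpose_mat det_I)
qed

lemma phi0: "nondegenerate phi0" "metric phi0 = mat 1" "vol phi0 = 1" "ginv phi0 = mat 1"
proof -
  show n: "nondegenerate phi0" using determines_phi0 unfolding nondegenerate_def by blast
  show m: "metric phi0 = mat 1" "vol phi0 = 1" using determines_phi0 metric_eqI vol_eqI by blast+
  show "ginv phi0 = mat 1" by (rule ginv_unique[OF n]) (simp add: m)
qed

lemma exists_normal_form:
  assumes "alternating3 p" "nondegenerate p"
  shows "\<exists>M. det M \<noteq> 0 \<and> act M p = phi0"
proof -
  have d: "determines p (metric p) (vol p)" by (rule nondegenerate_determines[OF assms(2)])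
  then obtain e :: "7 \<Rightarrow> vec7" where "\<forall>i j. e i \<bullet> (metric p *v e j) = (if i = j then 1 else 0)"
    using orthonormal_extension[of "metric p" "{}"] unfolding determines_def by auto
  then have e: "(\<chi> i. e i) ** metric p ** transpose (\<chi> i. e i) = mat 1" (is "?M ** _ ** _ = _")
    by (rule congruent_identity)
  then have "det ?M * det (metric p) * det ?M = 1" by (metis det_I det_mul det_transpose)
  then have dM: "det ?M \<noteq> 0" by auto
  define q where "q = act ?M p"
  have q: "alternating3 q" "nondegenerate q" "metric q = mat 1"
    unfolding q_def using assms dM e by (simp_all add: act_alternating nondegenerate_act metric_act)
  then have dq: "determines q (mat 1) (vol q)" using nondegenerate_determines by metis
  have "q \<noteq> 0"
  proof
    assume "q = 0"
    then have "wedge_form q 1 1 = 0" by (simp add: wedge_form_def)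
    with dq pos_def_det_pos[OF dq] show False by (simp add: determines_def mat_def)
  qed
  then obtain f :: "7 \<Rightarrow> vec7" and l where f: "l > 0" "\<forall>i j. f i \<bullet> f j = (if i = j then 1 else 0)"
    "crs q (f 1) (f 2) = l *\<^sub>R f 3" "crs q (f 2) (f 3) = l *\<^sub>R f 1" "crs q (f 3) (f 1) = l *\<^sub>R f 2"
    by (rule exists_adapted_triple[OF q(1)])
  have E: "(\<chi> i. f i) ** mat 1 ** transpose (\<chi> i. f i) = mat 1" (is "?E ** _ ** _ = _")
    by (rule congruent_identity) (use f in simp)
  then have "det ?E * det ?E = 1" by (metis det_I det_mul det_transpose matrix_mul_rid)
  then have dE: "det ?E \<noteq> 0" by auto
  define r where "r = act ?E q"
  have r: "alternating3 r" "nondegenerate r" "metric r = mat 1"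
    unfolding r_def using q dE E by (simp_all add: act_alternating nondegenerate_act metric_act)
  then have dr: "determines r (mat 1) (vol r)" using nondegenerate_determines by metis
  have rn: "r $ i $ j $ k = crs q (f i) (f j) \<bullet> f k" for i j k
    unfolding r_def by (rule act_rows)
  have c13: "crs q (f 1) (f 3) = - (l *\<^sub>R f 2)" using crs_commute[OF q(1), of "f 1" "f 3"] f by simp
  interpret adapted_form r l "vol r"
  proof
    show "wmat r = (- 6 * vol r) *\<^sub>R mat 1" using determines_wmat(1)[OF dr] .
    show "(vol r)\<^sup>2 = 1" using dr unfolding determines_def by (metis det_I power2_abs real_sqrt_one power_one)
  qed (use r f in \<open>simp_all add: c13 rn\<close>)
  have "act (rot ** ?E ** ?M) p = phi0"
    using normal_form unfolding r_def q_def by (simp add: act_act matrix_mul_assoc)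
  moreover have "det (rot ** ?E ** ?M) \<noteq> 0" using det_rot dE dM by (simp add: det_mul)
  ultimately show ?thesis by blast
qed

subsection \<open>Naturality of the algebraic operations\<close>

text \<open>The infinitesimal action: the derivative of \<open>act\<close> at the identity in
  direction \<open>K\<close>. No metric is involved; \<open>diamond\<close> arises from it by
  raising the second index of its argument.\<close>

definition der :: "real^7^7 \<Rightarrow> ten3 \<Rightarrow> ten3" where
  "der K p = slot K p + vmap (slot K) p + vmap (vmap (slot K)) p"

lemma diamond_der: "diamond A p = der (A ** ginv p) p"
proof -
  have "diamond A p $ i $ j $ k = der (A ** ginv p) p $ i $ j $ k" for i j k
  proof -
    have swap: "(\<Sum>q\<in>UNIV. \<Sum>r\<in>UNIV. f q r) = (\<Sum>r\<in>UNIV. \<Sum>q\<in>UNIV. (f q r :: real))" for f :: "7 \<Rightarrow> 7 \<Rightarrow> real"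
      by (rule sum.swap)
    show ?thesis
      by (simp add: diamond_def der_def slot_nth matrix_matrix_mult_def sum.distrib distrib_left
          sum_distrib_left sum_distrib_right swap[of "\<lambda>q r. ginv p $ q $ r * _ q r"] mult_ac)
        (simp add: swap[of "\<lambda>q r. _ q * _ q r"] mult_ac)
  qed
  then show ?thesis by (simp add: vec_eq_iff)
qed

lemma act_der:
  assumes "N ** M = mat 1" shows "act M (der K p) = der (M ** K ** N) (act M p)"
proof -
  have K: "M ** K ** N ** M = M ** K"
    by (metis assms matrix_mul_assoc matrix_mul_rid)
  have 1: "slot (M ** K ** N) (act M p) = act M (slot K p)"
    by (simp add: act_def slot_slot K slot_vmap[OF linear_act2, symmetric])
  have 2: "vmap (slot (M ** K ** N)) (act M p) = act M (vmap (slot K) p)"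
    by (simp add: act_def act2_def slot_vmap[OF linear_slot, symmetric] slot_slot K)
  have 3: "vmap (vmap (slot (M ** K ** N))) (act M p) = act M (vmap (vmap (slot K)) p)"
    by (simp add: act_def act2_def slot_vmap[OF linear_vmap[OF linear_slot], symmetric]
        slot_vmap[OF linear_slot, symmetric] slot_slot K)
  show ?thesis
    unfolding der_def linear_add[OF linear_act] 1 2 3 ..
qed

lemma act2_ginv:
  assumes "nondegenerate p" "N ** M = mat 1"
  shows "act2 M A ** ginv (act M p) = M ** (A ** ginv p) ** N"
proof -
  have "transpose M ** transpose N = mat 1" using assms(2) by (metis matrix_transpose_mul transpose_mat)
  then have "X ** transpose M ** transpose N = X" for X :: ten2
    by (metis matrix_mul_assoc matrix_mul_rid)
  then show ?thesis unfolding ginv_act[OF assms] act2_matrix by (simp add: matrix_mul_assoc)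
qed

lemma diamond_act:
  assumes "nondegenerate p" "N ** M = mat 1"
  shows "diamond (act2 M A) (act M p) = act M (diamond A p)"
  unfolding diamond_der act2_ginv[OF assms] act_der[OF assms(2)] ..

lemma hook_psi_sum: "hook_psi X p = (\<Sum>m\<in>UNIV. (ginv p *v X) $ m *\<^sub>R psi p $ m)"
  by (simp add: vec_eq_iff hook_psi_def matrix_vector_mult_def sum_distrib_right)

text \<open>Raised indices transform with the inverse transpose, so contracting a raised index with
  a lowered one gives an invariant. This makes \<open>hook_psi\<close> natural.\<close>

lemma pairing_slot:
  assumes "N ** M = mat 1"
  shows "(\<Sum>m\<in>UNIV. (transpose N *v y) $ m *\<^sub>R slot M t $ m) = (\<Sum>m\<in>UNIV. y $ m *\<^sub>R t $ m)"
proof -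
  have "(\<Sum>m\<in>UNIV. z $ m *\<^sub>R slot M t $ m) = (\<Sum>n\<in>UNIV. (transpose M *v z) $ n *\<^sub>R t $ n)" for z
  proof -
    have "(\<Sum>m\<in>UNIV. z $ m *\<^sub>R slot M t $ m) = (\<Sum>m\<in>UNIV. \<Sum>n\<in>UNIV. (M $ m $ n * z $ m) *\<^sub>R t $ n)"
      by (simp add: slot_nth scaleR_right.sum mult.commute)
    also have "\<dots> = (\<Sum>n\<in>UNIV. (transpose M *v z) $ n *\<^sub>R t $ n)"
      by (subst sum.swap) (simp add: vector_matrix_mult_def scaleR_left.sum mult.commute)
    finally show ?thesis .
  qed
  moreover have "transpose M *v (transpose N *v y) = y"
    by (metis assms matrix_transpose_mul matrix_vector_mul_assoc matrix_vector_mul_lid transpose_mat)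
  ultimately show ?thesis by metis
qed

lemma left_inverse_det: "N ** M = (mat 1 :: real^7^7) \<Longrightarrow> det M \<noteq> 0"
  by (metis invertible_det_nz invertible_left_inverse)

lemma exists_left_inverse: "det M \<noteq> 0 \<Longrightarrow> \<exists>N. N ** M = (mat 1 :: real^7^7)"
  by (metis invertible_det_nz invertible_left_inverse)

lemma hook_psi_act:
  assumes "nondegenerate p" "N ** M = mat 1"
  shows "hook_psi (M *v X) (act M p) = act M (hook_psi X p)"
proof -
  have "ginv (act M p) *v (M *v X) = transpose N *v (ginv p *v X)"
    unfolding ginv_act[OF assms] using assms(2)
    by (metis matrix_mul_assoc matrix_mul_rid matrix_vector_mul_assoc)
  then show ?thesis
    unfolding hook_psi_sum psi_act[OF assms(1) left_inverse_det[OF assms(2)]] act4_def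
    by (simp only: pairing_slot[OF assms(2)] vmap_nth linear_sum[OF linear_act] linear_scale[OF linear_act])
qed

lemma of_pair_act:
  assumes "nondegenerate p" "N ** M = mat 1"
  shows "of_pair (act M p) (act2 M h, M *v X) = act M (of_pair p (h, X))"
  by (simp add: of_pair_def diamond_act[OF assms] hook_psi_act[OF assms] linear_add[OF linear_act])

lemma inner_slot:
  fixes t u :: "'a::real_inner^7"
  shows "slot M t \<bullet> u = t \<bullet> slot (transpose M) u"
  unfolding inner_vec_def slot_nth inner_sum_left inner_sum_right inner_scaleR_left inner_scaleR_right
  by (subst sum.swap) (simp add: transpose_def)

lemma inner_vmap:
  fixes t u :: "'a::real_inner^7"
  assumes "\<And>x y. L x \<bullet> y = x \<bullet> L' y" shows "vmap L t \<bullet> u = t \<bullet> vmap L' u"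
  by (simp add: inner_vec_def[of "vmap L t"] inner_vec_def[of t] assms)

lemma inner_act2: "act2 M t \<bullet> u = t \<bullet> act2 (transpose M) u"
  unfolding act2_def inner_slot inner_vmap[OF inner_slot]
  by (simp add: slot_vmap[OF linear_slot])

lemma inner_act: "act M t \<bullet> u = t \<bullet> act (transpose M) u"
  unfolding act_def inner_slot inner_vmap[OF inner_act2]
  by (simp add: slot_vmap[OF linear_act2])

text \<open>A left inverse of \<open>X \<mapsto> X \<lrcorner> \<psi>\<close>, from \<open>\<psi>\<^sub>i\<^sub>j\<^sub>k\<^sub>l \<psi>\<^sub>m\<^sub>j\<^sub>k\<^sub>l = 24 g\<^sub>i\<^sub>m\<close>.\<close>

definition unhook :: "ten3 \<Rightarrow> ten3 \<Rightarrow> vec7" where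
  "unhook p \<eta> = (\<chi> q. (psi p $ q \<bullet> act (ginv p) \<eta>) / 24)"

lemma unhook_act:
  assumes "nondegenerate p" "N ** M = mat 1"
  shows "unhook (act M p) (act M \<eta>) = M *v unhook p \<eta>"
proof -
  have eq: "act (ginv (act M p)) (act M \<eta>) = act (transpose N) (act (ginv p) \<eta>)"
    unfolding ginv_act[OF assms] act_act using assms(2) by (metis matrix_mul_assoc matrix_mul_rid)
  have "act M a \<bullet> act (transpose N) b = a \<bullet> b" for a b
  proof -
    have "transpose M ** transpose N = mat 1" using assms(2) by (metis matrix_transpose_mul transpose_mat)
    then show ?thesis by (simp add: inner_act act_act)
  qed
  then show ?thesis
    unfolding unhook_def eq
    by (simp add: vec_eq_iff psi_act[OF assms(1) left_inverse_det[OF assms(2)]] act4_def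
        slot_nth inner_sum_left matrix_vector_mult_def sum_divide_distrib)
qed

text \<open>The algebraic part of \<open>VT\<close>. On decomposable tensors it is the cross product
  of covectors, so one naturality lemma serves both.\<close>

definition contract2 :: "ten3 \<Rightarrow> ten2 \<Rightarrow> vec7" where
  "contract2 p T = (\<chi> k. \<Sum>a\<in>UNIV. \<Sum>b\<in>UNIV. act2 (ginv p) T $ a $ b * p $ a $ b $ k)"

lemma contract2_inner: "contract2 p T \<bullet> z = p \<bullet> (\<chi> a b. act2 (ginv p) T $ a $ b *\<^sub>R z)"
proof -
  have "contract2 p T \<bullet> z = (\<Sum>k\<in>UNIV. \<Sum>a\<in>UNIV. \<Sum>b\<in>UNIV. act2 (ginv p) T $ a $ b * (p $ a $ b $ k * z $ k))"
    by (simp add: contract2_def inner_vec_def sum_distrib_left sum_distrib_right mult_ac)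
  also have "\<dots> = (\<Sum>a\<in>UNIV. \<Sum>b\<in>UNIV. \<Sum>k\<in>UNIV. act2 (ginv p) T $ a $ b * (p $ a $ b $ k * z $ k))"
    by (rule sum_rotate[symmetric])
  finally show ?thesis by (simp add: inner_vec_def mult_ac)
qed

lemma contract2_act:
  assumes "nondegenerate p" "N ** M = mat 1"
  shows "contract2 (act M p) (act2 M T) = M *v contract2 p T"
proof -
  have outer: "act K (\<chi> a b. S $ a $ b *\<^sub>R z) = (\<chi> a b. act2 K S $ a $ b *\<^sub>R (K *v z))" for K S z
    by (simp add: vec_eq_iff act_def act2_def slot_nth matrix_vector_mult_def
        sum_distrib_left sum_distrib_right mult_ac)
  have "transpose M ** (transpose N ** ginv p ** N) ** M = ginv p"
  proof -
    have "transpose M ** transpose N = mat 1" using assms(2) by (metis matrix_transpose_mul transpose_mat)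
    then show ?thesis by (metis assms(2) matrix_mul_assoc matrix_mul_lid matrix_mul_rid)
  qed
  then have *: "act2 (transpose M) (act2 (ginv (act M p)) (act2 M T)) = act2 (ginv p) T"
    by (simp add: act2_act2 ginv_act[OF assms] matrix_mul_assoc)
  have "contract2 (act M p) (act2 M T) \<bullet> z = (M *v contract2 p T) \<bullet> z" for z
  proof -
    have "contract2 (act M p) (act2 M T) \<bullet> z = contract2 p T \<bullet> (transpose M *v z)"
      unfolding contract2_inner inner_act outer * ..
    also have "\<dots> = (M *v contract2 p T) \<bullet> z"
      by (metis dot_lmul_matrix inner_commute transpose_matrix_vector transpose_transpose)
    finally show ?thesis .
  qed
  then show ?thesis by (metis vector_eq_rdot)
qed

definition outer :: "vec7 \<Rightarrow> vec7 \<Rightarrow> ten2" where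
  "outer x y = (\<chi> i j. x $ i * y $ j)"

lemma act2_outer: "act2 M (outer x y) = outer (M *v x) (M *v y)"
  by (simp add: vec_eq_iff act2_nth outer_def matrix_vector_mult_def sum_product mult_ac)

definition cross :: "ten3 \<Rightarrow> vec7 \<Rightarrow> vec7 \<Rightarrow> vec7" where
  "cross p x y = contract2 p (outer x y)"

lemma cross_act:
  assumes "nondegenerate p" "N ** M = mat 1"
  shows "cross (act M p) (M *v x) (M *v y) = M *v cross p x y"
  unfolding cross_def act2_outer[symmetric] by (rule contract2_act[OF assms])

subsection \<open>Identities for the standard form\<close>

lemma sum_sign_compose:
  assumes "t permutes (UNIV :: 7 set)"
  shows "(\<Sum>s | s permutes (UNIV :: 7 set). of_int (sign s) * F s) =
     of_int (sign t) * (\<Sum>s | s permutes (UNIV :: 7 set). of_int (sign s) * F (s \<circ> t) :: real)"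
proof -
  have perm: "permutation s" if "s permutes (UNIV::7 set)" for s
    using that by (auto simp: permutation_permutes)
  have "(\<Sum>s | s permutes (UNIV :: 7 set). of_int (sign s) * F s) =
      (\<Sum>s | s permutes (UNIV :: 7 set). of_int (sign (s \<circ> t)) * F (s \<circ> t))"
    by (rule sum_permutations_compose_right[OF assms])
  also have "\<dots> = of_int (sign t) * (\<Sum>s | s permutes (UNIV :: 7 set). of_int (sign s) * F (s \<circ> t))"
    unfolding sum_distrib_left
    by (intro sum.cong refl) (simp add: sign_compose perm assms)
  finally show ?thesis .
qed

lemma sum_sign_swap:
  assumes "x \<noteq> y"
  shows "(\<Sum>s | s permutes (UNIV :: 7 set). of_int (sign s) * F s) =
     - (\<Sum>s | s permutes (UNIV :: 7 set). of_int (sign s) * F (s \<circ> Transposition.transpose x y) :: real)"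
  using sum_sign_compose[OF permutes_swap_id[of x UNIV y], of F] assms by (simp add: sign_swap_id)

lemma wedge_transpose_left: "wedge (transpose q) r p = - wedge q r p"
  using sum_sign_swap[of 1 2 "\<lambda>s. q$(s 2)$(s 1) * r$(s 3)$(s 4) * p$(s 5)$(s 6)$(s 7)"]
  by (simp add: wedge_def transpose_def Transposition.transpose_def mult.assoc)

lemma wedge_diff_left: "wedge (q - q') r p = wedge q r p - wedge q' r p"
  by (simp add: wedge_def algebra_simps sum_subtractf)

text \<open>Puts alternating matrices in place of arbitrary ones, as \<open>wedge_expand\<close>
  demands; each antisymmetrization without a factor 1/2 doubles the value.\<close>

lemma wedge_alternate: "wedge q r p = wedge (q - transpose q) (r - transpose r) p / 4"
  by (simp add: wedge_diff_left wedge_transpose_left wedge_commute[of _ "r - transpose r"])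
     (simp add: wedge_diff_left wedge_transpose_left wedge_commute[of r])

definition unit2 :: "7 \<Rightarrow> 7 \<Rightarrow> ten2" where
  "unit2 a b = (\<chi> i j. if i = a \<and> j = b then 1 else 0)"

text \<open>Prescribing the four free indices amounts to wedging with unit tensors, which brings the
  components of the dual within reach of \<open>wedge_expand\<close>.\<close>

lemma hodge_wedge: "hodge R $ a $ b $ c $ d = wedge (unit2 a b) (unit2 c d) R"
proof -
  \<comment> \<open>A cyclic shift that moves the four free indices to the front; a cycle of odd
    length is even.\<close>
  define t :: "7 \<Rightarrow> 7" where "t = Transposition.transpose 1 5 \<circ> (Transposition.transpose 5 2 \<circ>
    (Transposition.transpose 2 6 \<circ> (Transposition.transpose 6 3 \<circ>
    (Transposition.transpose 3 7 \<circ> Transposition.transpose 7 4))))"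
  have t: "t permutes UNIV" unfolding t_def by (intro permutes_compose permutes_swap_id) simp_all
  have "sign t = 1"
    unfolding t_def by (simp add: sign_compose permutation_compose permutation_swap_id sign_swap_id)
  have tv: "t 1 = 5" "t 2 = 6" "t 3 = 7" "t 4 = 1" "t 5 = 2" "t 6 = 3" "t 7 = 4"
    by (simp_all add: t_def Transposition.transpose_def)
  have "hodge R $ a $ b $ c $ d = (\<Sum>s | s permutes (UNIV :: 7 set). of_int (sign s) *
     (if s 4 = a \<and> s 5 = b \<and> s 6 = c \<and> s 7 = d then R$(s 1)$(s 2)$(s 3) else 0))"
    unfolding hodge_def by (simp, rule sum.mono_neutral_cong_left) (auto simp: finite_permutations)
  also note sum_sign_compose[OF t]
  also have "of_int (sign t) * (\<Sum>s | s permutes (UNIV :: 7 set). of_int (sign s) *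
     (if (s \<circ> t) 4 = a \<and> (s \<circ> t) 5 = b \<and> (s \<circ> t) 6 = c \<and> (s \<circ> t) 7 = d
      then R$((s \<circ> t) 1)$((s \<circ> t) 2)$((s \<circ> t) 3) else 0)) = wedge (unit2 a b) (unit2 c d) R"
    unfolding wedge_def by (simp add: tv \<open>sign t = 1\<close>) (intro sum.cong refl, simp add: unit2_def tv)
  finally show ?thesis .
qed

lemma hodge_alternating: "alternating3 (hodge R $ a)" "hodge R $ a $ b $ c $ d = - hodge R $ b $ a $ c $ d"
proof -
  have 1: "hodge R $ a $ b $ c $ d = - hodge R $ b $ a $ c $ d" for a b c d
    using wedge_transpose_left[of "unit2 a b"]
    by (simp add: hodge_wedge) (simp add: transpose_def unit2_def conj_commute)
  have 2: "hodge R $ a $ b $ c $ d = - hodge R $ a $ b $ d $ c" for a b c d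
  proof -
    have "hodge R $ a $ b $ x $ y = hodge R $ x $ y $ a $ b" for x y
      unfolding hodge_wedge by (rule wedge_commute)
    then show ?thesis using 1[of c d a b] by metis
  qed
  have 3: "hodge R $ a $ b $ c $ d = - hodge R $ a $ c $ b $ d" for a b c d
    using sum_sign_swap[of 2 3 "\<lambda>s. unit2 a b$(s 1)$(s 2) * unit2 c d$(s 3)$(s 4) * R$(s 5)$(s 6)$(s 7)"]
    by (simp add: hodge_wedge wedge_def Transposition.transpose_def mult.assoc unit2_def)
      (intro sum.cong refl, simp)
  show "hodge R $ a $ b $ c $ d = - hodge R $ b $ a $ c $ d" by (rule 1)
  show "alternating3 (hodge R $ a)" unfolding alternating3_def using 2 3 by blast
qed

lemma psi_alternating: "alternating3 (psi p $ a)" "psi p $ a $ b = - psi p $ b $ a"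
proof -
  show "alternating3 (psi p $ a)"
    by (simp add: psi_hodge alternating3_scaleR hodge_alternating)
  have "psi p $ a $ b $ c $ d = - psi p $ b $ a $ c $ d" for c d
    using hodge_alternating(2)[of "act (ginv p) p" a b c d] by (simp add: psi_hodge)
  then show "psi p $ a $ b = - psi p $ b $ a" by (simp add: vec_eq_iff)
qed

lemma psi_phi0_wedge: "psi phi0 $ a $ b $ c $ d = wedge (unit2 a b - unit2 b a) (unit2 c d - unit2 d c) phi0 / 24"
proof -
  have "transpose (unit2 a b) = unit2 b a" for a b by (auto simp: transpose_def unit2_def vec_eq_iff)
  then show ?thesis by (simp add: psi_hodge phi0 hodge_wedge wedge_alternate[of "unit2 a b"])
qed

lemma alt2_unit2: "alt2 (\<lambda>i j. (unit2 a b - unit2 b a)$i$j)"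
  unfolding alt2_def unit2_def by (simp add: conj_commute)

lemmas wedge_phi0 = wedge_expand[OF _ _ alternating3_phi0, unfolded wedge5_def phi0_nth, simplified]

lemma psi_phi0_nth: "psi phi0$1$2$3$4 = 0" "psi phi0$1$2$3$5 = 0" "psi phi0$1$2$3$6 = 0" "psi phi0$1$2$3$7 = 0" "psi phi0$1$2$4$5 = 0" "psi phi0$1$2$4$6 = 0" "psi phi0$1$2$4$7 = - 1" "psi phi0$1$2$5$6 = 1" "psi phi0$1$2$5$7 = 0" "psi phi0$1$2$6$7 = 0" "psi phi0$1$3$4$5 = 0" "psi phi0$1$3$4$6 = 1" "psi phi0$1$3$4$7 = 0" "psi phi0$1$3$5$6 = 0" "psi phi0$1$3$5$7 = 1" "psi phi0$1$3$6$7 = 0" "psi phi0$1$4$5$6 = 0" "psi phi0$1$4$5$7 = 0" "psi phi0$1$4$6$7 = 0" "psi phi0$1$5$6$7 = 0" "psi phi0$2$3$4$5 = - 1" "psi phi0$2$3$4$6 = 0" "psi phi0$2$3$4$7 = 0" "psi phi0$2$3$5$6 = 0" "psi phi0$2$3$5$7 = 0" "psi phi0$2$3$6$7 = 1" "psi phi0$2$4$5$6 = 0" "psi phi0$2$4$5$7 = 0" "psi phi0$2$4$6$7 = 0" "psi phi0$2$5$6$7 = 0" "psi phi0$3$4$5$6 = 0" "psi phi0$3$4$5$7 = 0" "psi phi0$3$4$6$7 = 0" "psi phi0$3$5$6$7 = 0" "psi phi0$4$5$6$7 = 1"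
  unfolding psi_phi0_wedge wedge_phi0[OF alt2_unit2 alt2_unit2]
  by (simp_all add: unit2_def)

lemma alternating3_sum: "(\<And>i. i \<in> I \<Longrightarrow> alternating3 (f i)) \<Longrightarrow> alternating3 (\<Sum>i\<in>I. f i)"
proof (induction I rule: infinite_finite_induct)
  case (insert x F)
  then show ?case by (simp add: alternating3_add)
qed (simp_all add: alternating3_def)

lemma hook_psi_alternating: "alternating3 (hook_psi X p)"
  unfolding hook_psi_sum by (intro alternating3_sum alternating3_scaleR psi_alternating)

lemma der_nth: "der K p $ i $ j $ k =
   (\<Sum>q\<in>UNIV. K$i$q * p$q$j$k) + (\<Sum>q\<in>UNIV. K$j$q * p$i$q$k) + (\<Sum>q\<in>UNIV. K$k$q * p$i$j$q)"
  by (simp add: der_def slot_nth)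

lemma der_alternating: assumes "alternating3 p" shows "alternating3 (der K p)"
proof -
  note a = alternating3D[OF assms]
  have "der K p $ j $ i $ k = - der K p $ i $ j $ k" for i j k
  proof -
    have "(\<Sum>q\<in>UNIV. K$j$q * p$q$i$k) = - (\<Sum>q\<in>UNIV. K$j$q * p$i$q$k)" for i j
      unfolding sum_negf[symmetric] by (intro sum.cong refl) (subst a(1), simp)
    moreover have "(\<Sum>q\<in>UNIV. K$k$q * p$j$i$q) = - (\<Sum>q\<in>UNIV. K$k$q * p$i$j$q)"
      unfolding sum_negf[symmetric] by (intro sum.cong refl) (subst a(1), simp)
    ultimately show ?thesis by (simp add: der_nth)
  qed
  moreover have "der K p $ i $ k $ j = - der K p $ i $ j $ k" for i j k
  proof -
    have "(\<Sum>q\<in>UNIV. K$k$q * p$i$q$j) = - (\<Sum>q\<in>UNIV. K$k$q * p$i$j$q)" for k j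
      unfolding sum_negf[symmetric] by (intro sum.cong refl) (subst a(2), simp)
    moreover have "(\<Sum>q\<in>UNIV. K$i$q * p$q$k$j) = - (\<Sum>q\<in>UNIV. K$i$q * p$q$j$k)"
      unfolding sum_negf[symmetric] by (intro sum.cong refl) (subst a(2), simp)
    ultimately show ?thesis by (simp add: der_nth)
  qed
  ultimately show ?thesis unfolding alternating3_def by (metis minus_minus)
qed

lemma diamond_alternating: "alternating3 p \<Longrightarrow> alternating3 (diamond A p)"
  by (simp add: diamond_der der_alternating)

lemma of_pair_alternating: "alternating3 p \<Longrightarrow> alternating3 (of_pair p u)"
  by (simp add: of_pair_def alternating3_add diamond_alternating hook_psi_alternating)

lemma psi_sort:
  "psi p $ a $ a $ b $ c = 0" "psi p $ a $ b $ b $ c = 0" "psi p $ a $ b $ c $ c = 0" "psi p $ a $ b $ c $ b = 0"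
  "psi p $ a $ b $ a $ c = 0" "psi p $ a $ b $ c $ a = 0"
  "rk b < rk a \<Longrightarrow> psi p $ a $ b $ c $ d = - psi p $ b $ a $ c $ d"
  "rk c < rk b \<Longrightarrow> psi p $ a $ b $ c $ d = - psi p $ a $ c $ b $ d"
  "rk d < rk c \<Longrightarrow> psi p $ a $ b $ c $ d = - psi p $ a $ b $ d $ c"
proof -
  note s = alt3_sort[OF alternating3_alt3[OF psi_alternating(1)]]
  have 1: "psi p $ a $ b $ c $ d = - psi p $ b $ a $ c $ d" for a b c d
    by (simp add: psi_alternating(2)[of p a b])
  show "psi p $ a $ b $ b $ c = 0" "psi p $ a $ b $ c $ c = 0" "psi p $ a $ b $ c $ b = 0" by (rule s)+
  show 0: "psi p $ a $ a $ b $ c = 0" for b c using 1[of a a b c] by simp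
  show 2: "psi p $ a $ b $ a $ c = 0" for c
    using alternating3D(1)[OF psi_alternating(1)[of p a], of b a c] 0[of b c] by simp
  show "psi p $ a $ b $ c $ a = 0"
    using alternating3D(2)[OF psi_alternating(1)[of p a], of b c a] 2[of c] by simp
  show "rk b < rk a \<Longrightarrow> psi p $ a $ b $ c $ d = - psi p $ b $ a $ c $ d" by (rule 1)
  show "rk c < rk b \<Longrightarrow> psi p $ a $ b $ c $ d = - psi p $ a $ c $ b $ d" by (rule s(4))
  show "rk d < rk c \<Longrightarrow> psi p $ a $ b $ c $ d = - psi p $ a $ b $ d $ c" by (rule s(5))
qed

lemma phi0_ops:
  "diamond A phi0 = der A phi0" "hook_psi X phi0 = (\<Sum>m\<in>UNIV. X $ m *\<^sub>R psi phi0 $ m)"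
  "contract2 phi0 T $ k = (\<Sum>a\<in>UNIV. \<Sum>b\<in>UNIV. T$a$b * phi0$a$b$k)"
  "unhook phi0 \<eta> $ q = (psi phi0 $ q \<bullet> \<eta>) / 24"
  by (simp_all add: diamond_der hook_psi_sum contract2_def unhook_def phi0)

lemma contract2_phi0:
  "contract2 phi0 T $ 1 = T$2$3 - T$3$2 + T$4$5 - T$5$4 - T$6$7 + T$7$6"
  "contract2 phi0 T $ 2 = T$3$1 - T$1$3 + T$4$6 - T$6$4 + T$5$7 - T$7$5"
  "contract2 phi0 T $ 3 = T$1$2 - T$2$1 + T$4$7 - T$7$4 - T$5$6 + T$6$5"
  "contract2 phi0 T $ 4 = T$5$1 - T$1$5 + T$6$2 - T$2$6 + T$7$3 - T$3$7"
  "contract2 phi0 T $ 5 = T$1$4 - T$4$1 + T$7$2 - T$2$7 - T$6$3 + T$3$6"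
  "contract2 phi0 T $ 6 = T$2$4 - T$4$2 - T$7$1 + T$1$7 - T$3$5 + T$5$3"
  "contract2 phi0 T $ 7 = T$3$4 - T$4$3 - T$1$6 + T$6$1 + T$2$5 - T$5$2"
  by (simp_all add: phi0_ops sum_7 phi0_nth phi0_sort)

lemma hook_psi_phi0_nth: "hook_psi X phi0 $ i $ j $ k = (\<Sum>m\<in>UNIV. X $ m * psi phi0 $ m $ i $ j $ k)"
  by (simp add: phi0_ops)

lemma forall_sorted:
  assumes "alternating3 p" "alternating3 q" "\<forall>i j k. rk i < rk j \<longrightarrow> rk j < rk k \<longrightarrow> p$i$j$k = q$i$j$k"
  shows "p = q"
  using assms alternating3_eqI by blast

lemma symD: assumes "transpose h = h" shows "h $ a $ b = h $ b $ (a :: 7)"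
proof -
  have "h $ a $ b = transpose h $ b $ a" by (simp add: transpose_def)
  then show ?thesis unfolding assms .
qed

lemma skewD: assumes "transpose A = - (A :: ten2)" shows "A $ j $ i = - A $ i $ j"
proof -
  have "A $ j $ i = transpose A $ i $ j" by (simp add: transpose_def)
  then show ?thesis unfolding assms by simp
qed

text \<open>The skew matrices killed by \<open>contract2 phi0\<close> form the Lie algebra g2 of the
  stabilizer, so only the seven-dimensional remainder of \<open>A\<close> acts on the form.\<close>

lemma diamond_skew_phi0:
  assumes "transpose A = - A"
  shows "diamond A phi0 = hook_psi ((- 1/2) *\<^sub>R contract2 phi0 A) phi0"
proof -
  have "alt2 (\<lambda>i j. A$i$j)" unfolding alt2_def using skewD[OF assms] by blast
  note A = alt2_sort[OF this]
  show ?thesis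
  proof (rule forall_sorted)
    show "\<forall>i j k. rk i < rk j \<longrightarrow> rk j < rk k \<longrightarrow>
        diamond A phi0 $ i $ j $ k = hook_psi ((- 1/2) *\<^sub>R contract2 phi0 A) phi0 $ i $ j $ k"
      by (simp add: forall_7)
         (simp add: phi0_ops(1) der_nth hook_psi_phi0_nth sum_7 phi0_nth phi0_sort psi_phi0_nth psi_sort
          contract2_phi0 A field_simps)
  qed (simp_all add: diamond_alternating hook_psi_alternating alternating3_phi0)
qed

text \<open>Inverse of \<open>(h, X) \<mapsto> h \<diamondop> \<phi> + X \<lrcorner> \<psi>\<close> in the standard frame: contracting \<open>(h \<diamondop> \<phi>)\<^sub>i\<^sub>a\<^sub>b\<close> with
  \<open>\<phi>\<^sub>j\<^sub>a\<^sub>b\<close> gives \<open>4 h\<^sub>i\<^sub>j + 2 tr h \<delta>\<^sub>i\<^sub>j\<close>.\<close>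

definition trace_phi0 :: "ten3 \<Rightarrow> ten2" where
  "trace_phi0 \<eta> = (\<chi> i j. contract2 phi0 (\<eta> $ i) $ j)"

text \<open>The trace of 4 h + 2 tr(h) delta is 18 tr(h), so 1/36 of it is the term tr(h)/2 that
  remains after dividing by 4. Symmetrizing turns 1/4 into 1/8 and discards the contribution of X,
  which is skew.\<close>

definition sym_part0 :: "ten3 \<Rightarrow> ten2" where
  "sym_part0 \<eta> = (1/8) *\<^sub>R (trace_phi0 \<eta> + transpose (trace_phi0 \<eta>))
     - ((\<Sum>k\<in>UNIV. trace_phi0 \<eta> $ k $ k) / 36) *\<^sub>R mat 1"

lemma sym_part0_sym: "transpose (sym_part0 \<eta>) = sym_part0 \<eta>"
  by (simp add: sym_part0_def transpose_def vec_eq_iff mat_def algebra_simps)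

lemma unhook_phi0:
  assumes "alternating3 \<eta>"
  shows "unhook phi0 \<eta> $ 1 = (\<eta>$3$5$7 + \<eta>$3$4$6 + \<eta>$2$5$6 - \<eta>$2$4$7) / 4"
    "unhook phi0 \<eta> $ 2 = (\<eta>$3$6$7 - \<eta>$3$4$5 - \<eta>$1$5$6 + \<eta>$1$4$7) / 4"
    "unhook phi0 \<eta> $ 3 = (- \<eta>$2$6$7 + \<eta>$2$4$5 - \<eta>$1$5$7 - \<eta>$1$4$6) / 4"
    "unhook phi0 \<eta> $ 4 = (\<eta>$5$6$7 - \<eta>$2$3$5 + \<eta>$1$3$6 - \<eta>$1$2$7) / 4"
    "unhook phi0 \<eta> $ 5 = (- \<eta>$4$6$7 + \<eta>$2$3$4 + \<eta>$1$3$7 + \<eta>$1$2$6) / 4"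
    "unhook phi0 \<eta> $ 6 = (\<eta>$4$5$7 + \<eta>$2$3$7 - \<eta>$1$3$4 - \<eta>$1$2$5) / 4"
    "unhook phi0 \<eta> $ 7 = (- \<eta>$4$5$6 - \<eta>$2$3$6 - \<eta>$1$3$5 + \<eta>$1$2$4) / 4"
  by (simp_all add: phi0_ops inner_vec_def sum_7 psi_phi0_nth psi_sort
      alt3_sort[OF alternating3_alt3[OF assms]])

lemma unhook_hook_phi0: "unhook phi0 (hook_psi X phi0) = X"
  by (simp add: vec_eq_iff forall_7 unhook_phi0 hook_psi_alternating)
     (simp add: hook_psi_phi0_nth sum_7 psi_phi0_nth psi_sort)

lemma of_pair_surj_phi0:
  assumes "alternating3 \<eta>"
  shows "of_pair phi0 (sym_part0 \<eta>, unhook phi0 \<eta>) = \<eta>"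
proof (rule forall_sorted)
  show "\<forall>i j k. rk i < rk j \<longrightarrow> rk j < rk k \<longrightarrow>
     of_pair phi0 (sym_part0 \<eta>, unhook phi0 \<eta>) $ i $ j $ k = \<eta> $ i $ j $ k"
    by (simp add: forall_7)
       (simp add: of_pair_def phi0_ops(1) der_nth hook_psi_phi0_nth sum_7 phi0_nth phi0_sort psi_phi0_nth psi_sort
        unhook_phi0[OF assms] sym_part0_def trace_phi0_def transpose_def mat_def contract2_phi0
        alt3_sort[OF alternating3_alt3[OF assms]] field_simps)
qed (simp_all add: of_pair_alternating alternating3_phi0 assms)

lemma of_pair_inj_phi0:
  assumes "transpose h = h"
  shows "sym_part0 (of_pair phi0 (h, X)) = h" "unhook phi0 (of_pair phi0 (h, X)) = X"
proof -
  note h = symD[OF assms]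
  note simps = of_pair_def phi0_ops(1) der_nth hook_psi_phi0_nth sum_7 phi0_nth phi0_sort psi_phi0_nth psi_sort h
  show "unhook phi0 (of_pair phi0 (h, X)) = X"
    by (simp add: vec_eq_iff forall_7 unhook_phi0 of_pair_alternating alternating3_phi0) (simp add: simps)
  have "trace_phi0 (of_pair phi0 (h, X)) $ k $ k = 4 * h $ k $ k + 2 * (\<Sum>k\<in>UNIV. h $ k $ k)" for k
  proof -
    have "\<forall>k. trace_phi0 (of_pair phi0 (h, X)) $ k $ k = 4 * h $ k $ k + 2 * (\<Sum>k\<in>UNIV. h $ k $ k)"
      by (simp add: forall_7 trace_phi0_def contract2_phi0) (simp add: simps)
    then show ?thesis by blast
  qed
  moreover have "trace_phi0 (of_pair phi0 (h, X)) $ i $ j + trace_phi0 (of_pair phi0 (h, X)) $ j $ i = 8 * h $ i $ j"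
    if "i \<noteq> j" for i j
  proof -
    have "\<forall>i j. rk i < rk j \<longrightarrow> trace_phi0 (of_pair phi0 (h, X)) $ i $ j + trace_phi0 (of_pair phi0 (h, X)) $ j $ i
        = 8 * h $ i $ j"
      by (simp add: forall_7 trace_phi0_def contract2_phi0) (simp add: simps)
    moreover have "rk i < rk j \<or> rk j < rk i"
      using that exhaust_7[of i] exhaust_7[of j] by auto
    ultimately show ?thesis using h[of i j] by (metis add.commute)
  qed
  ultimately show "sym_part0 (of_pair phi0 (h, X)) = h"
    by (simp add: vec_eq_iff sym_part0_def transpose_def mat_def sum.distrib flip: sum_distrib_left)
      (simp add: field_simps)
qed

text \<open>Shows a variation along psi as an infinitesimal rotation, the shape in which its effect
  on the metric is visible.\<close>

lemma hook_psi_diamond_phi0: "\<exists>A. transpose A = - A \<and> hook_psi X phi0 = diamond A phi0"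
proof -
  \<comment> \<open>The factor -1/3 comes from phi_mij phi_kij = 6 delta_mk together with the -1/2
    of \<open>diamond_skew_phi0\<close>.\<close>
  define A :: ten2 where "A = (\<chi> i j. - (1/3) * (\<Sum>m\<in>UNIV. X $ m * phi0 $ m $ i $ j))"
  have A: "transpose A = - A"
    unfolding A_def transpose_def by (simp add: vec_eq_iff sum_negf[symmetric])
      (intro allI sum.cong refl, subst alternating3D(2)[OF alternating3_phi0], simp)
  have "(- 1/2) *\<^sub>R contract2 phi0 A = X"
    by (simp add: vec_eq_iff forall_7 contract2_phi0) (simp add: A_def sum_7 phi0_nth phi0_sort)
  then show ?thesis using A diamond_skew_phi0[OF A] by metis
qed

text \<open>The double product rule of the imaginary octonions. It makes the cross product with a
  nonzero covector invertible on the orthogonal complement of that covector.\<close>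

lemma cross_cross_phi0: "cross phi0 x (cross phi0 x y) = (x \<bullet> y) *\<^sub>R x - (x \<bullet> x) *\<^sub>R y"
  by (simp add: vec_eq_iff forall_7 cross_def contract2_phi0 outer_def inner_vec_def sum_7)
     (simp add: algebra_simps)

text \<open>Anticipates the symbol of the torsion, whose part in \<open>h\<close> has the rows \<xi>
  \<times> h_m; this contraction of it enters the symbol of \<open>VT\<close>.\<close>

lemma contract2_cross_phi0:
  assumes "transpose h = h"
  shows "contract2 phi0 (\<chi> m. cross phi0 x (h $ m)) = (\<Sum>k\<in>UNIV. h $ k $ k) *\<^sub>R x - h *v x"
proof -
  note h = symD[OF assms]
  show ?thesis
    by (simp add: vec_eq_iff forall_7 cross_def contract2_phi0 outer_def matrix_vector_mult_def sum_7)
       (simp add: h algebra_simps)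
qed

subsection \<open>Identities for nondegenerate 3-forms\<close>

text \<open>The clause on \<open>ginv p\<close> says that \<open>K\<close> carries the inner product
  of covectors to the Euclidean one, so identities with inner products can be transported as
  well.\<close>

lemma normal_form_cases:
  assumes "alternating3 p" "nondegenerate p"
  obtains L K where "L ** K = mat 1" "K ** L = mat 1" "p = act L phi0"
    "ginv p = transpose K ** K"
proof -
  obtain M where M: "det M \<noteq> 0" "act M p = phi0" using exists_normal_form[OF assms] by blast
  then obtain N where N: "N ** M = mat 1" using exists_left_inverse by blast
  then have MN: "M ** N = mat 1" using matrix_left_right_inverse by blast
  have p: "p = act N phi0" using act_inverse[OF N] M(2) by metis
  then have "ginv p = transpose M ** K ** M" if "K = mat 1" for K
    using ginv_act[OF phi0(1) MN] that by (simp add: phi0)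
  then have "ginv p = transpose M ** M" by simp
  then show ?thesis using that[OF N MN p] by blast
qed

lemma skew_act2: "transpose A = - A \<Longrightarrow> transpose (act2 M A) = - act2 M A"
  using linear_neg[OF linear_act2, of M A] by (simp add: act2_matrix matrix_transpose_mul matrix_mul_assoc)

lemma sym_act2: "transpose A = A \<Longrightarrow> transpose (act2 M A) = act2 M A"
  by (simp add: act2_matrix matrix_transpose_mul matrix_mul_assoc)

lemma diamond_skew:
  assumes "alternating3 p" "nondegenerate p" "transpose A = - A"
  shows "diamond A p = hook_psi ((- 1/2) *\<^sub>R contract2 p A) p"
proof -
  obtain L K where LK: "L ** K = mat 1" "K ** L = mat 1" "p = act L phi0"
    using normal_form_cases[OF assms(1,2)] by metis
  define B where "B = act2 K A"
  have A: "A = act2 L B" by (simp add: B_def act2_act2 LK)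
  have B: "transpose B = - B" unfolding B_def by (rule skew_act2[OF assms(3)])
  show ?thesis
    unfolding A LK(3) diamond_act[OF phi0(1) LK(2)] contract2_act[OF phi0(1) LK(2)] diamond_skew_phi0[OF B]
      hook_psi_act[OF phi0(1) LK(2), symmetric] matrix_vector_mult_scaleR ..
qed

lemma unhook_hook:
  assumes "alternating3 p" "nondegenerate p" shows "unhook p (hook_psi X p) = X"
proof -
  obtain L K where LK: "L ** K = mat 1" "K ** L = mat 1" "p = act L phi0"
    using normal_form_cases[OF assms(1,2)] by metis
  have X: "X = L *v (K *v X)" by (simp add: matrix_vector_mul_assoc LK)
  show ?thesis
    by (subst X, unfold LK(3) hook_psi_act[OF phi0(1) LK(2)] unhook_act[OF phi0(1) LK(2)] unhook_hook_phi0)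
       (simp add: matrix_vector_mul_assoc LK)
qed

lemma of_pair_inj:
  assumes "alternating3 p" "nondegenerate p" "u \<in> sym_pairs" "w \<in> sym_pairs" "of_pair p u = of_pair p w"
  shows "u = w"
proof -
  obtain L K where LK: "L ** K = mat 1" "K ** L = mat 1" "p = act L phi0"
    using normal_form_cases[OF assms(1,2)] by metis
  have *: "act2 K (fst u) = sym_part0 (act K (of_pair p u))" "K *v snd u = unhook phi0 (act K (of_pair p u))"
    if "u \<in> sym_pairs" for u
  proof -
    have "of_pair p u = of_pair (act L phi0) (act2 L (act2 K (fst u)), L *v (K *v snd u))"
      by (simp add: LK act2_act2 matrix_vector_mul_assoc)
    also have "\<dots> = act L (of_pair phi0 (act2 K (fst u), K *v snd u))"
      by (rule of_pair_act[OF phi0(1) LK(2)])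
    finally have "act K (of_pair p u) = of_pair phi0 (act2 K (fst u), K *v snd u)"
      by (simp add: act_inverse[OF LK(2)])
    moreover have "transpose (act2 K (fst u)) = act2 K (fst u)"
      using that by (intro sym_act2) (auto simp: sym_pairs_def)
    ultimately show "act2 K (fst u) = sym_part0 (act K (of_pair p u))" "K *v snd u = unhook phi0 (act K (of_pair p u))"
      by (simp_all add: of_pair_inj_phi0)
  qed
  have "act2 K (fst u) = act2 K (fst w)" "K *v snd u = K *v snd w"
    using *[OF assms(3)] *[OF assms(4)] assms(5) by simp_all
  then have "act2 L (act2 K (fst u)) = act2 L (act2 K (fst w))" "L *v (K *v snd u) = L *v (K *v snd w)"
    by simp_all
  then show ?thesis by (simp add: LK act2_act2 matrix_vector_mul_assoc prod_eq_iff)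
qed

lemma of_pair_surj:
  assumes "alternating3 p" "nondegenerate p" "alternating3 \<eta>"
  obtains h X where "transpose h = h" "of_pair p (h, X) = \<eta>"
proof -
  obtain L K where LK: "L ** K = mat 1" "K ** L = mat 1" "p = act L phi0"
    using normal_form_cases[OF assms(1,2)] by metis
  let ?h = "sym_part0 (act K \<eta>)" and ?X = "unhook phi0 (act K \<eta>)"
  have "of_pair p (act2 L ?h, L *v ?X) = act L (of_pair phi0 (?h, ?X))"
    unfolding LK(3) by (rule of_pair_act[OF phi0(1) LK(2)])
  also have "\<dots> = \<eta>" by (simp add: of_pair_surj_phi0 act_alternating assms(3) act_inverse[OF LK(1)])
  finally show ?thesis using that sym_act2[OF sym_part0_sym] by blast
qed

lemma to_pair_of_pair:
  assumes "alternating3 p" "nondegenerate p" "u \<in> sym_pairs" shows "to_pair p (of_pair p u) = u"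
  unfolding to_pair_def using assms of_pair_inj by (intro the_equality) auto

lemma hook_psi_is_diamond:
  assumes "alternating3 p" "nondegenerate p"
  obtains A where "transpose A = - A" "hook_psi X p = diamond A p"
proof -
  obtain L K where LK: "L ** K = mat 1" "K ** L = mat 1" "p = act L phi0"
    using normal_form_cases[OF assms(1,2)] by metis
  obtain A where A: "transpose A = - A" "hook_psi (K *v X) phi0 = diamond A phi0"
    using hook_psi_diamond_phi0 by blast
  have "X = L *v (K *v X)" by (simp add: matrix_vector_mul_assoc LK)
  then have "hook_psi X p = act L (hook_psi (K *v X) phi0)"
    unfolding LK(3) using hook_psi_act[OF phi0(1) LK(2)] by metis
  also have "\<dots> = diamond (act2 L A) p"
    unfolding A(2) LK(3) diamond_act[OF phi0(1) LK(2)] ..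
  finally show ?thesis using that skew_act2[OF A(1)] by blast
qed

section \<open>Inner product and cross product of covectors\<close>

definition ip :: "ten3 \<Rightarrow> vec7 \<Rightarrow> vec7 \<Rightarrow> real" where
  "ip p x y = x \<bullet> (ginv p *v y)"

lemma cross_cross:
  assumes "alternating3 p" "nondegenerate p"
  shows "cross p x (cross p x y) = ip p x y *\<^sub>R x - ip p x x *\<^sub>R y"
proof -
  obtain L K where LK: "L ** K = mat 1" "K ** L = mat 1" "p = act L phi0" "ginv p = transpose K ** K"
    using normal_form_cases[OF assms(1,2)] by metis
  have L: "L *v (K *v x) = x" for x by (simp add: matrix_vector_mul_assoc LK)
  have ip: "ip p x y = (K *v x) \<bullet> (K *v y)" for x y
    unfolding ip_def LK(4) by (metis dot_lmul_matrix matrix_vector_mul_assoc transpose_matrix_vector inner_commute transpose_transpose)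
  have c: "cross p x y = L *v cross phi0 (K *v x) (K *v y)" for x y
    using cross_act[OF phi0(1) LK(2), of "K *v x" "K *v y"] by (simp add: L LK(3))
  have "cross p x (cross p x y) = L *v cross phi0 (K *v x) (cross phi0 (K *v x) (K *v y))"
    unfolding c[of x "cross p x y"] unfolding c[of x y] by (simp add: matrix_vector_mul_assoc LK)
  then show ?thesis
    unfolding cross_cross_phi0 ip by (simp add: matrix_vector_mult_diff_distrib matrix_vector_mult_scaleR L)
qed

lemma linear_contract2: "linear (contract2 p)"
  by (rule linearI)
     (simp_all add: contract2_def vec_eq_iff linear_add[OF linear_act2] linear_scale[OF linear_act2]
      distrib_left distrib_right sum.distrib sum_distrib_left mult_ac)

lemma cross_add: "cross p x (y + z) = cross p x y + cross p x z" "cross p (x + z) y = cross p x y + cross p z y"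
proof -
  have "outer x (y + z) = outer x y + outer x z" "outer (x + z) y = outer x y + outer z y"
    by (simp_all add: outer_def vec_eq_iff algebra_simps)
  then show "cross p x (y + z) = cross p x y + cross p x z" "cross p (x + z) y = cross p x y + cross p z y"
    by (simp_all add: cross_def linear_add[OF linear_contract2])
qed

lemma cross_scaleR: "cross p x (c *\<^sub>R y) = c *\<^sub>R cross p x y" "cross p (c *\<^sub>R x) y = c *\<^sub>R cross p x y"
proof -
  have "outer x (c *\<^sub>R y) = c *\<^sub>R outer x y" "outer (c *\<^sub>R x) y = c *\<^sub>R outer x y"
    by (simp_all add: outer_def vec_eq_iff)
  then show "cross p x (c *\<^sub>R y) = c *\<^sub>R cross p x y" "cross p (c *\<^sub>R x) y = c *\<^sub>R cross p x y"
    by (simp_all add: cross_def linear_scale[OF linear_contract2])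
qed

lemma linear_cross: "linear (cross p x)"
  by (rule linearI) (simp_all add: cross_add cross_scaleR)

lemma crs_contract2: "cross p x y = crs p (ginv p *v x) (ginv p *v y)"
  unfolding cross_def contract2_def act2_outer by (simp add: outer_def crs_def)

lemma cross_commute: "alternating3 p \<Longrightarrow> cross p x y = - cross p y x"
  unfolding crs_contract2 by (rule crs_commute)

lemma ip_commute: "nondegenerate p \<Longrightarrow> ip p x y = ip p y x"
  unfolding ip_def by (metis dot_lmul_matrix ginv_sym inner_commute transpose_matrix_vector)

lemma ip_cross:
  assumes "alternating3 p" "nondegenerate p" shows "ip p x (cross p x y) = 0"
proof -
  have "ip p x (cross p x y) = crs p (ginv p *v x) (ginv p *v y) \<bullet> (ginv p *v x)"
    unfolding ip_commute[OF assms(2), of x] by (simp add: ip_def crs_contract2)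
  then show ?thesis by (simp add: crs_orthogonal[OF assms(1)])
qed

lemma ip_linear: "ip p x (y + z) = ip p x y + ip p x z" "ip p x (c *\<^sub>R y) = c * ip p x y" "ip p x 0 = 0"
  "ip p x (- y) = - ip p x y" "ip p x (y - z) = ip p x y - ip p x z"
  by (simp_all add: ip_def matrix_vector_right_distrib inner_add_right matrix_vector_mult_scaleR
      matrix_vector_mult_diff_distrib inner_diff_right vec.neg)

lemma ip_pos:
  assumes "nondegenerate p" "x \<noteq> 0" shows "ip p x x > 0"
proof -
  define y where "y = ginv p *v x"
  have x: "x = metric p *v y" by (simp add: y_def matrix_vector_mul_assoc ginv_inverse[OF assms(1)])
  then have "y \<noteq> 0" using assms(2) by auto
  then have "y \<bullet> (metric p *v y) > 0"
    using nondegenerate_determines[OF assms(1)] unfolding determines_def by blast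
  then show ?thesis by (simp add: ip_def y_def[symmetric] inner_commute flip: x)
qed

lemma contract2_cross:
  assumes "alternating3 p" "nondegenerate p" "transpose h = h"
  shows "contract2 p (\<chi> m. cross p x (h $ m)) = (ginv p \<bullet> h) *\<^sub>R x - h *v (ginv p *v x)"
proof -
  obtain L K where LK: "L ** K = mat 1" "K ** L = mat 1" "p = act L phi0" "ginv p = transpose K ** K"
    using normal_form_cases[OF assms(1,2)] by metis
  have L: "L *v (K *v x) = x" for x by (simp add: matrix_vector_mul_assoc LK)
  define h' where "h' = act2 K h"
  have h': "transpose h' = h'" unfolding h'_def by (rule sym_act2[OF assms(3)])
  have h: "h = act2 L h'" by (simp add: h'_def act2_act2 LK)
  have row: "h $ m = L *v (\<Sum>n\<in>UNIV. L $ m $ n *\<^sub>R h' $ n)" for m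
    unfolding h act2_def slot_nth slot_vec vmap_nth
    by (simp add: linear_sum linear_scale)
  have c: "cross p x (L *v y) = L *v cross phi0 (K *v x) y" for y
    using cross_act[OF phi0(1) LK(2), of "K *v x" y] by (simp add: L LK(3))
  have "(\<chi> m. cross p x (h $ m)) = act2 L (\<chi> n. cross phi0 (K *v x) (h' $ n))"
    unfolding row c
    by (simp add: vec_eq_iff act2_def slot_nth slot_vec linear_sum[OF linear_cross] cross_scaleR
        linear_sum linear_scale matrix_vector_mult_scaleR)
  then have "contract2 p (\<chi> m. cross p x (h $ m)) = L *v contract2 phi0 (\<chi> n. cross phi0 (K *v x) (h' $ n))"
    unfolding LK(3) by (simp add: contract2_act[OF phi0(1) LK(2)])
  also have "\<dots> = (\<Sum>k\<in>UNIV. h' $ k $ k) *\<^sub>R x - L *v (h' *v (K *v x))"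
    unfolding contract2_cross_phi0[OF h'] by (simp add: matrix_vector_mult_diff_distrib matrix_vector_mult_scaleR L)
  also have "L *v (h' *v (K *v x)) = h *v (ginv p *v x)"
  proof -
    have "h ** (transpose K ** K) = L ** h' ** (transpose L ** transpose K) ** K"
      by (simp add: h act2_matrix matrix_mul_assoc)
    also have "transpose L ** transpose K = mat 1" by (metis LK(2) matrix_transpose_mul transpose_mat)
    finally show ?thesis by (simp add: LK(4) matrix_vector_mul_assoc matrix_mul_assoc)
  qed
  also have "(\<Sum>k\<in>UNIV. h' $ k $ k) = ginv p \<bullet> h"
  proof -
    have "ginv p = act2 (transpose K) (mat 1)" by (simp add: LK(4) act2_matrix)
    then have "ginv p \<bullet> h = mat 1 \<bullet> h'" by (simp add: inner_act2 h'_def)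
    also have "\<dots> = (\<Sum>i\<in>UNIV. \<Sum>j\<in>UNIV. if i = j then h' $ i $ j else 0)"
      unfolding inner_vec_def by (intro sum.cong refl) (simp add: mat_def)
    finally show ?thesis by simp
  qed
  finally show ?thesis .
qed

subsection \<open>Smooth maps between Euclidean spaces\<close>

text \<open>Derivatives are taken in a frozen direction \<open>v\<close>, so the codomain stays
  \<open>'b\<close> and the recursion does not climb through spaces of linear maps. With all orders
  available, continuity of the derivatives is automatic.\<close>

primrec diff_times :: "nat \<Rightarrow> 'a::euclidean_space set \<Rightarrow> ('a \<Rightarrow> 'b::real_normed_vector) \<Rightarrow> bool" where
  "diff_times 0 S f = True"
| "diff_times (Suc n) S f \<longleftrightarrow> (\<forall>x\<in>S. f differentiable (at x)) \<and>
     (\<forall>v. diff_times n S (\<lambda>x. frechet_derivative f (at x) v))"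

definition smooth :: "'a::euclidean_space set \<Rightarrow> ('a \<Rightarrow> 'b::real_normed_vector) \<Rightarrow> bool" where
  "smooth S f \<longleftrightarrow> open S \<and> (\<forall>n. diff_times n S f)"

lemma diff_times_cong:
  assumes "open S" "\<And>x. x \<in> S \<Longrightarrow> f x = g x" "diff_times n S g" shows "diff_times n S f"
  using assms(2,3)
proof (induction n arbitrary: f g)
  case (Suc n)
  have *: "(f has_derivative frechet_derivative g (at x)) (at x)" if "x \<in> S" for x
    using Suc.prems that assms(1) has_derivative_transform_within_open[of g _ x UNIV S f]
    by (auto simp: frechet_derivative_works)
  have eq: "frechet_derivative f (at x) = frechet_derivative g (at x)" if "x \<in> S" for x
    using frechet_derivative_at[OF *[OF that]] by simp
  show ?case
    unfolding diff_times.simps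
  proof (intro conjI ballI allI)
    show "f differentiable (at x)" if "x \<in> S" for x using *[OF that] unfolding differentiable_def by blast
    show "diff_times n S (\<lambda>x. frechet_derivative f (at x) v)" for v
      by (rule Suc.IH[of _ "\<lambda>x. frechet_derivative g (at x) v"]) (use eq Suc.prems(2) in auto)
  qed
qed simp

lemma diff_timesI:
  assumes "open S" "\<And>x. x \<in> S \<Longrightarrow> (f has_derivative D x) (at x)" and "\<And>v. diff_times n S (\<lambda>x. D x v)"
  shows "diff_times (Suc n) S f"
  unfolding diff_times.simps
proof (intro conjI ballI allI)
  show "f differentiable (at x)" if "x \<in> S" for x using assms(2)[OF that] unfolding differentiable_def by blast
  show "diff_times n S (\<lambda>x. frechet_derivative f (at x) v)" for v
    by (rule diff_times_cong[OF assms(1) _ assms(3)[of v]]) (simp add: frechet_derivative_at[OF assms(2), symmetric])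
qed

lemma diff_timesD:
  assumes "diff_times (Suc n) S f" "x \<in> S"
  shows "(f has_derivative frechet_derivative f (at x)) (at x)"
  using assms by (simp add: frechet_derivative_works)

lemma diff_times_mono: "diff_times (Suc n) S f \<Longrightarrow> diff_times n S f"
  by (induction n arbitrary: f) auto

lemma diff_times_subset: "diff_times n S f \<Longrightarrow> T \<subseteq> S \<Longrightarrow> diff_times n T f"
  by (induction n arbitrary: f) auto

lemma diff_times_const: "open S \<Longrightarrow> diff_times n S (\<lambda>x. c)"
  by (induction n arbitrary: c) (auto intro!: diff_timesI derivative_eq_intros)

lemma diff_times_add:
  assumes "open S" "diff_times n S f" "diff_times n S g" shows "diff_times n S (\<lambda>x. f x + g x)"
  using assms(2,3)
proof (induction n arbitrary: f g)
  case (Suc n)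
  show ?case
    by (rule diff_timesI[OF assms(1) has_derivative_add[OF diff_timesD[OF Suc.prems(1)] diff_timesD[OF Suc.prems(2)]]])
       (use Suc in simp_all)
qed simp

lemma diff_times_bounded_linear:
  assumes "open S" "bounded_linear L" "diff_times n S f" shows "diff_times n S (\<lambda>x. L (f x))"
  using assms(3)
proof (induction n arbitrary: f)
  case (Suc n)
  show ?case
    by (rule diff_timesI[OF assms(1) bounded_linear.has_derivative[OF assms(2) diff_timesD[OF Suc.prems]]])
       (use Suc in simp_all)
qed simp

lemma diff_times_bilinear:
  assumes "open S" "bounded_bilinear B" "diff_times n S f" "diff_times n S g"
  shows "diff_times n S (\<lambda>x. B (f x) (g x))"
  using assms(3,4)
proof (induction n arbitrary: f g)
  case (Suc n)
  note f = Suc.prems(1) note g = Suc.prems(2)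
  show ?case
  proof (rule diff_timesI[OF assms(1) bounded_bilinear.FDERIV[OF assms(2) diff_timesD[OF f] diff_timesD[OF g]]])
    show "diff_times n S (\<lambda>x. B (f x) (frechet_derivative g (at x) v) + B (frechet_derivative f (at x) v) (g x))" for v
      using f g by (intro diff_times_add assms Suc.IH diff_times_mono[OF f] diff_times_mono[OF g]) simp_all
  qed
qed simp

lemma diff_times_compose_linear:
  assumes "open S" "bounded_linear L" "diff_times n T f" "\<And>x. x \<in> S \<Longrightarrow> L x \<in> T"
  shows "diff_times n S (\<lambda>x. f (L x))"
  using assms(3)
proof (induction n arbitrary: f)
  case (Suc n)
  show ?case
  proof (rule diff_timesI[OF assms(1)])
    show "((\<lambda>x. f (L x)) has_derivative (\<lambda>v. frechet_derivative f (at (L x)) (L v))) (at x)" if "x \<in> S" for x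
      using has_derivative_compose[OF bounded_linear_imp_has_derivative[OF assms(2)] diff_timesD[OF Suc.prems assms(4)[OF that]]]
      by simp
    show "diff_times n S (\<lambda>x. frechet_derivative f (at (L x)) (L v))" for v
      by (rule Suc.IH) (use Suc.prems in simp)
  qed
qed simp

lemma diff_times_inverse:
  fixes f :: "'a::euclidean_space \<Rightarrow> real"
  assumes "open S" "diff_times n S f" "\<And>x. x \<in> S \<Longrightarrow> f x \<noteq> 0" shows "diff_times n S (\<lambda>x. inverse (f x))"
  using assms(2)
proof (induction n)
  case (Suc n)
  have i: "diff_times n S (\<lambda>x. inverse (f x))" using Suc diff_times_mono by blast
  show ?case
  proof (rule diff_timesI[OF assms(1)])
    show "((\<lambda>x. inverse (f x)) has_derivative
      (\<lambda>v. (- 1) *\<^sub>R (frechet_derivative f (at x) v * (inverse (f x) * inverse (f x))))) (at x)" if "x \<in> S" for x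
      by (rule has_derivative_eq_rhs[OF Deriv.has_derivative_inverse[OF assms(3)[OF that] diff_timesD[OF Suc.prems that]]])
         (simp add: fun_eq_iff mult_ac)
    show "diff_times n S (\<lambda>x. (- 1) *\<^sub>R (frechet_derivative f (at x) v * (inverse (f x) * inverse (f x))))" for v
      using Suc.prems i
      by (intro diff_times_bounded_linear[OF assms(1) bounded_linear_scaleR_right]
          diff_times_bilinear[OF assms(1) bounded_bilinear_mult]) simp_all
  qed
qed simp

text \<open>The derivative of the root is expressed by the root itself, so the induction closes. Its
  eighth power is written as iterated squares to make the rule for products applicable.\<close>

lemma diff_times_root9:
  fixes f :: "'a::euclidean_space \<Rightarrow> real"
  assumes "open S" "diff_times n S f" "\<And>x. x \<in> S \<Longrightarrow> f x \<noteq> 0" shows "diff_times n S (\<lambda>x. root 9 (f x))"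
  using assms(2)
proof (induction n)
  case (Suc n)
  let ?r = "\<lambda>x. root 9 (f x)"
  have r: "diff_times n S ?r" using Suc diff_times_mono by blast
  let ?r2 = "\<lambda>x. ?r x * ?r x" and ?r4 = "\<lambda>x. (?r x * ?r x) * (?r x * ?r x)"
  note m = diff_times_bilinear[OF assms(1) bounded_bilinear_mult]
  have d: "diff_times n S (\<lambda>x. 9 * (?r4 x * ?r4 x))"
    by (intro m r diff_times_const assms(1))
  show ?case
  proof (rule diff_timesI[OF assms(1)])
    show "(?r has_derivative (\<lambda>v. frechet_derivative f (at x) v * inverse (9 * (?r4 x * ?r4 x)))) (at x)"
      if "x \<in> S" for x
    proof -
      have "DERIV (root 9) (f x) :> inverse (real 9 * root 9 (f x) ^ (9 - Suc 0))"
        by (rule DERIV_odd_real_root) (use assms(3)[OF that] in auto)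
      then have "(root 9 has_derivative (\<lambda>v. inverse (9 * (?r4 x * ?r4 x)) * v)) (at (f x))"
      proof -
        have "inverse (real 9 * root 9 (f x) ^ (9 - Suc 0)) = inverse (9 * (?r4 x * ?r4 x))"
        proof -
          have "z ^ 8 = ((z * z) * (z * z)) * ((z * z) * (z * z))" for z :: real by (simp add: eval_nat_numeral)
          then show ?thesis by (simp del: inverse_mult_distrib)
        qed
        with \<open>DERIV (root 9) (f x) :> _\<close> show ?thesis
          by (simp only: has_field_derivative_def)
      qed
      from has_derivative_compose[OF diff_timesD[OF Suc.prems that] this] show ?thesis
        by (simp add: mult.commute)
    qed
    show "diff_times n S (\<lambda>x. frechet_derivative f (at x) v * inverse (9 * (?r4 x * ?r4 x)))" for v
      using Suc.prems assms(3)
      by (intro m diff_times_inverse[OF assms(1) d]) auto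
  qed
qed simp

named_theorems smooth_intros

lemma smooth_const: "open S \<Longrightarrow> smooth S (\<lambda>x. c)"
  by (simp add: smooth_def diff_times_const)

lemma smooth_add [smooth_intros]: "smooth S f \<Longrightarrow> smooth S g \<Longrightarrow> smooth S (\<lambda>x. f x + g x)"
  by (simp add: smooth_def diff_times_add)

lemma smooth_linear: "bounded_linear L \<Longrightarrow> smooth S f \<Longrightarrow> smooth S (\<lambda>x. L (f x))"
  by (simp add: smooth_def diff_times_bounded_linear)

lemma smooth_bilinear: "bounded_bilinear B \<Longrightarrow> smooth S f \<Longrightarrow> smooth S g \<Longrightarrow> smooth S (\<lambda>x. B (f x) (g x))"
  by (simp add: smooth_def diff_times_bilinear)

lemma smooth_id: "open S \<Longrightarrow> smooth S (\<lambda>x. x)"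
proof -
  assume S: "open S"
  have "diff_times n S (\<lambda>x. x)" for n
    by (cases n) (auto intro!: diff_timesI[OF S] has_derivative_ident diff_times_const S)
  with S show ?thesis by (simp add: smooth_def)
qed

lemmas smooth_scaleR [smooth_intros] = smooth_bilinear[OF bounded_bilinear_scaleR]
lemma smooth_mult [smooth_intros]: "smooth S f \<Longrightarrow> smooth S g \<Longrightarrow> smooth S (\<lambda>x. f x * g x :: real)"
  by (rule smooth_bilinear[OF bounded_bilinear_mult])
lemmas smooth_inner [smooth_intros] = smooth_bilinear[OF bounded_bilinear_inner]
lemmas smooth_nth [smooth_intros] = smooth_linear[OF bounded_linear_vec_nth]

lemma smooth_minus [smooth_intros]: "smooth S f \<Longrightarrow> smooth S (\<lambda>x. - f x)"
  by (rule smooth_linear[OF bounded_linear_minus[OF bounded_linear_ident]])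

lemma smooth_diff [smooth_intros]: "smooth S f \<Longrightarrow> smooth S g \<Longrightarrow> smooth S (\<lambda>x. f x - g x)"
  using smooth_add[OF _ smooth_minus] by fastforce

lemma smooth_cmult [smooth_intros]: "smooth S f \<Longrightarrow> smooth S (\<lambda>x. c * f x :: real)"
  by (rule smooth_linear[OF bounded_linear_mult_right])

lemma smooth_divide [smooth_intros]: "smooth S f \<Longrightarrow> smooth S (\<lambda>x. f x / c :: real)"
  by (rule smooth_linear[OF bounded_linear_divide])

lemma smooth_sum [smooth_intros]:
  assumes "open S" "\<And>i. i \<in> I \<Longrightarrow> smooth S (f i)" shows "smooth S (\<lambda>x. \<Sum>i\<in>I. f i x)"
  using assms(2) by (induction I rule: infinite_finite_induct) (auto intro: smooth_add smooth_const assms(1))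

lemma smooth_prod:
  fixes f :: "'i \<Rightarrow> 'a::euclidean_space \<Rightarrow> real"
  assumes "open S" "\<And>i. i \<in> I \<Longrightarrow> smooth S (f i)" shows "smooth S (\<lambda>x. \<Prod>i\<in>I. f i x)"
  using assms(2) by (induction I rule: infinite_finite_induct) (auto intro: smooth_mult smooth_const assms(1))

lemma smooth_inverse:
  fixes f :: "'a::euclidean_space \<Rightarrow> real"
  shows "smooth S f \<Longrightarrow> (\<And>x. x \<in> S \<Longrightarrow> f x \<noteq> 0) \<Longrightarrow> smooth S (\<lambda>x. inverse (f x))"
  by (simp add: smooth_def diff_times_inverse)

lemma smooth_root9:
  fixes f :: "'a::euclidean_space \<Rightarrow> real"
  shows "smooth S f \<Longrightarrow> (\<And>x. x \<in> S \<Longrightarrow> f x \<noteq> 0) \<Longrightarrow> smooth S (\<lambda>x. root 9 (f x))"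
  by (simp add: smooth_def diff_times_root9)

lemma smooth_cong: "smooth S g \<Longrightarrow> (\<And>x. x \<in> S \<Longrightarrow> f x = g x) \<Longrightarrow> smooth S f"
  unfolding smooth_def using diff_times_cong by blast

lemma smooth_subset: "smooth S f \<Longrightarrow> open T \<Longrightarrow> T \<subseteq> S \<Longrightarrow> smooth T f"
  unfolding smooth_def using diff_times_subset by blast

lemma smooth_compose_linear:
  "smooth T f \<Longrightarrow> open S \<Longrightarrow> bounded_linear L \<Longrightarrow> (\<And>x. x \<in> S \<Longrightarrow> L x \<in> T) \<Longrightarrow> smooth S (\<lambda>x. f (L x))"
  unfolding smooth_def using diff_times_compose_linear by blast

lemma bounded_linear_axis: "bounded_linear (axis i :: 'b::real_normed_vector \<Rightarrow> 'b^'n)"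
proof (rule bounded_linear_intro[where K = 1])
  fix x :: 'b
  have "norm (axis i x :: 'b^'n) = norm x"
    by (simp add: norm_vec_def L2_set_def axis_def if_distrib[of norm] if_distrib[of "\<lambda>x. x\<^sup>2"] cong: if_cong)
  then show "norm (axis i x :: 'b^'n) \<le> norm x * 1" by simp
qed (auto simp: axis_def vec_eq_iff)

lemma smooth_vec [smooth_intros]:
  assumes "open S" "\<And>i. smooth S (\<lambda>x. f x i)" shows "smooth S (\<lambda>x. \<chi> i. f x i)"
proof (rule smooth_cong)
  show "smooth S (\<lambda>x. \<Sum>i\<in>UNIV. axis i (f x i))"
    using assms by (intro smooth_sum smooth_linear[OF bounded_linear_axis]) auto
  show "(\<chi> i. f x i) = (\<Sum>i\<in>UNIV. axis i (f x i))" for x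
    by (simp add: vec_eq_iff axis_def)
qed

lemma smooth_differentiable: "smooth S f \<Longrightarrow> x \<in> S \<Longrightarrow> f differentiable (at x)"
  unfolding smooth_def by (metis diff_times.simps(2))

lemma smooth_has_derivative: "smooth S f \<Longrightarrow> x \<in> S \<Longrightarrow> (f has_derivative frechet_derivative f (at x)) (at x)"
  using smooth_differentiable frechet_derivative_works by blast

lemma frechet_derivative_basis:
  fixes f :: "'a::euclidean_space \<Rightarrow> 'b::real_normed_vector"
  assumes "f differentiable (at x)"
  shows "frechet_derivative f (at x) w = (\<Sum>b\<in>Basis. (w \<bullet> b) *\<^sub>R frechet_derivative f (at x) b)"
proof -
  have "linear (frechet_derivative f (at x))" using assms by (rule linear_frechet_derivative)
  then have "frechet_derivative f (at x) (\<Sum>b\<in>Basis. (w \<bullet> b) *\<^sub>R b) = (\<Sum>b\<in>Basis. (w \<bullet> b) *\<^sub>R frechet_derivative f (at x) b)"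
    by (simp add: linear_sum linear_scale)
  then show ?thesis by (simp add: euclidean_representation)
qed

text \<open>Base point and direction vary together. Expanding the direction in a basis leaves
  derivatives in frozen directions, the only ones that \<open>diff_times\<close> speaks of.\<close>

lemma smooth_frechet:
  fixes F :: "'a::euclidean_space \<Rightarrow> 'b::real_normed_vector"
  assumes "smooth T F" "open S" "bounded_linear L" "\<And>x. x \<in> S \<Longrightarrow> L x \<in> T" "smooth S w"
  shows "smooth S (\<lambda>x. frechet_derivative F (at (L x)) (w x))"
proof (rule smooth_cong)
  have "smooth T (\<lambda>y. frechet_derivative F (at y) b)" for b
    using assms(1) unfolding smooth_def by (metis diff_times.simps(2))
  then have "smooth S (\<lambda>x. frechet_derivative F (at (L x)) b)" for b
    by (rule smooth_compose_linear[OF _ assms(2,3,4)])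
  moreover have "smooth S (\<lambda>x. w x \<bullet> b)" for b
    by (rule smooth_linear[OF bounded_linear_inner_left assms(5)])
  ultimately show "smooth S (\<lambda>x. \<Sum>b\<in>Basis. (w x \<bullet> b) *\<^sub>R frechet_derivative F (at (L x)) b)"
    by (intro smooth_sum smooth_scaleR assms(2)) auto
qed (use frechet_derivative_basis smooth_differentiable[OF assms(1)] assms(4) in blast)

lemma frechet_axis:
  fixes f :: "vec7 \<Rightarrow> 'b::real_normed_vector"
  assumes "f differentiable (at x)"
  shows "frechet_derivative f (at x) v = (\<Sum>i\<in>UNIV. v $ i *\<^sub>R pd i f x)"
proof -
  have "linear (frechet_derivative f (at x))" using assms by (rule linear_frechet_derivative)
  then have "frechet_derivative f (at x) (\<Sum>i\<in>UNIV. v $ i *\<^sub>R axis i 1) = (\<Sum>i\<in>UNIV. v $ i *\<^sub>R pd i f x)"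
    by (simp add: linear_sum linear_scale pd_def)
  moreover have "(\<Sum>i\<in>UNIV. v $ i *\<^sub>R axis i 1) = v"
    by (simp add: vec_eq_iff axis_def if_distrib[of "\<lambda>c. _ * c"] cong: if_cong)
  ultimately show ?thesis by simp
qed

text \<open>A derivative in a fixed direction is a combination of partial derivatives with constant
  coefficients, and conversely each partial derivative is one of them.\<close>

lemma smooth_on_iff: assumes "open U" shows "smooth_on U f \<longleftrightarrow> smooth U f"
proof
  assume s: "smooth_on U f"
  have "diff_times n U (pds l f)" for n l
  proof (induction n arbitrary: l)
    case (Suc n)
    have d: "pds l f differentiable (at x)" if "x \<in> U" for x using s that by (simp add: smooth_on_def)
    show ?case
    proof (rule diff_timesI[OF assms])
      show "(pds l f has_derivative (\<lambda>v. \<Sum>i\<in>UNIV. v $ i *\<^sub>R pds (i # l) f x)) (at x)" if "x \<in> U" for x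
      proof (rule has_derivative_eq_rhs)
        show "(pds l f has_derivative frechet_derivative (pds l f) (at x)) (at x)"
          using d[OF that] by (simp add: frechet_derivative_works)
        show "frechet_derivative (pds l f) (at x) = (\<lambda>v. \<Sum>i\<in>UNIV. v $ i *\<^sub>R pds (i # l) f x)"
          using frechet_axis[OF d[OF that]] by (simp add: fun_eq_iff)
      qed
      have "diff_times n U (\<lambda>x. \<Sum>i\<in>I. v $ i *\<^sub>R pds (i # l) f x)" for I v
        by (induction I rule: infinite_finite_induct)
           (auto intro!: diff_times_add diff_times_const assms diff_times_bounded_linear[OF assms bounded_linear_scaleR_right] Suc
             simp del: pds.simps)
      then show "diff_times n U (\<lambda>x. \<Sum>i\<in>UNIV. v $ i *\<^sub>R pds (i # l) f x)" for v .
    qed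
  qed simp
  from this[of _ "[]"] show "smooth U f" using assms by (simp add: smooth_def)
next
  assume s: "smooth U f"
  have "smooth U (pds l f)" for l
  proof (induction l)
    case (Cons i l)
    then have "smooth U (\<lambda>x. frechet_derivative (pds l f) (at x) (axis i 1))"
      unfolding smooth_def by (metis diff_times.simps(2))
    then show ?case by (simp add: pd_def[abs_def])
  qed (simp add: s)
  then show "smooth_on U f" unfolding smooth_on_def using smooth_differentiable by blast
qed

lemma smooth_pd: "smooth U f \<Longrightarrow> smooth U (pd i f)"
  unfolding pd_def[abs_def] smooth_def by (metis diff_times.simps(2))

subsection \<open>The metric as a smooth function of the 3-form\<close>

lemma smooth_wmat: "smooth UNIV wmat"
  unfolding wmat_def[abs_def] wedge_form_def
  by (intro smooth_vec smooth_divide smooth_sum smooth_mult smooth_nth smooth_const smooth_id open_UNIV)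

lemma smooth_det:
  fixes A :: "'a::euclidean_space \<Rightarrow> real^7^7"
  assumes "open S" "smooth S A" shows "smooth S (\<lambda>x. det (A x))"
  unfolding det_def
  by (intro smooth_sum smooth_mult smooth_prod smooth_nth smooth_const assms)

text \<open>Crude but sufficient: there are 49 entries, each at most \<open>norm A\<close> in
  absolute value.\<close>

lemma quadratic_bound: "\<bar>X \<bullet> (A *v X)\<bar> \<le> 49 * norm A * (X \<bullet> X)" for A :: ten2
proof -
  have "\<bar>X $ i * (A $ i $ j * X $ j)\<bar> \<le> norm A * (X \<bullet> X)" for i j
  proof -
    have "\<bar>A $ i $ j\<bar> \<le> norm A"
      by (rule order_trans[OF component_le_norm_cart Finite_Cartesian_Product.norm_nth_le])
    moreover have "\<bar>X $ i\<bar> * \<bar>X $ j\<bar> \<le> X \<bullet> X"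
      using mult_mono[OF component_le_norm_cart[of X i] component_le_norm_cart[of X j]]
      by (simp add: dot_square_norm power2_eq_square)
    ultimately have "\<bar>A $ i $ j\<bar> * (\<bar>X $ i\<bar> * \<bar>X $ j\<bar>) \<le> norm A * (X \<bullet> X)"
      by (intro mult_mono) auto
    then show ?thesis by (simp add: abs_mult mult_ac)
  qed
  then have "(\<Sum>i\<in>UNIV. \<Sum>j\<in>UNIV. \<bar>X $ i * (A $ i $ j * X $ j)\<bar>) \<le> (\<Sum>i\<in>(UNIV::7 set). \<Sum>j\<in>(UNIV::7 set). norm A * (X \<bullet> X))"
    by (intro sum_mono)
  also have "\<dots> = 49 * norm A * (X \<bullet> X)" by simp
  finally have "(\<Sum>i\<in>UNIV. \<Sum>j\<in>UNIV. \<bar>X $ i * (A $ i $ j * X $ j)\<bar>) \<le> 49 * norm A * (X \<bullet> X)" .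
  moreover have "X \<bullet> (A *v X) = (\<Sum>i\<in>UNIV. \<Sum>j\<in>UNIV. X $ i * (A $ i $ j * X $ j))"
    by (simp add: inner_vec_def matrix_vector_mult_def sum_distrib_left)
  moreover have "\<bar>\<Sum>i\<in>UNIV. \<Sum>j\<in>UNIV. X $ i * (A $ i $ j * X $ j)\<bar> \<le> (\<Sum>i\<in>UNIV. \<Sum>j\<in>UNIV. \<bar>X $ i * (A $ i $ j * X $ j)\<bar>)"
    by (rule order_trans[OF sum_abs]) (intro sum_mono sum_abs)
  ultimately show ?thesis by linarith
qed

lemma pos_def_lower_bound:
  fixes g :: ten2
  assumes "\<And>X. X \<noteq> 0 \<Longrightarrow> X \<bullet> (g *v X) > 0"
  obtains m where "m > 0" "\<And>X. m * (X \<bullet> X) \<le> X \<bullet> (g *v X)"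
proof -
  have "continuous_on (sphere (0::vec7) 1) (\<lambda>X. X \<bullet> (g *v X))"
    by (intro continuous_intros linear_continuous_on matrix_vector_mul_bounded_linear)
  moreover have "axis 1 1 \<in> sphere (0::vec7) 1" by simp
  ultimately obtain X0 where X0: "X0 \<in> sphere (0::vec7) 1" "\<And>X. X \<in> sphere 0 1 \<Longrightarrow> X0 \<bullet> (g *v X0) \<le> X \<bullet> (g *v X)"
    using continuous_attains_inf[of "sphere (0::vec7) 1" "\<lambda>X. X \<bullet> (g *v X)"] compact_sphere by blast
  show ?thesis
  proof (rule that[of "X0 \<bullet> (g *v X0)"])
    show "X0 \<bullet> (g *v X0) > 0" using X0(1) by (intro assms) auto
    show "X0 \<bullet> (g *v X0) * (X \<bullet> X) \<le> X \<bullet> (g *v X)" for X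
    proof (cases "X = 0")
      case False
      have "X0 \<bullet> (g *v X0) \<le> ((1 / norm X) *\<^sub>R X) \<bullet> (g *v ((1 / norm X) *\<^sub>R X))"
        using False by (intro X0(2)) simp
      also have "\<dots> = (X \<bullet> (g *v X)) / (X \<bullet> X)"
        using False by (simp add: matrix_vector_mult_scaleR dot_square_norm power2_eq_square)
      finally show ?thesis using False by (simp add: field_simps)
    qed simp
  qed
qed

text \<open>These formulas are smooth on the whole open set where \<open>wmat p\<close> is
  invertible, which contains the nondegenerate forms. So their continuity can be used to prove that
  nondegeneracy is an open condition.\<close>

definition vol_formula :: "ten3 \<Rightarrow> real" where
  "vol_formula p = root 9 (det (wmat p) / (- 6)^7)"

definition metric_formula :: "ten3 \<Rightarrow> ten2" where
  "metric_formula p = (- 1/6 * inverse (vol_formula p)) *\<^sub>R wmat p"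

lemma open_det_wmat: "open {p. det (wmat p) \<noteq> 0}"
proof -
  have s: "smooth UNIV (\<lambda>p. det (wmat p))" by (intro smooth_det smooth_wmat open_UNIV)
  have "continuous_on UNIV (\<lambda>p. det (wmat p))"
    using smooth_differentiable[OF s] differentiable_imp_continuous_within
    by (auto simp: continuous_on_eq_continuous_within)
  then show ?thesis by (simp add: open_Collect_neq continuous_on_const)
qed

lemma smooth_vol_formula: "smooth {p. det (wmat p) \<noteq> 0} vol_formula"
  unfolding vol_formula_def[abs_def]
  by (intro smooth_root9 smooth_divide smooth_det open_det_wmat smooth_subset[OF smooth_wmat]) auto

lemma smooth_metric_formula: "smooth {p. det (wmat p) \<noteq> 0} metric_formula"
  unfolding metric_formula_def[abs_def]
  by (intro smooth_scaleR smooth_cmult smooth_inverse smooth_vol_formula smooth_subset[OF smooth_wmat] open_det_wmat)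
     (auto simp: vol_formula_def)

lemma determines_det_wmat: "determines p g v \<Longrightarrow> det (wmat p) \<noteq> 0"
  using determines_wmat(2) pos_def_det_pos(2) by fastforce

lemma nondegenerate_formulas:
  assumes "nondegenerate p"
  shows "det (wmat p) \<noteq> 0" "vol p = vol_formula p" "metric p = metric_formula p"
proof -
  note d = nondegenerate_determines[OF assms]
  show "det (wmat p) \<noteq> 0" by (rule determines_det_wmat[OF d])
  show v: "vol p = vol_formula p" unfolding vol_formula_def by (rule determines_wmat(3)[OF d])
  show "metric p = metric_formula p"
  proof -
    have "- 1/6 * inverse (vol p) = - 1 / (6 * vol p)"
      using pos_def_det_pos(2)[OF d] by (simp add: field_simps)
    then show ?thesis unfolding metric_formula_def v[symmetric] by (simp only: determines_wmat(4)[OF d, symmetric])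
  qed
qed

lemma determines_formulas:
  assumes "det (wmat p) \<noteq> 0" "\<And>X. X \<noteq> 0 \<Longrightarrow> X \<bullet> (metric_formula p *v X) > 0"
  shows "determines p (metric_formula p) (vol_formula p)"
proof -
  let ?v = "vol_formula p"
  have v: "?v \<noteq> 0" using assms(1) by (simp add: vol_formula_def)
  have v9: "?v ^ 9 = det (wmat p) / (- 6)^7" unfolding vol_formula_def by (rule odd_real_root_pow) simp
  \<comment> \<open>Seven powers of 1/v against the ninth power of v: the determinant condition
    holds by itself, and positivity is the only one left to require.\<close>
  have "det (metric_formula p) = (- 1/6 * inverse ?v)^7 * det (wmat p)"
    unfolding metric_formula_def det_scaleR by simp
  also have "\<dots> = (- 1/6)^7 * (- 6)^7 * (inverse ?v)^7 * ?v ^ 9"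
    unfolding v9 by (simp add: power_mult_distrib field_simps)
  also have "\<dots> = ?v\<^sup>2" using v by (simp add: field_simps flip: power_add)
  finally have "\<bar>?v\<bar> = sqrt (det (metric_formula p))" by simp
  moreover have "wedge_form p i j = - 6 * metric_formula p $ i $ j * ?v" for i j
    using v by (simp add: metric_formula_def wmat_def)
  moreover have "transpose (metric_formula p) = metric_formula p"
    unfolding metric_formula_def transpose_scalar wmat_sym ..
  ultimately show ?thesis using assms(2) unfolding determines_def by blast
qed

text \<open>Positive definiteness has a margin \<open>m\<close> on the unit sphere, which a small
  change of \<open>metric_formula\<close> cannot exhaust.\<close>

lemma open_nondegenerate: "open {p. nondegenerate p}"
  unfolding open_contains_ball
proof
  fix p assume "p \<in> {p. nondegenerate p}"
  then have n: "nondegenerate p" by simp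
  let ?V = "{p. det (wmat p) \<noteq> 0}"
  have pV: "p \<in> ?V" using nondegenerate_formulas[OF n] by simp
  obtain m where m: "m > 0" "\<And>X. m * (X \<bullet> X) \<le> X \<bullet> (metric_formula p *v X)"
    using pos_def_lower_bound[of "metric p"] nondegenerate_determines[OF n] nondegenerate_formulas[OF n]
    unfolding determines_def by metis
  have "isCont metric_formula p"
    using smooth_differentiable[OF smooth_metric_formula pV] by (simp add: differentiable_imp_continuous_within)
  then obtain d1 where d1: "d1 > 0" "\<And>q. dist q p < d1 \<Longrightarrow> dist (metric_formula q) (metric_formula p) < m / 49"
    unfolding continuous_at_eps_delta using m by (metis divide_pos_pos zero_less_numeral)
  obtain d2 where d2: "d2 > 0" "ball p d2 \<subseteq> ?V" using open_det_wmat pV open_contains_ball by blast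
  have "nondegenerate q" if "q \<in> ball p (min d1 d2)" for q
  proof -
    have q: "q \<in> ?V" "norm (metric_formula q - metric_formula p) < m / 49"
      using that d1(2)[of q] d2(2) by (auto simp: dist_norm norm_minus_commute)
    have "X \<bullet> (metric_formula q *v X) > 0" if "X \<noteq> 0" for X
    proof -
      have XX: "X \<bullet> X > 0" using that by simp
      have "X \<bullet> (metric_formula q *v X) = X \<bullet> (metric_formula p *v X) + X \<bullet> ((metric_formula q - metric_formula p) *v X)"
        by (simp add: matrix_vector_mult_diff_rdistrib inner_diff_right)
      moreover have "49 * norm (metric_formula q - metric_formula p) * (X \<bullet> X) < m * (X \<bullet> X)"
        using q(2) XX by (intro mult_strict_right_mono) auto
      ultimately show ?thesis
        using m(2)[of X] quadratic_bound[of X "metric_formula q - metric_formula p"] by linarith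
    qed
    then show ?thesis using determines_formulas[of q] q(1) unfolding nondegenerate_def by blast
  qed
  then show "\<exists>e>0. ball p e \<subseteq> {p. nondegenerate p}"
    using d1(1) d2(1) by (intro exI[of _ "min d1 d2"]) auto
qed

lemma smooth_vol: "smooth {p. nondegenerate p} vol"
  by (rule smooth_cong[OF smooth_subset[OF smooth_vol_formula open_nondegenerate]])
     (auto simp: nondegenerate_formulas)

lemma smooth_metric: "smooth {p. nondegenerate p} metric"
  by (rule smooth_cong[OF smooth_subset[OF smooth_metric_formula open_nondegenerate]])
     (auto simp: nondegenerate_formulas)

text \<open>Cramer's rule expresses the entries of the inverse as quotients of determinants.\<close>

lemma smooth_ginv: "smooth {p. nondegenerate p} ginv"
proof (rule smooth_cong)
  show "smooth {p. nondegenerate p} (\<lambda>p. \<chi> i j. inverse (det (metric p)) *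
     det (\<chi> r s. if s = i then axis j 1 $ r else metric p $ r $ s))"
  proof (intro smooth_vec smooth_mult smooth_inverse smooth_det open_nondegenerate smooth_metric)
    show "smooth {p. nondegenerate p} (\<lambda>p. if s = i then axis j 1 $ r else metric p $ r $ s)" for i j r s :: 7
      by (cases "s = i") (simp_all add: smooth_const open_nondegenerate smooth_nth smooth_metric)
    show "det (metric p) \<noteq> 0" if "p \<in> {p. nondegenerate p}" for p
      using pos_def_det_pos[OF nondegenerate_determines] that by force
  qed
  show "ginv p = (\<chi> i j. inverse (det (metric p)) *
     det (\<chi> r s. if s = i then axis j 1 $ r else metric p $ r $ s))" if "p \<in> {p. nondegenerate p}" for p
  proof -
    have n: "nondegenerate p" using that by simp
    have d: "det (metric p) \<noteq> 0" using pos_def_det_pos[OF nondegenerate_determines[OF n]] by simp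
    have e: "metric p *v (ginv p *v axis j 1) = axis j 1" for j
      by (simp add: matrix_vector_mul_assoc ginv_inverse[OF n])
    have "det (\<chi> r s. if s = i then axis j 1 $ r else metric p $ r $ s) = (ginv p *v axis j 1) $ i * det (metric p)" for i j
      using cramer_lemma[of i "metric p" "ginv p *v axis j 1"] unfolding e .
    moreover have "(ginv p *v axis j 1) $ i = ginv p $ i $ j" for i j
      by (simp add: matrix_vector_mult_basis column_def)
    ultimately show ?thesis using d by (simp add: vec_eq_iff)
  qed
qed

lemma smooth_psi: "smooth {p. nondegenerate p} psi"
  unfolding psi_def[abs_def] raise3_def
  by (intro smooth_vec smooth_divide smooth_sum smooth_mult smooth_nth smooth_const smooth_id smooth_vol
      smooth_ginv open_nondegenerate)
    (simp, intro smooth_sum smooth_mult smooth_nth smooth_const smooth_id smooth_ginv open_nondegenerate)?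

section \<open>The derivative of the metric along orbits of the linear group\<close>

lemma act_path: "\<exists>R R'. \<forall>t. act (mat 1 + t *\<^sub>R K) p = p + t *\<^sub>R der K p + t\<^sup>2 *\<^sub>R R + (t * t\<^sup>2) *\<^sub>R R'"
proof -
  have v: "vmap (\<lambda>x. f x + h x) u = vmap f u + vmap h u" "vmap (\<lambda>x. t *\<^sub>R f x) u = t *\<^sub>R vmap f u"
    "vmap (\<lambda>x. x) u = u" for t :: real and f h :: "'b::real_vector \<Rightarrow> 'b" and u
    by (simp_all add: vec_eq_iff)
  have s: "slot (mat 1 + t *\<^sub>R K) = (\<lambda>x. x + t *\<^sub>R slot K x)" for t
    by (simp add: fun_eq_iff slot_add_left slot_scaleR_left)
  let ?A = "slot K" and ?B = "vmap (slot K)" and ?C = "vmap (vmap (slot K))"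
  have lin: "linear ?A" "linear ?B" by (intro linear_slot linear_vmap)+
  have "act M p = slot M (vmap (slot M) (vmap (vmap (slot M)) p))" for M
    by (simp add: act_def act2_def[abs_def])
  then have "act (mat 1 + t *\<^sub>R K) p = p + t *\<^sub>R der K p + t\<^sup>2 *\<^sub>R (?A (?B p) + ?A (?C p) + ?B (?C p))
     + (t * t\<^sup>2) *\<^sub>R ?A (?B (?C p))" for t
    by (simp add: s v der_def linear_slot linear_vmap linear_add linear_scale scaleR_add_right power2_eq_square)
  then show ?thesis by blast
qed

text \<open>Along the path \<open>act (mat 1 + t *\<^sub>R K) p\<close> naturality makes the metric
  a quadratic polynomial in \<open>t\<close> as long as the matrix stays invertible. Comparing two
  derivatives of the same function avoids differentiating the formula with the root.\<close>

lemma metric_derivative_diamond: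
  assumes "nondegenerate p"
  shows "frechet_derivative metric (at p) (diamond A p) = A + transpose A"
proof -
  define K where "K = A ** ginv p"
  have d: "diamond A p = der K p" by (simp add: K_def diamond_der)
  have Kg: "K ** metric p = A"
    by (simp add: K_def ginv_inverse[OF assms] flip: matrix_mul_assoc)
  obtain R R' where R: "\<And>t. act (mat 1 + t *\<^sub>R K) p = p + t *\<^sub>R der K p + t\<^sup>2 *\<^sub>R R + (t * t\<^sup>2) *\<^sub>R R'"
    using act_path by blast
  have "((\<lambda>t. act (mat 1 + t *\<^sub>R K) p) has_vector_derivative der K p) (at 0)"
    unfolding R by (auto intro!: derivative_eq_intros)
  then have c: "((\<lambda>t. act (mat 1 + t *\<^sub>R K) p) has_derivative (\<lambda>t. t *\<^sub>R der K p)) (at 0)"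
    by (simp add: has_vector_derivative_def)
  have "(metric has_derivative frechet_derivative metric (at p)) (at (act (mat 1 + 0 *\<^sub>R K) p))"
    using smooth_has_derivative[OF smooth_metric] assms by simp
  from has_derivative_compose[OF c this]
  have 1: "((\<lambda>t. metric (act (mat 1 + t *\<^sub>R K) p)) has_derivative
      (\<lambda>t. frechet_derivative metric (at p) (t *\<^sub>R der K p))) (at 0)" by simp
  define m where "m = (\<lambda>t::real. metric p + t *\<^sub>R (A + transpose A) + t\<^sup>2 *\<^sub>R (A ** transpose K))"
  have "(m has_vector_derivative (A + transpose A)) (at 0)"
    unfolding m_def by (auto intro!: derivative_eq_intros)
  then have 2: "(m has_derivative (\<lambda>t. t *\<^sub>R (A + transpose A))) (at 0)"
    by (simp add: has_vector_derivative_def)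
  have meq: "metric (act (mat 1 + t *\<^sub>R K) p) = m t" if "det (mat 1 + t *\<^sub>R K) \<noteq> 0" for t
  proof -
    have "metric p ** transpose K = transpose A"
      using Kg metric_sym[OF assms] by (metis matrix_transpose_mul)
    moreover have "transpose (mat 1 + t *\<^sub>R K) = mat 1 + t *\<^sub>R transpose K"
      by (simp add: transpose_def vec_eq_iff mat_def)
    moreover have "(B + C) ** D = B ** D + C ** D" for B C D :: ten2
      by (simp add: matrix_matrix_mult_def vec_eq_iff sum.distrib distrib_right)
    ultimately show ?thesis
      unfolding metric_act[OF assms that] m_def
      by (simp add: matrix_add_ldistrib
          matrix_scalar_ac Kg power2_eq_square scaleR_add_right flip: scalar_matrix_assoc matrix_mul_assoc)
  qed
  have "continuous_on UNIV (\<lambda>t. det (mat 1 + t *\<^sub>R K))"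
    unfolding det_def by (simp, intro continuous_intros)
  then have "open {t. det (mat 1 + t *\<^sub>R K) \<noteq> 0}" by (simp add: open_Collect_neq)
  moreover have "0 \<in> {t. det (mat 1 + t *\<^sub>R K) \<noteq> 0}" by simp
  ultimately have "(m has_derivative (\<lambda>t. frechet_derivative metric (at p) (t *\<^sub>R der K p))) (at 0)"
    by (rule has_derivative_transform_within_open[OF 1]) (simp add: meq)
  from fun_cong[OF has_derivative_unique[OF this 2], of 1] show ?thesis by (simp add: d)
qed

lemma linear_metric_derivative: "nondegenerate p \<Longrightarrow> linear (frechet_derivative metric (at p))"
  using smooth_differentiable[OF smooth_metric] by (intro linear_frechet_derivative) auto

text \<open>The psi part is a diamond with a skew matrix, and \<open>A + transpose A\<close>
  vanishes for it.\<close>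

lemma metric_derivative_of_pair:
  assumes "alternating3 p" "nondegenerate p" "transpose h = h"
  shows "frechet_derivative metric (at p) (of_pair p (h, X)) = 2 *\<^sub>R h"
proof -
  obtain A where A: "transpose A = - A" "hook_psi X p = diamond A p"
    by (rule hook_psi_is_diamond[OF assms(1,2)])
  show ?thesis
    using assms(3) by (simp add: of_pair_def A linear_add[OF linear_metric_derivative[OF assms(2)]]
        metric_derivative_diamond[OF assms(2)] scaleR_2)
qed

subsection \<open>The operators as functions of jets\<close>

text \<open>Here and below \<open>p\<close> stands for the value of a form at a point and
  \<open>q $ i\<close> for its i-th partial derivative there; the chain rule replaces the
  derivatives of the metric.\<close>

definition christoffel_jet :: "ten3 \<Rightarrow> ten4 \<Rightarrow> ten3" where
  "christoffel_jet p q = (\<chi> k i j. (1/2) * (\<Sum>l\<in>UNIV. ginv p $ k $ l *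
     (frechet_derivative metric (at p) (q $ i) $ j $ l + frechet_derivative metric (at p) (q $ j) $ i $ l
      - frechet_derivative metric (at p) (q $ l) $ i $ j)))"

text \<open>\<open>unhook\<close> stands in for the definite description of the torsion. It gives a
  value for every jet, so smoothness becomes a matter of formulas.\<close>

definition torsion_jet :: "ten3 \<Rightarrow> ten4 \<Rightarrow> ten2" where
  "torsion_jet p q = (\<chi> m. unhook p (q $ m - der (\<chi> i r. christoffel_jet p q $ r $ m $ i) p))"

definition VT_jet :: "ten3 \<Rightarrow> ten4 \<Rightarrow> vec7" where
  "VT_jet p q = contract2 p (torsion_jet p q)"

definition sharp_jet :: "ten3 \<Rightarrow> ten4 \<Rightarrow> vec7" where
  "sharp_jet p q = ginv p *v VT_jet p q"

abbreviation jets1 :: "(ten3 \<times> ten4) set" where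
  "jets1 \<equiv> {x. nondegenerate (fst x)}"

abbreviation jets2 :: "(ten3 \<times> ten4 \<times> (ten4^7)) set" where
  "jets2 \<equiv> {x. nondegenerate (fst x)}"

lemma open_jets: "open {x :: ten3 \<times> 'b::topological_space. nondegenerate (fst x)}"
  using open_vimage[OF open_nondegenerate, of fst] by (simp add: vimage_def continuous_on_fst)

lemma smooth_fst_compose:
  "smooth {p. nondegenerate p} F \<Longrightarrow> smooth {x :: ten3 \<times> 'b::euclidean_space. nondegenerate (fst x)} (\<lambda>x. F (fst x))"
  by (rule smooth_compose_linear[OF _ open_jets bounded_linear_fst]) auto

lemmas smooth_jets_base = smooth_fst_compose[OF smooth_ginv] smooth_fst_compose[OF smooth_psi]
  smooth_fst_compose[OF smooth_metric] smooth_fst_compose[OF smooth_id[OF open_nondegenerate]]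

lemma smooth_snd: "open S \<Longrightarrow> smooth S (\<lambda>x. snd x)"
  by (rule smooth_linear[OF bounded_linear_snd smooth_id])

lemma smooth_christoffel_jet: "smooth jets1 (\<lambda>x. christoffel_jet (fst x) (snd x))"
  unfolding christoffel_jet_def
  by (intro smooth_vec smooth_cmult smooth_sum smooth_mult smooth_add smooth_diff smooth_nth smooth_snd
      smooth_frechet[OF smooth_metric] smooth_jets_base open_jets bounded_linear_fst) auto

lemma smooth_unhook:
  fixes S :: "'a::euclidean_space set"
  assumes "open S" "smooth S p" "smooth S \<eta>" "smooth S (\<lambda>x. psi (p x))" "smooth S (\<lambda>x. ginv (p x))"
  shows "smooth S (\<lambda>x. unhook (p x) (\<eta> x))"
  unfolding unhook_def inner_vec_def act_nth inner_real_def
  by (intro smooth_vec smooth_divide smooth_sum smooth_mult smooth_nth assms)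

lemma smooth_der:
  fixes S :: "'a::euclidean_space set"
  assumes "open S" "smooth S K" "smooth S p" shows "smooth S (\<lambda>x. der (K x) (p x))"
  unfolding der_def slot_def vmap_def
  by (intro smooth_vec smooth_sum smooth_add smooth_scaleR smooth_nth assms)

lemma smooth_contract2:
  fixes S :: "'a::euclidean_space set"
  assumes "open S" "smooth S p" "smooth S T" "smooth S (\<lambda>x. ginv (p x))"
  shows "smooth S (\<lambda>x. contract2 (p x) (T x))"
  unfolding contract2_def act2_nth
  by (intro smooth_vec smooth_sum smooth_mult smooth_nth assms)

lemma smooth_mult_vec:
  fixes S :: "'a::euclidean_space set" and A :: "'a \<Rightarrow> ten2"
  assumes "open S" "smooth S A" "smooth S x" shows "smooth S (\<lambda>z. A z *v x z)"
  unfolding matrix_vector_mult_def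
  by (intro smooth_vec smooth_sum smooth_mult smooth_nth assms)

lemma smooth_torsion_jet: "smooth jets1 (\<lambda>x. torsion_jet (fst x) (snd x))"
  unfolding torsion_jet_def
  by (intro smooth_vec smooth_unhook smooth_diff smooth_der smooth_nth smooth_snd smooth_christoffel_jet
      smooth_jets_base open_jets)

lemma smooth_VT_jet: "smooth jets1 (\<lambda>x. VT_jet (fst x) (snd x))"
  unfolding VT_jet_def by (intro smooth_contract2 smooth_torsion_jet smooth_jets_base open_jets)

lemma smooth_sharp_jet: "smooth jets1 (\<lambda>x. sharp_jet (fst x) (snd x))"
  unfolding sharp_jet_def by (intro smooth_mult_vec smooth_VT_jet smooth_jets_base open_jets)

text \<open>The derivative in the \<open>i\<close>-th coordinate direction of a function of 1-jets, as a function of 2-jets.\<close>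

definition total :: "(ten3 \<Rightarrow> ten4 \<Rightarrow> 'b::real_normed_vector) \<Rightarrow> 7 \<Rightarrow> ten3 \<times> ten4 \<times> (ten4^7) \<Rightarrow> 'b" where
  "total F i x = frechet_derivative (\<lambda>w. F (fst w) (snd w)) (at (fst x, fst (snd x)))
     (fst (snd x) $ i, snd (snd x) $ i)"

lemma smooth_total:
  assumes "smooth jets1 (\<lambda>w. F (fst w) (snd w))" shows "smooth jets2 (total F i)"
  unfolding total_def[abs_def]
proof (rule smooth_frechet[OF assms open_jets])
  show "bounded_linear (\<lambda>x :: ten3 \<times> ten4 \<times> (ten4^7). (fst x, fst (snd x)))"
    by (intro bounded_linear_Pair bounded_linear_fst bounded_linear_compose[OF bounded_linear_fst bounded_linear_snd])
  show "smooth jets2 (\<lambda>x. (fst (snd x) $ i, snd (snd x) $ i))"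
    by (rule smooth_linear[OF _ smooth_id[OF open_jets]])
       (intro bounded_linear_Pair bounded_linear_compose[OF bounded_linear_vec_nth]
         bounded_linear_compose[OF bounded_linear_fst bounded_linear_snd]
         bounded_linear_compose[OF bounded_linear_snd bounded_linear_snd])
qed simp

abbreviation on_jets2 :: "(ten3 \<Rightarrow> ten4 \<Rightarrow> 'b) \<Rightarrow> ten3 \<times> ten4 \<times> (ten4^7) \<Rightarrow> 'b" where
  "on_jets2 F x \<equiv> F (fst x) (fst (snd x))"

lemma smooth_on_jets2:
  assumes "smooth jets1 (\<lambda>w. F (fst w) (snd w))" shows "smooth jets2 (\<lambda>x. on_jets2 F x)"
proof -
  have "bounded_linear (\<lambda>x :: ten3 \<times> ten4 \<times> (ten4^7). (fst x, fst (snd x)))"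
    by (intro bounded_linear_Pair bounded_linear_fst bounded_linear_compose[OF bounded_linear_fst bounded_linear_snd])
  from smooth_compose_linear[OF assms open_jets this] show ?thesis by simp
qed

definition ricci_jet :: "ten3 \<times> ten4 \<times> (ten4^7) \<Rightarrow> ten2" where
  "ricci_jet x = (\<chi> j k. (\<Sum>i\<in>UNIV. total christoffel_jet i x $ i $ j $ k - total christoffel_jet j x $ i $ i $ k) +
     (\<Sum>i\<in>UNIV. \<Sum>r\<in>UNIV. on_jets2 christoffel_jet x $ i $ i $ r * on_jets2 christoffel_jet x $ r $ j $ k
        - on_jets2 christoffel_jet x $ i $ j $ r * on_jets2 christoffel_jet x $ r $ i $ k))"

definition lie_jet :: "ten3 \<times> ten4 \<times> (ten4^7) \<Rightarrow> ten2" where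
  "lie_jet x = (\<chi> i j. \<Sum>m\<in>UNIV.
     on_jets2 sharp_jet x $ m * frechet_derivative metric (at (fst x)) (fst (snd x) $ m) $ i $ j +
     total sharp_jet i x $ m * metric (fst x) $ m $ j + total sharp_jet j x $ m * metric (fst x) $ i $ m)"

definition div_jet :: "ten3 \<times> ten4 \<times> (ten4^7) \<Rightarrow> vec7" where
  "div_jet x = (\<chi> k. \<Sum>i\<in>UNIV. \<Sum>j\<in>UNIV. ginv (fst x) $ i $ j * (total torsion_jet i x $ j $ k
     - (\<Sum>r\<in>UNIV. on_jets2 christoffel_jet x $ r $ i $ j * on_jets2 torsion_jet x $ r $ k
          + on_jets2 christoffel_jet x $ r $ i $ k * on_jets2 torsion_jet x $ j $ r)))"

definition div_t_jet :: "ten3 \<times> ten4 \<times> (ten4^7) \<Rightarrow> vec7" where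
  "div_t_jet x = (\<chi> k. \<Sum>i\<in>UNIV. \<Sum>j\<in>UNIV. ginv (fst x) $ i $ j * (total torsion_jet i x $ k $ j
     - (\<Sum>r\<in>UNIV. on_jets2 christoffel_jet x $ r $ i $ j * on_jets2 torsion_jet x $ k $ r
          + on_jets2 christoffel_jet x $ r $ i $ k * on_jets2 torsion_jet x $ r $ j)))"

definition G2_jet :: "real \<Rightarrow> real \<Rightarrow> real \<Rightarrow> ten3 \<times> ten4 \<times> (ten4^7) \<Rightarrow> ten3" where
  "G2_jet a b1 b2 x = diamond (- ricci_jet x + a *\<^sub>R lie_jet x) (fst x)
     + hook_psi (b1 *\<^sub>R div_jet x + b2 *\<^sub>R div_t_jet x) (fst x)"

lemma smooth_diamond:
  fixes S :: "'a::euclidean_space set"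
  assumes "open S" "smooth S A" "smooth S p" "smooth S (\<lambda>x. ginv (p x))"
  shows "smooth S (\<lambda>x. diamond (A x) (p x))"
  unfolding diamond_def by (intro smooth_vec smooth_sum smooth_add smooth_mult smooth_nth assms)

lemma smooth_hook_psi:
  fixes S :: "'a::euclidean_space set"
  assumes "open S" "smooth S X" "smooth S (\<lambda>x. psi (p x))" "smooth S (\<lambda>x. ginv (p x))"
  shows "smooth S (\<lambda>x. hook_psi (X x) (p x))"
  unfolding hook_psi_def by (intro smooth_vec smooth_sum smooth_add smooth_mult smooth_nth assms)

lemma smooth_G2_jet: "smooth jets2 (G2_jet a b1 b2)"
proof -
  note j = smooth_total[OF smooth_christoffel_jet] smooth_total[OF smooth_torsion_jet]
    smooth_total[OF smooth_sharp_jet] smooth_on_jets2[OF smooth_christoffel_jet]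
    smooth_on_jets2[OF smooth_torsion_jet] smooth_on_jets2[OF smooth_sharp_jet]
  note intros = smooth_vec smooth_sum smooth_add smooth_diff smooth_mult smooth_nth smooth_jets_base open_jets j
  have "smooth jets2 ricci_jet" unfolding ricci_jet_def[abs_def] by (intro intros)
  moreover have "smooth jets2 lie_jet" unfolding lie_jet_def[abs_def]
  proof (intro intros)
    show "smooth jets2 (\<lambda>x. frechet_derivative metric (at (fst x)) (fst (snd x) $ m))" for m
      by (rule smooth_frechet[OF smooth_metric open_jets bounded_linear_fst])
         (auto intro!: smooth_nth smooth_linear[OF bounded_linear_compose[OF bounded_linear_fst bounded_linear_snd] smooth_id[OF open_jets]])
  qed
  moreover have "smooth jets2 div_jet" unfolding div_jet_def[abs_def] by (intro intros)
  moreover have "smooth jets2 div_t_jet" unfolding div_t_jet_def[abs_def] by (intro intros)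
  ultimately show ?thesis
    unfolding G2_jet_def[abs_def]
    by (intro smooth_add smooth_diamond smooth_hook_psi smooth_minus smooth_jets_base open_jets
        smooth_linear[OF bounded_linear_scaleR_right])
qed

section \<open>Covariant derivative and torsion at a point, in terms of pairs\<close>

lemma linear_hook_psi: "linear (\<lambda>X. hook_psi X p)"
proof (rule linearI)
  show "hook_psi (X + Y) p = hook_psi X p + hook_psi Y p" for X Y
    by (simp add: hook_psi_sum matrix_vector_right_distrib scaleR_add_left sum.distrib)
  show "hook_psi (c *\<^sub>R X) p = c *\<^sub>R hook_psi X p" for c X
    by (simp add: hook_psi_sum matrix_vector_mult_scaleR scaleR_right.sum)
qed

lemma linear_diamond: "linear (\<lambda>A. diamond A p)"
  by (rule linearI)
     (simp_all add: vec_eq_iff diamond_def distrib_right distrib_left sum.distrib sum_distrib_left mult_ac)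

lemma linear_of_pair: "linear (of_pair p)"
  by (rule linearI)
     (simp_all add: of_pair_def linear_add[OF linear_hook_psi] linear_add[OF linear_diamond]
       linear_scale[OF linear_hook_psi] linear_scale[OF linear_diamond] scaleR_add_right)

text \<open>The i-th derivative of the metric is 2 h_i, so with its upper index lowered the
  Christoffel symbol in direction \<open>m\<close> splits into the symmetric \<open>h m\<close> and
  a skew remainder.\<close>

lemma christoffel_jet_lower:
  assumes p: "alternating3 p" "nondegenerate p" and h: "\<And>i. transpose (h i) = h i"
    and q: "\<And>i. q $ i = of_pair p (h i, X i)"
  shows "(\<chi> i r. christoffel_jet p q $ r $ m $ i) ** metric p = h m + (\<chi> i j. h i $ m $ j - h j $ m $ i)"
proof -
  have D: "frechet_derivative metric (at p) (q $ i) = 2 *\<^sub>R h i" for i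
    unfolding q by (rule metric_derivative_of_pair[OF p h])
  have "(\<Sum>r\<in>UNIV. christoffel_jet p q $ r $ m $ i * metric p $ r $ j) = h m $ i $ j + (h i $ m $ j - h j $ m $ i)" for i j
  proof -
    define v where "v = (\<chi> l. h m $ i $ l + h i $ m $ l - h l $ m $ i)"
    have "christoffel_jet p q $ r $ m $ i = (ginv p *v v) $ r" for r
      by (simp add: christoffel_jet_def D v_def matrix_vector_mult_def sum_distrib_left algebra_simps)
    then have "(\<Sum>r\<in>UNIV. christoffel_jet p q $ r $ m $ i * metric p $ r $ j) = (metric p *v (ginv p *v v)) $ j"
      using symD[OF metric_sym[OF p(2)], of j]
      by (simp add: matrix_vector_mult_def[of "metric p"] mult.commute)
    also have "\<dots> = v $ j" by (simp add: matrix_vector_mul_assoc ginv_inverse[OF p(2)])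
    finally show ?thesis by (simp add: v_def)
  qed
  then show ?thesis by (simp add: vec_eq_iff matrix_matrix_mult_def)
qed

text \<open>The symmetric part of the connection cancels \<open>h m\<close> in \<open>q $ m\<close>,
  and the skew part acts along psi only. This is why a torsion tensor exists.\<close>

lemma covariant_derivative_hook:
  assumes p: "alternating3 p" "nondegenerate p" and h: "\<And>i. transpose (h i) = h i"
    and q: "\<And>i. q $ i = of_pair p (h i, X i)"
  shows "q $ m - der (\<chi> i r. christoffel_jet p q $ r $ m $ i) p =
    hook_psi (X m + (1/2) *\<^sub>R contract2 p (\<chi> i j. h i $ m $ j - h j $ m $ i)) p" (is "_ - der ?G p = _")
proof -
  let ?S = "\<chi> i j. h i $ m $ j - h j $ m $ i"
  have "transpose ?S = - ?S" by (simp add: vec_eq_iff transpose_def)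
  note S = diamond_skew[OF p this]
  have "der ?G p = diamond (?G ** metric p) p"
    by (simp add: diamond_der ginv_inverse[OF p(2)] flip: matrix_mul_assoc)
  also have "\<dots> = diamond (h m) p + diamond ?S p"
    unfolding christoffel_jet_lower[OF assms] by (rule linear_add[OF linear_diamond])
  finally have "q $ m - der ?G p = hook_psi (X m) p - diamond ?S p"
    by (simp add: q of_pair_def)
  also have "\<dots> = hook_psi (X m - (- 1/2) *\<^sub>R contract2 p ?S) p"
    unfolding S by (rule linear_diff[OF linear_hook_psi, symmetric])
  finally show ?thesis by simp
qed

lemma torsion_jet_eq:
  assumes p: "alternating3 p" "nondegenerate p" and h: "\<And>i. transpose (h i) = h i"
    and q: "\<And>i. q $ i = of_pair p (h i, X i)"
  shows "torsion_jet p q $ m = X m + (1/2) *\<^sub>R contract2 p (\<chi> i j. h i $ m $ j - h j $ m $ i)"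
  unfolding torsion_jet_def by (simp add: covariant_derivative_hook[OF assms] unhook_hook[OF p])

section \<open>Partial derivatives, and the operators as jet functions along a form\<close>

lemma pd_compose:
  assumes "F differentiable (at (f y))" "f differentiable (at y)"
  shows "pd i (\<lambda>z. F (f z)) y = frechet_derivative F (at (f y)) (pd i f y)"
proof -
  note has_derivative_compose[OF assms(2)[unfolded frechet_derivative_works] assms(1)[unfolded frechet_derivative_works]]
  from fun_cong[OF frechet_derivative_at[OF this], of "axis i 1"] show ?thesis by (simp add: pd_def)
qed

lemma pd_linear:
  assumes "bounded_linear L" "f differentiable (at y)" shows "pd i (\<lambda>z. L (f z)) y = L (pd i f y)"
proof -
  have "(L has_derivative L) (at x)" for x by (rule bounded_linear_imp_has_derivative[OF assms(1)])
  from frechet_derivative_at[OF this, symmetric] bounded_linear_imp_differentiable[OF assms(1)]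
  have "L differentiable (at (f y))" "frechet_derivative L (at (f y)) = L" by blast+
  then show ?thesis using pd_compose[of L f y i] assms(2) by simp
qed

lemma pd_cong:
  assumes "open V" "y \<in> V" "\<And>z. z \<in> V \<Longrightarrow> f z = g z" "g differentiable (at y)"
  shows "pd i f y = pd i g y"
proof -
  have "frechet_derivative g (at y) = frechet_derivative f (at y)"
    by (rule frechet_derivative_transform_within_open[OF assms(4,1,2)]) (simp add: assms(3))
  then show ?thesis by (simp add: pd_def)
qed

lemma bounded_linear_transpose: "bounded_linear (transpose :: ten2 \<Rightarrow> ten2)"
  unfolding linear_conv_bounded_linear[symmetric] by (rule linearI) (simp_all add: vec_eq_iff transpose_def)

lemma sum_swap4:
  "(\<Sum>i\<in>A. \<Sum>j\<in>B. \<Sum>a\<in>C. \<Sum>b\<in>D. f i j a b) = (\<Sum>a\<in>C. \<Sum>b\<in>D. \<Sum>i\<in>A. \<Sum>j\<in>B. f i j a b)"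
  by (subst sum_rotate, rule sum.cong[OF refl], rule sum_rotate)

text \<open>An arbitrary open set, not just a chart image: a variation of \<phi> by \<open>s\<close>
  times a 3-form is nondegenerate only on a smaller set, which depends on \<open>s\<close>.\<close>

locale G2_germ =
  fixes V :: "vec7 set" and \<phi> :: "vec7 \<Rightarrow> ten3"
  assumes opn: "open V" and G2: "G2_form_on V \<phi>"
begin

lemma alt: "z \<in> V \<Longrightarrow> alternating3 (\<phi> z)" and nd: "z \<in> V \<Longrightarrow> nondegenerate (\<phi> z)"
  and sm: "smooth V \<phi>"
  using G2 smooth_on_iff[OF opn] unfolding G2_form_on_def by auto

definition "D1 z = (\<chi> i. pd i \<phi> z)"
definition "D2 z = (\<chi> i j. pd i (pd j \<phi>) z)"

lemma smooth_D1: "smooth V D1"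
  unfolding D1_def[abs_def] by (intro smooth_vec opn smooth_pd[OF sm])

lemma pd_D1: assumes "z \<in> V" shows "pd i D1 z = D2 z $ i"
proof -
  have "D2 z $ i $ j = pd i D1 z $ j" for j
    using pd_linear[OF bounded_linear_vec_nth smooth_differentiable[OF smooth_D1 assms], of i j]
    by (simp add: D2_def D1_def[abs_def])
  then show ?thesis by (simp add: vec_eq_iff)
qed

text \<open>The chain rule for functions of the 1-jet. The map \<open>L\<close> accommodates the
  transpose of the torsion and is the identity elsewhere.\<close>

lemma pd_total:
  assumes F: "smooth jets1 (\<lambda>w. F (fst w) (snd w))" and L: "bounded_linear L"
    and H: "\<And>z. z \<in> V \<Longrightarrow> H z = L (F (\<phi> z) (D1 z))" and y: "y \<in> V"
  shows "pd i H y = L (total F i (\<phi> y, D1 y, D2 y))"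
proof -
  let ?F = "\<lambda>w. F (fst w) (snd w)" and ?J = "\<lambda>z. (\<phi> z, D1 z)"
  note d = smooth_has_derivative[OF sm y] smooth_has_derivative[OF smooth_D1 y]
  have J: "(?J has_derivative (\<lambda>v. (frechet_derivative \<phi> (at y) v, frechet_derivative D1 (at y) v))) (at y)"
    by (rule has_derivative_Pair[OF d])
  then have Jd: "?J differentiable (at y)" unfolding differentiable_def by blast
  have pJ: "pd i ?J y = (pd i \<phi> y, pd i D1 y)"
    using fun_cong[OF frechet_derivative_at[OF J], of "axis i 1"] by (simp add: pd_def)
  have Fd: "?F differentiable (at (?J y))"
    using smooth_differentiable[OF F] nd[OF y] by simp
  have FJ: "(\<lambda>z. ?F (?J z)) differentiable (at y)"
    using differentiable_chain_at[OF Jd Fd] by (simp add: o_def)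
  have "(\<lambda>z. L (?F (?J z))) differentiable (at y)"
    using differentiable_chain_at[OF FJ bounded_linear_imp_differentiable[OF L]] by (simp add: o_def)
  then have "pd i H y = pd i (\<lambda>z. L (?F (?J z))) y"
    using H by (intro pd_cong[OF opn y]) auto
  also have "\<dots> = L (frechet_derivative ?F (at (?J y)) (pd i \<phi> y, pd i D1 y))"
    unfolding pd_linear[OF L FJ] pd_compose[OF Fd Jd] pJ ..
  also have "pd i \<phi> y = D1 y $ i" by (simp add: D1_def)
  finally show ?thesis by (simp add: total_def pd_D1[OF y])
qed

lemmas pd_total_id = pd_total[OF _ bounded_linear_ident]

lemma pd_metric: "z \<in> V \<Longrightarrow> pd i (\<lambda>z. metric (\<phi> z)) z = frechet_derivative metric (at (\<phi> z)) (D1 z $ i)"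
  using pd_compose[of metric \<phi> z i] smooth_differentiable[OF smooth_metric] smooth_differentiable[OF sm] nd
  by (simp add: D1_def)

lemma christoffel_eq: "z \<in> V \<Longrightarrow> christoffel \<phi> z = christoffel_jet (\<phi> z) (D1 z)"
  by (simp add: christoffel_def christoffel_jet_def Let_def pd_metric)

lemma alternating_D1: assumes z: "z \<in> V" shows "alternating3 (D1 z $ m)"
proof -
  have zero: "L (D1 z $ m) = 0" if L: "bounded_linear L" and 0: "\<And>z. z \<in> V \<Longrightarrow> L (\<phi> z) = 0" for L :: "ten3 \<Rightarrow> real"
  proof -
    have "L (pd m \<phi> z) = pd m (\<lambda>z. L (\<phi> z)) z"
      by (rule pd_linear[OF L smooth_differentiable[OF sm z], symmetric])
    also have "\<dots> = pd m (\<lambda>z. 0) z" by (rule pd_cong[OF opn z]) (simp_all add: 0)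
    finally show ?thesis by (simp add: D1_def pd_def)
  qed
  have n: "bounded_linear (\<lambda>t::ten3. t $ i $ j $ k)" for i j k
    by (intro bounded_linear_compose[OF bounded_linear_vec_nth] bounded_linear_vec_nth)
  have "D1 z $ m $ i $ j $ k + D1 z $ m $ j $ i $ k = 0" for i j k
    by (rule zero[OF bounded_linear_add[OF n n]]) (simp add: alternating3D(1)[OF alt, of _ i j k])
  moreover have "D1 z $ m $ i $ j $ k + D1 z $ m $ i $ k $ j = 0" for i j k
    by (rule zero[OF bounded_linear_add[OF n n]]) (simp add: alternating3D(2)[OF alt, of _ i j k])
  ultimately show ?thesis unfolding alternating3_def by (simp add: eq_neg_iff_add_eq_0)
qed

lemma torsion_eq: assumes z: "z \<in> V" shows "torsion \<phi> z = torsion_jet (\<phi> z) (D1 z)"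
proof -
  note p = alt[OF z] nd[OF z]
  \<comment> \<open>The partial derivatives are again 3-forms, so each splits into a pair, as the
    pointwise formulas require.\<close>
  have "\<exists>u. transpose (fst u) = fst u \<and> D1 z $ i = of_pair (\<phi> z) (fst u, snd u)" for i
  proof (rule of_pair_surj[OF p alternating_D1[OF z, of i]])
    fix h X assume "transpose h = h" "of_pair (\<phi> z) (h, X) = D1 z $ i"
    then show ?thesis by (intro exI[of _ "(h, X)"]) simp
  qed
  then have "\<exists>u. \<forall>i. transpose (fst (u i)) = fst (u i) \<and> D1 z $ i = of_pair (\<phi> z) (fst (u i), snd (u i))"
    by (intro choice) blast
  then obtain u where "\<And>i. transpose (fst (u i)) = fst (u i)" "\<And>i. D1 z $ i = of_pair (\<phi> z) (fst (u i), snd (u i))"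
    by blast
  note hX = this
  have n: "nabla3 \<phi> \<phi> z $ m = D1 z $ m - der (\<chi> i r. christoffel_jet (\<phi> z) (D1 z) $ r $ m $ i) (\<phi> z)" for m
    by (simp add: vec_eq_iff nabla3_def Let_def christoffel_eq[OF z] D1_def der_nth sum.distrib)
  have "(\<Sum>r\<in>UNIV. \<Sum>q\<in>UNIV. T $ m $ r * ginv (\<phi> z) $ r $ q * psi (\<phi> z) $ q $ i $ j $ k) =
      hook_psi (T $ m) (\<phi> z) $ i $ j $ k" for T :: ten2 and m i j k
    unfolding hook_psi_def vec_lambda_beta
    by (subst sum.swap, intro sum.cong refl, subst symD[OF ginv_sym[OF p(2)]]) simp
  then have iff: "(\<forall>m i j k. nabla3 \<phi> \<phi> z $ m $ i $ j $ k =
       (\<Sum>r\<in>UNIV. \<Sum>q\<in>UNIV. T $ m $ r * ginv (\<phi> z) $ r $ q * psi (\<phi> z) $ q $ i $ j $ k)) \<longleftrightarrow>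
     (\<forall>m. nabla3 \<phi> \<phi> z $ m = hook_psi (T $ m) (\<phi> z))" for T
    by (simp add: vec_eq_iff)
  show ?thesis
    unfolding torsion_def iff
  proof (rule the_equality)
    show "\<forall>m. nabla3 \<phi> \<phi> z $ m = hook_psi (torsion_jet (\<phi> z) (D1 z) $ m) (\<phi> z)"
      unfolding n covariant_derivative_hook[OF p hX] torsion_jet_eq[OF p hX] by simp
    show "T = torsion_jet (\<phi> z) (D1 z)" if "\<forall>m. nabla3 \<phi> \<phi> z $ m = hook_psi (T $ m) (\<phi> z)" for T
    proof -
      have "T $ m = unhook (\<phi> z) (nabla3 \<phi> \<phi> z $ m)" for m using that unhook_hook[OF p] by simp
      then show ?thesis unfolding torsion_jet_def n by (simp add: vec_eq_iff)
    qed
  qed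
qed

lemma VT_eq: assumes z: "z \<in> V" shows "VT \<phi> z = VT_jet (\<phi> z) (D1 z)"
proof -
  have "VT \<phi> z $ k = contract2 (\<phi> z) (torsion \<phi> z) $ k" for k
    unfolding VT_def contract2_def vec_lambda_beta act2_nth sum_distrib_right
    by (subst sum_swap4, intro sum.cong refl)
       (subst (1 2) symD[OF ginv_sym[OF nd[OF z]]], rule refl)
  then show ?thesis unfolding VT_jet_def torsion_eq[OF z, symmetric] by (simp add: vec_eq_iff)
qed

lemma sharp_eq: "z \<in> V \<Longrightarrow> sharp \<phi> (VT \<phi>) z = sharp_jet (\<phi> z) (D1 z)"
  by (simp add: sharp_def sharp_jet_def VT_eq)

lemma G2_operator_eq:
  assumes y: "y \<in> V" shows "G2_operator a b1 b2 \<phi> y = G2_jet a b1 b2 (\<phi> y, D1 y, D2 y)"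
proof -
  let ?x = "(\<phi> y, D1 y, D2 y)"
  have ric: "ricci \<phi> y = ricci_jet ?x"
    unfolding ricci_def ricci_jet_def Let_def
    by (simp add: christoffel_eq[OF y] pd_total_id[OF smooth_christoffel_jet christoffel_eq y])
  have lie: "lie_VT_metric \<phi> y = lie_jet ?x"
    unfolding lie_VT_metric_def lie2_def lie_jet_def
    by (simp add: sharp_eq[OF y] pd_metric[OF y] pd_total_id[OF smooth_sharp_jet sharp_eq y])
  have div: "div_torsion \<phi> y = div_jet ?x"
    unfolding divergence_def div_jet_def nabla2_def Let_def
    by (simp add: christoffel_eq[OF y] torsion_eq[OF y] pd_total_id[OF smooth_torsion_jet torsion_eq y])
  have "pd i (\<lambda>z. transpose (torsion \<phi> z)) y = transpose (total torsion_jet i ?x)" for i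
    by (rule pd_total[OF smooth_torsion_jet bounded_linear_transpose _ y]) (simp add: torsion_eq)
  then have div_t: "div_torsion_t \<phi> y = div_t_jet ?x"
    unfolding divergence_def div_t_jet_def nabla2_def Let_def
    by (simp add: christoffel_eq[OF y] torsion_eq[OF y]) (simp add: transpose_def)
  show ?thesis unfolding G2_operator_def G2_jet_def ric lie div div_t by simp
qed

end

section \<open>Compositions, and derivatives along affine lines\<close>

lemma diff_times_compose:
  assumes "open S" "diff_times n T f" "diff_times n S g" "\<And>x. x \<in> S \<Longrightarrow> g x \<in> T"
  shows "diff_times n S (\<lambda>x. f (g x))"
  using assms(2,3)
proof (induction n arbitrary: f)
  case (Suc n)
  have g: "diff_times n S g" by (rule diff_times_mono[OF Suc.prems(2)])
  let ?D = "\<lambda>x v. \<Sum>b\<in>Basis. (frechet_derivative g (at x) v \<bullet> b) *\<^sub>R frechet_derivative f (at (g x)) b"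
  have sum: "diff_times n S (\<lambda>x. \<Sum>b\<in>I. F b x)" if "\<And>b. diff_times n S (F b)" for F :: "'b \<Rightarrow> 'a \<Rightarrow> 'c" and I
    by (induction I rule: infinite_finite_induct)
       (auto intro!: diff_times_add diff_times_const assms(1) that)
  show ?case
  proof (rule diff_timesI[OF assms(1)])
    show "((\<lambda>x. f (g x)) has_derivative ?D x) (at x)" if x: "x \<in> S" for x
    proof (rule has_derivative_eq_rhs)
      show "((\<lambda>x. f (g x)) has_derivative (\<lambda>v. frechet_derivative f (at (g x)) (frechet_derivative g (at x) v))) (at x)"
        by (rule has_derivative_compose[OF diff_timesD[OF Suc.prems(2) x] diff_timesD[OF Suc.prems(1) assms(4)[OF x]]])
      show "(\<lambda>v. frechet_derivative f (at (g x)) (frechet_derivative g (at x) v)) = ?D x"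
        using Suc.prems(1) assms(4)[OF x] by (intro ext frechet_derivative_basis) simp
    qed
    show "diff_times n S (\<lambda>x. ?D x v)" for v
    proof (rule sum)
      fix b
      have "diff_times n S (\<lambda>x. frechet_derivative f (at (g x)) b)"
        by (rule Suc.IH[OF _ g]) (use Suc.prems(1) in simp)
      moreover have "diff_times n S (\<lambda>x. frechet_derivative g (at x) v \<bullet> b)"
        by (rule diff_times_bounded_linear[OF assms(1) bounded_linear_inner_left]) (use Suc.prems(2) in simp)
      ultimately show "diff_times n S (\<lambda>x. (frechet_derivative g (at x) v \<bullet> b) *\<^sub>R frechet_derivative f (at (g x)) b)"
        by (intro diff_times_bilinear[OF assms(1) bounded_bilinear_scaleR])
    qed
  qed
qed simp

lemma smooth_compose:
  "smooth T f \<Longrightarrow> smooth S g \<Longrightarrow> (\<And>x. x \<in> S \<Longrightarrow> g x \<in> T) \<Longrightarrow> smooth S (\<lambda>x. f (g x))"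
  unfolding smooth_def using diff_times_compose by blast

text \<open>Reads off a derivative when the function is visibly affine along one line, whatever it
  does in other directions. The symbols are computed in this way.\<close>

lemma affine_path_derivative:
  assumes "F differentiable (at x)" "\<And>s::real. F (x + s *\<^sub>R k) = F x + s *\<^sub>R Z"
  shows "frechet_derivative F (at x) k = Z"
proof -
  have "((\<lambda>s::real. x + s *\<^sub>R k) has_derivative (\<lambda>s. s *\<^sub>R k)) (at 0)"
    by (auto intro!: derivative_eq_intros)
  moreover have "(F has_derivative frechet_derivative F (at x)) (at (x + (0::real) *\<^sub>R k))"
    using assms(1) by (simp add: frechet_derivative_works)
  ultimately have 1: "((\<lambda>s::real. F (x + s *\<^sub>R k)) has_derivative (\<lambda>s. frechet_derivative F (at x) (s *\<^sub>R k))) (at 0)"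
    by (rule has_derivative_compose)
  have 2: "((\<lambda>s::real. F (x + s *\<^sub>R k)) has_derivative (\<lambda>s. s *\<^sub>R Z)) (at 0)"
    unfolding assms(2) by (auto intro!: derivative_eq_intros)
  from fun_cong[OF has_derivative_unique[OF 1 2], of 1] show ?thesis by simp
qed

subsection \<open>Evaluating principal symbols\<close>

definition grad :: "(vec7 \<Rightarrow> 'b::real_normed_vector) \<Rightarrow> vec7 \<Rightarrow> 'b^7" where
  "grad f z = (\<chi> i. pd i f z)"

definition hess :: "(vec7 \<Rightarrow> 'b::real_normed_vector) \<Rightarrow> vec7 \<Rightarrow> 'b^7^7" where
  "hess f z = (\<chi> i j. pd i (pd j f) z)"

lemma lists_1: "(\<Sum>l | length l = 1. f (l :: 7 list)) = (\<Sum>i\<in>UNIV. f [i] :: 'b::comm_monoid_add)"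
  by (rule sum.reindex_bij_witness[of _ "\<lambda>i. [i]" hd]) (auto simp: length_Suc_conv)

lemma lists_2: "(\<Sum>l | length l = 2. f (l :: 7 list)) = (\<Sum>i\<in>UNIV. \<Sum>j\<in>UNIV. f [i, j] :: 'b::comm_monoid_add)"
proof -
  have "(\<Sum>l | length l = 2. f l) = (\<Sum>z\<in>UNIV. f [fst z, snd z])"
    by (rule sum.reindex_bij_witness[of _ "\<lambda>z. [fst z, snd z]" "\<lambda>l. (hd l, hd (tl l))"])
       (auto simp: length_Suc_conv eval_nat_numeral)
  then show ?thesis
    by (simp add: UNIV_Times_UNIV[symmetric] sum.cartesian_product case_prod_unfold del: UNIV_Times_UNIV)
qed

lemma finite_lists_7: "finite {l :: 7 list. length l = n}"
  using finite_lists_length_eq[of "UNIV :: 7 set" n] by simp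

lemma lists_le_1: "(\<Sum>l | length l \<le> 1. f (l :: 7 list)) = f [] + (\<Sum>i\<in>UNIV. f [i] :: 'b::ab_group_add)"
proof -
  have "{l :: 7 list. length l \<le> 1} = insert [] {l. length l = 1}" by (auto simp: le_Suc_eq)
  then show ?thesis unfolding lists_1[symmetric] using finite_lists_7[of 1] by simp
qed

lemma lists_le_2: "(\<Sum>l | length l \<le> 2. f (l :: 7 list)) =
   f [] + (\<Sum>i\<in>UNIV. f [i]) + (\<Sum>i\<in>UNIV. \<Sum>j\<in>UNIV. f [i, j] :: 'b::ab_group_add)"
proof -
  have "{l :: 7 list. length l \<le> 2} = {l. length l \<le> 1} \<union> {l. length l = 2}" by auto
  moreover have "finite {l :: 7 list. length l \<le> 1}"
    using finite_lists_length_le[of "UNIV :: 7 set" 1] by simp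
  moreover have "{l :: 7 list. length l \<le> 1} \<inter> {l. length l = 2} = {}" by auto
  ultimately show ?thesis
    unfolding lists_le_1[symmetric] lists_2[symmetric] using finite_lists_7[of 2] by (simp add: sum.union_disjoint)
qed

lemma pd_linear_form: "pd i (\<lambda>z. (c + \<xi> \<bullet> (z - x)) *\<^sub>R v) = (\<lambda>z. \<xi> $ i *\<^sub>R v)"
proof
  fix z
  have "((\<lambda>z. (c + \<xi> \<bullet> (z - x)) *\<^sub>R v) has_derivative (\<lambda>w. (\<xi> \<bullet> w) *\<^sub>R v)) (at z)"
    by (auto intro!: derivative_eq_intros)
  from fun_cong[OF frechet_derivative_at[OF this], of "axis i 1"]
  show "pd i (\<lambda>z. (c + \<xi> \<bullet> (z - x)) *\<^sub>R v) z = \<xi> $ i *\<^sub>R v" by (simp add: pd_def inner_axis)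
qed

lemma pd_quadratic_form: "pd i (\<lambda>z. ((\<xi> \<bullet> (z - x))\<^sup>2 / 2) *\<^sub>R v) = (\<lambda>z. (0 + \<xi> \<bullet> (z - x)) *\<^sub>R (\<xi> $ i *\<^sub>R v))"
proof
  fix z
  have "((\<lambda>z. ((\<xi> \<bullet> (z - x))\<^sup>2 / 2) *\<^sub>R v) has_derivative (\<lambda>w. ((\<xi> \<bullet> (z - x)) * (\<xi> \<bullet> w)) *\<^sub>R v)) (at z)"
    by (auto intro!: derivative_eq_intros)
  from fun_cong[OF frechet_derivative_at[OF this], of "axis i 1"]
  show "pd i (\<lambda>z. ((\<xi> \<bullet> (z - x))\<^sup>2 / 2) *\<^sub>R v) z = (0 + \<xi> \<bullet> (z - x)) *\<^sub>R (\<xi> $ i *\<^sub>R v)"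
    by (simp add: pd_def inner_axis)
qed

lemma smooth_linear_form: "open U \<Longrightarrow> smooth U (\<lambda>z :: vec7. \<xi> \<bullet> (z - x))"
  by (intro smooth_linear[OF bounded_linear_inner_right] smooth_diff smooth_id smooth_const)

lemma bounded_linear_imp_sum_axis:
  assumes "linear (\<Psi> :: 'a::real_vector^7 \<Rightarrow> 'b::real_vector)"
  shows "\<Psi> w = (\<Sum>i\<in>UNIV. \<Psi> (axis i (w $ i)))"
proof -
  have "w = (\<Sum>i\<in>UNIV. axis i (w $ i))" by (simp add: vec_eq_iff axis_def)
  then have "\<Psi> w = \<Psi> (\<Sum>i\<in>UNIV. axis i (w $ i))" by simp
  then show ?thesis by (simp only: linear_sum[OF assms])
qed

lemma axis_linear: "axis i (x + y) = axis i x + axis i (y :: 'a::real_vector)" "axis i (c *\<^sub>R x) = c *\<^sub>R axis i (x :: 'a)"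
  by (simp_all add: vec_eq_iff axis_def)

text \<open>Testing with \<open>((\<xi> \<bullet> (z - x))\<^sup>m / m!) v\<close> singles out the terms of order \<open>m\<close>.\<close>

lemma principal_symbol_1:
  fixes \<Psi>0 :: "'a::euclidean_space \<Rightarrow> 'b::real_normed_vector" and \<Psi>1 :: "'a^7 \<Rightarrow> 'b"
  assumes "open U" "x \<in> U" "subspace E" "v \<in> E" "linear \<Psi>0" "linear \<Psi>1"
    and L: "\<And>u. smooth U u \<Longrightarrow> (\<And>y. y \<in> U \<Longrightarrow> u y \<in> E) \<Longrightarrow> L u x = \<Psi>0 (u x) + \<Psi>1 (grad u x)"
  shows "principal_symbol 1 U E L x \<xi> v = \<Psi>1 (\<chi> i. \<xi> $ i *\<^sub>R v)"
  unfolding principal_symbol_def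
proof (rule the_equality)
  define A where "A = (\<lambda>l :: 7 list. if l = [] then \<Psi>0 else (\<lambda>v. \<Psi>1 (axis (hd l) v)))"
  have "linear (\<lambda>v. \<Psi>1 (axis i v))" for i
    by (rule linearI) (simp_all add: axis_linear linear_add[OF assms(6)] linear_scale[OF assms(6)])
  then have "\<forall>l. linear (A l)" using assms(5) by (simp add: A_def)
  moreover have "\<forall>u. smooth_on U u \<and> (\<forall>y\<in>U. u y \<in> E) \<longrightarrow> L u x = (\<Sum>l | length l \<le> 1. A l (pds l u x))"
    unfolding lists_le_1 smooth_on_iff[OF assms(1)]
    using bounded_linear_imp_sum_axis[OF assms(6), of "grad _ _"] by (auto simp: A_def L grad_def)
  moreover have "\<Psi>1 (\<chi> i. \<xi> $ i *\<^sub>R v) = (\<Sum>l | length l = 1. (\<Prod>i\<leftarrow>l. \<xi> $ i) *\<^sub>R A l v)"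
    unfolding lists_1
    by (subst bounded_linear_imp_sum_axis[OF assms(6)]) (simp add: A_def axis_linear linear_scale[OF assms(6)])
  ultimately show "\<exists>A :: 7 list \<Rightarrow> 'a \<Rightarrow> 'b. (\<forall>l. linear (A l)) \<and>
     (\<forall>u. smooth_on U u \<and> (\<forall>y\<in>U. u y \<in> E) \<longrightarrow> L u x = (\<Sum>l | length l \<le> 1. A l (pds l u x))) \<and>
     \<Psi>1 (\<chi> i. \<xi> $ i *\<^sub>R v) = (\<Sum>l | length l = 1. (\<Prod>i\<leftarrow>l. \<xi> $ i) *\<^sub>R A l v)" by blast
next
  fix w assume "\<exists>A :: 7 list \<Rightarrow> 'a \<Rightarrow> 'b. (\<forall>l. linear (A l)) \<and>
     (\<forall>u. smooth_on U u \<and> (\<forall>y\<in>U. u y \<in> E) \<longrightarrow> L u x = (\<Sum>l | length l \<le> 1. A l (pds l u x))) \<and>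
     w = (\<Sum>l | length l = 1. (\<Prod>i\<leftarrow>l. \<xi> $ i) *\<^sub>R A l v)"
  then obtain A :: "7 list \<Rightarrow> 'a \<Rightarrow> 'b" where A: "\<And>l. linear (A l)"
    "\<And>u. smooth_on U u \<Longrightarrow> (\<forall>y\<in>U. u y \<in> E) \<Longrightarrow> L u x = (\<Sum>l | length l \<le> 1. A l (pds l u x))"
    "w = (\<Sum>l | length l = 1. (\<Prod>i\<leftarrow>l. \<xi> $ i) *\<^sub>R A l v)" by blast
  define u where "u = (\<lambda>z. (0 + \<xi> \<bullet> (z - x)) *\<^sub>R v)"
  have u: "smooth U u" "\<And>y. u y \<in> E"
    unfolding u_def using assms(1,3,4)
    by (auto intro!: smooth_scaleR smooth_linear_form smooth_const subspace_scale)
  have p: "pd i u = (\<lambda>z. \<xi> $ i *\<^sub>R v)" for i unfolding u_def by (rule pd_linear_form)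
  have ux: "u x = 0" by (simp add: u_def)
  have "w = L u x"
    unfolding A(3) A(2)[OF smooth_on_iff[OF assms(1), THEN iffD2, OF u(1)] ballI[OF u(2)]] lists_1 lists_le_1
    by (simp add: p ux linear_0[OF A(1)] linear_scale[OF A(1)])
  also have "\<dots> = \<Psi>1 (grad u x)" using L[OF u] by (simp add: ux linear_0[OF assms(5)])
  also have "grad u x = (\<chi> i. \<xi> $ i *\<^sub>R v)" by (simp add: grad_def p)
  finally show "w = \<Psi>1 (\<chi> i. \<xi> $ i *\<^sub>R v)" .
qed

lemma principal_symbol_2:
  fixes \<Psi>0 :: "'a::euclidean_space \<Rightarrow> 'b::real_normed_vector" and \<Psi>1 :: "'a^7 \<Rightarrow> 'b" and \<Psi>2 :: "'a^7^7 \<Rightarrow> 'b"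
  assumes "open U" "x \<in> U" "subspace E" "v \<in> E" "linear \<Psi>0" "linear \<Psi>1" "linear \<Psi>2"
    and L: "\<And>u. smooth U u \<Longrightarrow> (\<And>y. y \<in> U \<Longrightarrow> u y \<in> E) \<Longrightarrow> L u x = \<Psi>0 (u x) + \<Psi>1 (grad u x) + \<Psi>2 (hess u x)"
  shows "principal_symbol 2 U E L x \<xi> v = \<Psi>2 (\<chi> i j. (\<xi> $ i * \<xi> $ j) *\<^sub>R v)"
  unfolding principal_symbol_def
proof (rule the_equality)
  define A where "A = (\<lambda>l :: 7 list. if l = [] then \<Psi>0 else if length l = 1 then (\<lambda>v. \<Psi>1 (axis (hd l) v))
     else (\<lambda>v. \<Psi>2 (axis (hd l) (axis (hd (tl l)) v))))"
  have l2: "linear (\<lambda>w. \<Psi>2 (axis i w))" for i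
    by (rule linearI) (simp_all add: axis_linear linear_add[OF assms(7)] linear_scale[OF assms(7)])
  have "linear (\<lambda>v. \<Psi>1 (axis i v))" "linear (\<lambda>v. \<Psi>2 (axis i (axis j v)))" for i j
    by (rule linearI; simp add: axis_linear linear_add[OF assms(6)] linear_scale[OF assms(6)]
        linear_add[OF assms(7)] linear_scale[OF assms(7)])+
  then have "\<forall>l. linear (A l)" using assms(5) by (simp add: A_def)
  moreover have s2: "\<Psi>2 w = (\<Sum>i\<in>UNIV. \<Sum>j\<in>UNIV. \<Psi>2 (axis i (axis j (w $ i $ j))))" for w
    by (subst bounded_linear_imp_sum_axis[OF assms(7)], subst bounded_linear_imp_sum_axis[OF l2]) (rule refl)
  have "\<forall>u. smooth_on U u \<and> (\<forall>y\<in>U. u y \<in> E) \<longrightarrow> L u x = (\<Sum>l | length l \<le> 2. A l (pds l u x))"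
    unfolding lists_le_2 smooth_on_iff[OF assms(1)]
    using bounded_linear_imp_sum_axis[OF assms(6), of "grad _ _"] s2[of "hess _ _"]
    by (auto simp: A_def L grad_def hess_def)
  moreover have "\<Psi>2 (\<chi> i j. (\<xi> $ i * \<xi> $ j) *\<^sub>R v) = (\<Sum>l | length l = 2. (\<Prod>i\<leftarrow>l. \<xi> $ i) *\<^sub>R A l v)"
    unfolding lists_2 by (subst s2) (simp add: A_def axis_linear linear_scale[OF assms(7)])
  ultimately show "\<exists>A :: 7 list \<Rightarrow> 'a \<Rightarrow> 'b. (\<forall>l. linear (A l)) \<and>
     (\<forall>u. smooth_on U u \<and> (\<forall>y\<in>U. u y \<in> E) \<longrightarrow> L u x = (\<Sum>l | length l \<le> 2. A l (pds l u x))) \<and>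
     \<Psi>2 (\<chi> i j. (\<xi> $ i * \<xi> $ j) *\<^sub>R v) = (\<Sum>l | length l = 2. (\<Prod>i\<leftarrow>l. \<xi> $ i) *\<^sub>R A l v)" by blast
next
  fix w assume "\<exists>A :: 7 list \<Rightarrow> 'a \<Rightarrow> 'b. (\<forall>l. linear (A l)) \<and>
     (\<forall>u. smooth_on U u \<and> (\<forall>y\<in>U. u y \<in> E) \<longrightarrow> L u x = (\<Sum>l | length l \<le> 2. A l (pds l u x))) \<and>
     w = (\<Sum>l | length l = 2. (\<Prod>i\<leftarrow>l. \<xi> $ i) *\<^sub>R A l v)"
  then obtain A :: "7 list \<Rightarrow> 'a \<Rightarrow> 'b" where A: "\<And>l. linear (A l)"
    "\<And>u. smooth_on U u \<Longrightarrow> (\<forall>y\<in>U. u y \<in> E) \<Longrightarrow> L u x = (\<Sum>l | length l \<le> 2. A l (pds l u x))"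
    "w = (\<Sum>l | length l = 2. (\<Prod>i\<leftarrow>l. \<xi> $ i) *\<^sub>R A l v)" by blast
  \<comment> \<open>This field takes values in \<open>E\<close> and has vanishing 1-jet at
    \<open>x\<close>, so any admissible family of coefficients is forced to give the same
    value.\<close>
  define u where "u = (\<lambda>z. ((\<xi> \<bullet> (z - x))\<^sup>2 / 2) *\<^sub>R v)"
  have u: "smooth U u" "\<And>y. u y \<in> E"
    unfolding u_def power2_eq_square using assms(1,3,4)
    by (auto intro!: smooth_scaleR smooth_divide smooth_mult smooth_linear_form smooth_const subspace_scale)
  have p: "pd i u = (\<lambda>z. (0 + \<xi> \<bullet> (z - x)) *\<^sub>R (\<xi> $ i *\<^sub>R v))" for i
    unfolding u_def by (rule pd_quadratic_form)
  have pp: "pd i (pd j u) x = (\<xi> $ i * \<xi> $ j) *\<^sub>R v" for i j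
    unfolding p pd_linear_form by simp
  have ux: "u x = 0" "pd i u x = 0" for i by (simp add: u_def, simp add: p)
  have "w = L u x"
    unfolding A(3) A(2)[OF smooth_on_iff[OF assms(1), THEN iffD2, OF u(1)] ballI[OF u(2)]] lists_2 lists_le_2
    by (simp add: pp ux linear_0[OF A(1)] linear_scale[OF A(1)])
  also have "\<dots> = \<Psi>2 (hess u x)"
    using L[OF u] by (simp add: ux grad_def linear_0[OF assms(5)] linear_0[OF assms(6)] flip: zero_vec_def)
  also have "hess u x = (\<chi> i j. (\<xi> $ i * \<xi> $ j) *\<^sub>R v)" by (simp add: hess_def pp)
  finally show "w = \<Psi>2 (\<chi> i j. (\<xi> $ i * \<xi> $ j) *\<^sub>R v)" .
qed

section \<open>Leibniz rules, and \<open>to_pair\<close> as a linear map\<close>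

lemma frechet_linear_compose:
  assumes "bounded_linear L" "F differentiable (at x)"
  shows "frechet_derivative (\<lambda>x. L (F x)) (at x) k = L (frechet_derivative F (at x) k)"
  using fun_cong[OF frechet_derivative_at[OF bounded_linear.has_derivative[OF assms(1)
      assms(2)[unfolded frechet_derivative_works]]], of k] by simp

lemma pd_add:
  assumes "f differentiable (at y)" "g differentiable (at y)"
  shows "pd i (\<lambda>z. f z + g z) y = pd i f y + pd i g y"
  using fun_cong[OF frechet_derivative_at[OF has_derivative_add[OF assms[unfolded frechet_derivative_works]]], of "axis i 1"]
  unfolding pd_def by simp

lemma pd_scaleR:
  fixes f :: "vec7 \<Rightarrow> real"
  assumes "f differentiable (at y)" "g differentiable (at y)"
  shows "pd i (\<lambda>z. f z *\<^sub>R g z) y = pd i f y *\<^sub>R g y + f y *\<^sub>R pd i g y"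
  using fun_cong[OF frechet_derivative_at[OF has_derivative_scaleR[OF assms[unfolded frechet_derivative_works]]], of "axis i 1"]
  unfolding pd_def by (simp add: add.commute)

lemma pd_sum:
  assumes "\<And>b. b \<in> I \<Longrightarrow> f b differentiable (at y)"
  shows "pd i (\<lambda>z. \<Sum>b\<in>I. f b z) y = (\<Sum>b\<in>I. pd i (f b) y)"
  using fun_cong[OF frechet_derivative_at[OF has_derivative_sum[of I f "\<lambda>b. frechet_derivative (f b) (at y)" "at y"]], of "axis i 1"]
    assms unfolding pd_def frechet_derivative_works by simp

text \<open>Alternation is a linear condition satisfied along the whole line, hence inherited by the
  derivative. It is what entitles \<open>to_pair\<close> to be applied to a linearization.\<close>

lemma alternating3_derivative:
  assumes "F differentiable (at x)" "\<And>s::real. alternating3 (F (x + s *\<^sub>R k))"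
  shows "alternating3 (frechet_derivative F (at x) k)"
proof -
  have zero: "L (frechet_derivative F (at x) k) = 0"
    if L: "bounded_linear L" and 0: "\<And>t. alternating3 t \<Longrightarrow> L t = 0" for L :: "ten3 \<Rightarrow> real"
  proof -
    have "(\<lambda>x. L (F x)) differentiable (at x)"
      using differentiable_chain_at[OF assms(1) bounded_linear_imp_differentiable[OF L]] by (simp add: o_def)
    moreover have "L (F (x + s *\<^sub>R k)) = L (F x) + s *\<^sub>R 0" for s
      using 0[OF assms(2)[of s]] 0[OF assms(2)[of 0]] by simp
    ultimately show ?thesis using affine_path_derivative[of "\<lambda>x. L (F x)" x k 0]
      by (simp add: frechet_linear_compose[OF L assms(1)])
  qed
  have n: "bounded_linear (\<lambda>t::ten3. t $ i $ j $ k)" for i j k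
    by (intro bounded_linear_compose[OF bounded_linear_vec_nth] bounded_linear_vec_nth)
  let ?d = "frechet_derivative F (at x) k"
  have "?d $ i $ j $ k + ?d $ j $ i $ k = 0" for i j k
    by (rule zero[OF bounded_linear_add[OF n n]]) (simp add: alternating3D(1)[of _ i j k])
  moreover have "?d $ i $ j $ k + ?d $ i $ k $ j = 0" for i j k
    by (rule zero[OF bounded_linear_add[OF n n]]) (simp add: alternating3D(2)[of _ i j k])
  ultimately show ?thesis unfolding alternating3_def by (simp add: eq_neg_iff_add_eq_0)
qed

lemma subspace_sym_pairs: "subspace sym_pairs"
  unfolding subspace_def sym_pairs_def by (auto simp: transpose_def vec_eq_iff zero_prod_def)

text \<open>The description \<open>to_pair\<close> is only controlled on alternating tensors,
  whereas the coefficients in a principal symbol must be linear everywhere. A linear left inverse of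
  \<open>of_pair\<close> on the symmetric pairs agrees with it where it matters.\<close>

lemma to_pair_linear:
  assumes "alternating3 p" "nondegenerate p"
  obtains g where "linear g" "\<And>\<omega>. alternating3 \<omega> \<Longrightarrow> to_pair p \<omega> = g \<omega>"
    "\<And>u. u \<in> sym_pairs \<Longrightarrow> g (of_pair p u) = u"
proof -
  have "inj_on (of_pair p) sym_pairs" using of_pair_inj[OF assms] by (intro inj_onI) auto
  then obtain g where g: "linear g" "\<forall>u\<in>sym_pairs. g (of_pair p u) = u"
    using real_vector.linear_exists_left_inverse_on[OF linear_of_pair subspace_sym_pairs] by blast
  have "to_pair p \<omega> = g \<omega>" if "alternating3 \<omega>" for \<omega>
  proof (rule of_pair_surj[OF assms that])
    fix h X assume *: "transpose h = h" "of_pair p (h, X) = \<omega>"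
    then have "(h, X) \<in> sym_pairs" by (simp add: sym_pairs_def)
    then show ?thesis using to_pair_of_pair[OF assms, of "(h, X)"] g(2) *(2) by metis
  qed
  then show ?thesis using that g by blast
qed

section \<open>Linearization of an operator given by a function of 2-jets\<close>

context G2_germ
begin

lemma smooth_along: "smooth {p. nondegenerate p} F \<Longrightarrow> smooth V (\<lambda>z. F (\<phi> z))"
  by (rule smooth_compose[OF _ sm]) (auto simp: nd)

lemma smooth_of_pair: assumes "smooth V u" shows "smooth V (\<lambda>z. of_pair (\<phi> z) (u z))"
  unfolding of_pair_def
  by (intro smooth_add smooth_diamond smooth_hook_psi opn sm smooth_along[OF smooth_ginv] smooth_along[OF smooth_psi]
      smooth_linear[OF bounded_linear_fst assms] smooth_linear[OF bounded_linear_snd assms])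

text \<open>Nondegeneracy at the single point \<open>y\<close> holds for all small \<open>s\<close>
  by openness and then spreads to a neighbourhood of \<open>y\<close> by continuity.\<close>

lemma perturbation:
  assumes \<eta>: "smooth V \<eta>" "\<And>z. z \<in> V \<Longrightarrow> alternating3 (\<eta> z)" and y: "y \<in> V"
  obtains \<epsilon> :: real where "\<epsilon> > 0"
    "\<And>s. \<bar>s\<bar> < \<epsilon> \<Longrightarrow> \<exists>W. y \<in> W \<and> G2_germ W (\<lambda>z. \<phi> z + s *\<^sub>R \<eta> z)"
proof -
  obtain d where d: "d > 0" "ball (\<phi> y) d \<subseteq> {p. nondegenerate p}"
    using open_nondegenerate nd[OF y] open_contains_ball by blast
  show ?thesis
  \<comment> \<open>The added 1 keeps the bound meaningful when \<open>\<eta> y = 0\<close>.\<close>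
  proof (rule that[of "d / (1 + norm (\<eta> y))"])
    show "d / (1 + norm (\<eta> y)) > 0" using d(1) by (simp add: add_pos_nonneg)
    fix s :: real assume s: "\<bar>s\<bar> < d / (1 + norm (\<eta> y))"
    let ?f = "\<lambda>z. \<phi> z + s *\<^sub>R \<eta> z"
    have f: "smooth V ?f" by (intro smooth_add sm smooth_linear[OF bounded_linear_scaleR_right] \<eta>)
    have "continuous_on V ?f"
      using smooth_differentiable[OF f] by (intro differentiable_imp_continuous_on)
        (simp add: differentiable_on_def differentiable_at_withinI)
    then have W: "open (V \<inter> ?f -` {p. nondegenerate p})"
      by (rule continuous_open_preimage[OF _ opn open_nondegenerate])
    have "\<bar>s\<bar> * (1 + norm (\<eta> y)) < d" using s by (simp add: pos_less_divide_eq add_pos_nonneg)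
    then have "norm (s *\<^sub>R \<eta> y) < d" by (simp add: algebra_simps)
    then have "?f y \<in> ball (\<phi> y) d" by (simp add: dist_norm)
    then have "y \<in> V \<inter> ?f -` {p. nondegenerate p}" using d(2) y by auto
    moreover have "G2_germ (V \<inter> ?f -` {p. nondegenerate p}) ?f"
      unfolding G2_germ_def G2_form_on_def
      using W smooth_on_iff[OF W] smooth_subset[OF f W] alt \<eta>(2)
      by (auto intro!: alternating3_add alternating3_scaleR)
    ultimately show "\<exists>W. y \<in> W \<and> G2_germ W ?f" by (intro exI conjI)
  qed
qed

text \<open>Taking jets is linear, so the varied structure traces a straight line in jet space, and
  the linearization is the derivative of \<open>Fh\<close> along it.\<close>

lemma linearization_jet:
  assumes F: "smooth jets2 Fh"
    and eq: "\<And>W \<psi>. G2_germ W \<psi> \<Longrightarrow> y \<in> W \<Longrightarrow> F \<psi> y = Fh (\<psi> y, grad \<psi> y, hess \<psi> y)"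
    and u: "smooth V u" and y: "y \<in> V"
  defines "\<eta> \<equiv> \<lambda>z. of_pair (\<phi> z) (u z)"
  shows "linearization F \<phi> u y = frechet_derivative Fh (at (\<phi> y, grad \<phi> y, hess \<phi> y)) (\<eta> y, grad \<eta> y, hess \<eta> y)"
proof -
  have \<eta>: "smooth V \<eta>" unfolding \<eta>_def by (rule smooth_of_pair[OF u])
  have alt\<eta>: "alternating3 (\<eta> z)" if "z \<in> V" for z
    unfolding \<eta>_def by (rule of_pair_alternating[OF alt[OF that]])
  obtain \<epsilon> :: real where \<epsilon>: "\<epsilon> > 0" "\<And>s. \<bar>s\<bar> < \<epsilon> \<Longrightarrow> \<exists>W. y \<in> W \<and> G2_germ W (\<lambda>z. \<phi> z + s *\<^sub>R \<eta> z)"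
    using perturbation[OF \<eta> alt\<eta> y] by blast
  let ?x = "(\<phi> y, grad \<phi> y, hess \<phi> y)" and ?k = "(\<eta> y, grad \<eta> y, hess \<eta> y)"
  have pd1: "pd i (\<lambda>z. f z + s *\<^sub>R h z) z = pd i f z + s *\<^sub>R pd i h z"
    if "smooth V f" "smooth V h" "z \<in> V" for f h :: "vec7 \<Rightarrow> ten3" and s i z
    using pd_add[of f z "\<lambda>z. s *\<^sub>R h z" i] pd_linear[OF bounded_linear_scaleR_right, of h z i s]
      smooth_differentiable[OF that(1,3)] smooth_differentiable[OF that(2,3)]
      smooth_differentiable[OF smooth_linear[OF bounded_linear_scaleR_right that(2)] that(3)] by simp
  have jet: "((\<phi> y + s *\<^sub>R \<eta> y), grad (\<lambda>z. \<phi> z + s *\<^sub>R \<eta> z) y, hess (\<lambda>z. \<phi> z + s *\<^sub>R \<eta> z) y) = ?x + s *\<^sub>R ?k" for s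
  proof -
    have g: "pd j (\<lambda>z. \<phi> z + s *\<^sub>R \<eta> z) z = pd j \<phi> z + s *\<^sub>R pd j \<eta> z" if "z \<in> V" for j z
      by (rule pd1[OF sm \<eta> that])
    have "pd i (pd j (\<lambda>z. \<phi> z + s *\<^sub>R \<eta> z)) y = pd i (\<lambda>z. pd j \<phi> z + s *\<^sub>R pd j \<eta> z) y" for i j
      using smooth_differentiable[OF smooth_add[OF smooth_pd[OF sm] smooth_linear[OF bounded_linear_scaleR_right smooth_pd[OF \<eta>]]] y]
      by (intro pd_cong[OF opn y g])
    also have "\<dots> i j = pd i (pd j \<phi>) y + s *\<^sub>R pd i (pd j \<eta>) y" for i j
      by (rule pd1[OF smooth_pd[OF sm] smooth_pd[OF \<eta>] y])
    finally show ?thesis by (simp add: grad_def hess_def g[OF y] vec_eq_iff)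
  qed
  have xV: "?x \<in> jets2" using nd[OF y] by simp
  have "((\<lambda>s::real. ?x + s *\<^sub>R ?k) has_derivative (\<lambda>s. s *\<^sub>R ?k)) (at 0)"
    by (auto intro!: derivative_eq_intros)
  moreover have "(Fh has_derivative frechet_derivative Fh (at ?x)) (at (?x + (0::real) *\<^sub>R ?k))"
    using smooth_has_derivative[OF F xV] by simp
  ultimately have "((\<lambda>s::real. Fh (?x + s *\<^sub>R ?k)) has_derivative (\<lambda>s. frechet_derivative Fh (at ?x) (s *\<^sub>R ?k))) (at 0)"
    by (rule has_derivative_compose)
  then have d: "((\<lambda>s::real. Fh (?x + s *\<^sub>R ?k)) has_vector_derivative frechet_derivative Fh (at ?x) ?k) (at 0)"
    unfolding has_vector_derivative_def
    using linear_scale[OF linear_frechet_derivative[OF smooth_differentiable[OF F xV]]] by (simp only:)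
  have e: "Fh (?x + s *\<^sub>R ?k) = F (\<lambda>z. \<phi> z + s *\<^sub>R \<eta> z) y" if "s \<in> {- \<epsilon><..<\<epsilon>}" for s
  proof -
    have "\<bar>s\<bar> < \<epsilon>" using that by auto
    then obtain W where "y \<in> W" "G2_germ W (\<lambda>z. \<phi> z + s *\<^sub>R \<eta> z)" using \<epsilon>(2) by blast
    from eq[OF this(2,1)] show ?thesis unfolding jet[symmetric] by simp
  qed
  have "((\<lambda>s. F (\<lambda>z. \<phi> z + s *\<^sub>R \<eta> z) y) has_vector_derivative frechet_derivative Fh (at ?x) ?k) (at 0)"
  proof (rule has_vector_derivative_transform_within_open[OF d])
    show "open {- \<epsilon><..<\<epsilon>}" "0 \<in> {- \<epsilon><..<\<epsilon>}" using \<epsilon>(1) by simp_all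
  qed (rule e)
  then show ?thesis unfolding linearization_def \<eta>_def by (rule vector_derivative_at)
qed

text \<open>The 2-jet of \<open>h \<diamondop> \<phi> + X \<lrcorner> \<psi>\<close> is linear in the 2-jet of \<open>(h, X)\<close>, by the Leibniz rule.\<close>

definition "coef b z = of_pair (\<phi> z) b"

definition "jet_part0 y w = ((\<Sum>b\<in>Basis. (w \<bullet> b) *\<^sub>R coef b y), (\<chi> i. \<Sum>b\<in>Basis. (w \<bullet> b) *\<^sub>R pd i (coef b) y),
   (\<chi> i j. \<Sum>b\<in>Basis. (w \<bullet> b) *\<^sub>R pd i (pd j (coef b)) y))"

definition "jet_part1 y w = ((0::ten3), (\<chi> i. \<Sum>b\<in>Basis. (w $ i \<bullet> b) *\<^sub>R coef b y),
   (\<chi> i j. \<Sum>b\<in>Basis. (w $ j \<bullet> b) *\<^sub>R pd i (coef b) y + (w $ i \<bullet> b) *\<^sub>R pd j (coef b) y))"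

definition "jet_part2 y w = ((0::ten3), (0::ten4), (\<chi> i j. of_pair (\<phi> y) (w $ i $ j)))"

lemma linear_jet_part0: "linear (jet_part0 y)"
  by (rule linearI)
     (simp_all add: jet_part0_def vec_eq_iff inner_add_left distrib_right scaleR_add_left sum.distrib
       scaleR_right.sum sum_distrib_left mult_ac)

lemma linear_jet_part1: "linear (jet_part1 y)"
  by (rule linearI)
     (simp_all add: jet_part1_def vec_eq_iff inner_add_left distrib_right scaleR_add_left sum.distrib
       scaleR_right.sum sum_distrib_left distrib_left mult_ac)

lemma linear_jet_part2: "linear (jet_part2 y)"
  by (rule linearI)
     (simp_all add: jet_part2_def linear_add[OF linear_of_pair] linear_scale[OF linear_of_pair] vec_eq_iff)

lemma coef_sum: "of_pair (\<phi> z) w = (\<Sum>b\<in>Basis. (w \<bullet> b) *\<^sub>R coef b z)"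
proof -
  have "of_pair (\<phi> z) (\<Sum>b\<in>Basis. (w \<bullet> b) *\<^sub>R b) = (\<Sum>b\<in>Basis. (w \<bullet> b) *\<^sub>R coef b z)"
    by (simp add: linear_sum[OF linear_of_pair] linear_scale[OF linear_of_pair] coef_def)
  then show ?thesis by (simp add: euclidean_representation)
qed

lemma jet_of_pair:
  assumes u: "smooth V u" and y: "y \<in> V"
  defines "\<eta> \<equiv> \<lambda>z. of_pair (\<phi> z) (u z)"
  shows "(\<eta> y, grad \<eta> y, hess \<eta> y) = jet_part0 y (u y) + jet_part1 y (grad u y) + jet_part2 y (hess u y)"
proof -
  have E: "smooth V (coef b)" for b
    unfolding coef_def[abs_def] by (intro smooth_of_pair smooth_const opn)
  have leib: "pd i (\<lambda>z. (w z \<bullet> b) *\<^sub>R f z) z = (pd i w z \<bullet> b) *\<^sub>R f z + (w z \<bullet> b) *\<^sub>R pd i f z"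
    if "smooth V w" "smooth V f" "z \<in> V" for w :: "vec7 \<Rightarrow> pair7" and f :: "vec7 \<Rightarrow> ten3" and b i z
    using pd_scaleR[OF smooth_differentiable[OF smooth_linear[OF bounded_linear_inner_left that(1)] that(3)]
        smooth_differentiable[OF that(2,3)], of i b]
      pd_linear[OF bounded_linear_inner_left smooth_differentiable[OF that(1,3)], of i b] by simp
  have sm1: "smooth V (\<lambda>z. (w z \<bullet> b) *\<^sub>R f z)" if "smooth V w" "smooth V f"
    for w :: "vec7 \<Rightarrow> pair7" and f :: "vec7 \<Rightarrow> ten3" and b
    by (intro smooth_scaleR smooth_linear[OF bounded_linear_inner_left that(1)] that(2))
  have sd: "(\<lambda>z. (w z \<bullet> b) *\<^sub>R f z) differentiable (at z)" if "smooth V w" "smooth V f" "z \<in> V"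
    for w :: "vec7 \<Rightarrow> pair7" and f :: "vec7 \<Rightarrow> ten3" and b z
    using smooth_differentiable[OF sm1[OF that(1,2)] that(3)] .
  have \<eta>: "\<eta> = (\<lambda>z. \<Sum>b\<in>Basis. (u z \<bullet> b) *\<^sub>R coef b z)" unfolding \<eta>_def using coef_sum by blast
  have 1: "pd j \<eta> z = (\<Sum>b\<in>Basis. (pd j u z \<bullet> b) *\<^sub>R coef b z + (u z \<bullet> b) *\<^sub>R pd j (coef b) z)" if "z \<in> V" for j z
    unfolding \<eta> by (subst pd_sum) (auto simp: leib[OF u E that] sd[OF u E that])
  have s2: "smooth V (\<lambda>z. (pd j u z \<bullet> b) *\<^sub>R coef b z + (u z \<bullet> b) *\<^sub>R pd j (coef b) z)" for j b
    by (intro smooth_add sm1 smooth_pd u E)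
  have 2: "pd i (pd j \<eta>) y = (\<Sum>b\<in>Basis. (pd i (pd j u) y \<bullet> b) *\<^sub>R coef b y + (pd j u y \<bullet> b) *\<^sub>R pd i (coef b) y
     + ((pd i u y \<bullet> b) *\<^sub>R pd j (coef b) y + (u y \<bullet> b) *\<^sub>R pd i (pd j (coef b)) y))" for i j
  proof -
    have "pd i (pd j \<eta>) y = pd i (\<lambda>z. \<Sum>b\<in>Basis. (pd j u z \<bullet> b) *\<^sub>R coef b z + (u z \<bullet> b) *\<^sub>R pd j (coef b) z) y"
      by (rule pd_cong[OF opn y 1]) (auto intro!: smooth_differentiable[OF _ y] smooth_sum opn s2)
    also have "\<dots> = (\<Sum>b\<in>Basis. pd i (\<lambda>z. (pd j u z \<bullet> b) *\<^sub>R coef b z + (u z \<bullet> b) *\<^sub>R pd j (coef b) z) y)"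
      by (rule pd_sum) (rule smooth_differentiable[OF s2 y])
    finally show ?thesis
      by (simp add: pd_add[OF sd[OF smooth_pd[OF u] E y] sd[OF u smooth_pd[OF E] y]]
          leib[OF smooth_pd[OF u] E y] leib[OF u smooth_pd[OF E] y])
  qed
  show ?thesis
    unfolding grad_def hess_def jet_part0_def jet_part1_def jet_part2_def coef_sum
    using fun_cong[OF \<eta>, of y]
    by (simp add: 1[OF y] 2 vec_eq_iff sum.distrib algebra_simps)
qed

end

text \<open>A total derivative is affine in the second-order variable, with slope \<open>F p\<close>
  when \<open>F\<close> is linear in first derivatives. Second-order symbols are reduced to
  first-order ones in this way.\<close>

lemma total_shift:
  assumes F: "smooth jets1 (\<lambda>w. F (fst w) (snd w))" and p: "nondegenerate p" and lin: "linear (F p)"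
  shows "total F i (p, q, r + s *\<^sub>R r') = total F i (p, q, r) + s *\<^sub>R F p (r' $ i)"
proof -
  let ?G = "\<lambda>w. F (fst w) (snd w)"
  have d: "?G differentiable (at (p, q))" using smooth_differentiable[OF F] p by simp
  note l = linear_frechet_derivative[OF d]
  have "frechet_derivative ?G (at (p, q)) (0, w) = F p w" for w
    by (rule affine_path_derivative[OF d]) (simp add: linear_add[OF lin] linear_scale[OF lin])
  moreover have "(q $ i, (r + s *\<^sub>R r') $ i) = (q $ i, r $ i) + s *\<^sub>R (0, r' $ i)" by simp
  ultimately show ?thesis
    unfolding total_def fst_conv snd_conv by (simp only: linear_add[OF l] linear_scale[OF l])
qed

lemma linear_christoffel_jet: assumes "nondegenerate p" shows "linear (christoffel_jet p)"
  by (rule linearI)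
     (simp_all add: vec_eq_iff christoffel_jet_def linear_add[OF linear_metric_derivative[OF assms]]
       linear_scale[OF linear_metric_derivative[OF assms]] algebra_simps sum.distrib sum_subtractf
       sum_distrib_left)

lemma linear_unhook: "linear (unhook p)"
  by (rule linearI)
     (simp_all add: vec_eq_iff unhook_def linear_add[OF linear_act] linear_scale[OF linear_act] inner_add_right add_divide_distrib)

lemma linear_der: "linear (\<lambda>K. der K p)"
  by (rule linearI) (simp_all add: vec_eq_iff der_nth distrib_right sum.distrib sum_distrib_left distrib_left mult_ac)

lemma linear_torsion_jet: assumes "nondegenerate p" shows "linear (torsion_jet p)"
proof -
  note c = linear_christoffel_jet[OF assms]
  have 1: "(\<chi> i r. christoffel_jet p (q + q') $ r $ m $ i) =
      (\<chi> i r. christoffel_jet p q $ r $ m $ i) + (\<chi> i r. christoffel_jet p q' $ r $ m $ i)" for q q' m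
    by (simp add: vec_eq_iff linear_add[OF c])
  have 2: "(\<chi> i r. christoffel_jet p (a *\<^sub>R q) $ r $ m $ i) = a *\<^sub>R (\<chi> i r. christoffel_jet p q $ r $ m $ i)" for a q m
    by (simp add: vec_eq_iff linear_scale[OF c])
  show ?thesis
  proof (rule linearI)
    show "torsion_jet p (q + q') = torsion_jet p q + torsion_jet p q'" for q q'
      by (simp add: torsion_jet_def 1 linear_add[OF linear_der] linear_diff[OF linear_unhook] linear_add[OF linear_unhook] vec_eq_iff)
    show "torsion_jet p (a *\<^sub>R q) = a *\<^sub>R torsion_jet p q" for a q
      by (simp add: torsion_jet_def 2 linear_scale[OF linear_der] linear_scale[OF linear_unhook] vec_eq_iff
          flip: scaleR_diff_right)
  qed
qed

lemma linear_VT_jet: "nondegenerate p \<Longrightarrow> linear (VT_jet p)"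
  unfolding VT_jet_def[abs_def]
  using linear_compose[OF linear_torsion_jet linear_contract2] by (simp add: o_def)

lemma linear_sharp_jet: "nondegenerate p \<Longrightarrow> linear (sharp_jet p)"
  unfolding sharp_jet_def[abs_def]
  using linear_compose[OF linear_VT_jet matrix_vector_mul_linear] by (simp add: o_def)

lemma G2_jet_alternating: "alternating3 (fst x) \<Longrightarrow> alternating3 (G2_jet a b1 b2 x)"
  unfolding G2_jet_def by (intro alternating3_add diamond_alternating hook_psi_alternating)

subsection \<open>The principal symbols\<close>

definition mom :: "ten3 \<Rightarrow> vec7 \<Rightarrow> ten2 \<Rightarrow> vec7" where
  "mom p \<xi> h = h *v (ginv p *v \<xi>)"

definition VT_symbol :: "ten3 \<Rightarrow> vec7 \<Rightarrow> pair7 \<Rightarrow> vec7" where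
  "VT_symbol p \<xi> u = cross p \<xi> (snd u) + (ginv p \<bullet> fst u) *\<^sub>R \<xi> - mom p \<xi> (fst u)"

definition B_symbol :: "ten3 \<Rightarrow> real \<Rightarrow> vec7 \<Rightarrow> pair7 \<Rightarrow> vec7" where
  "B_symbol p a \<xi> u = mom p \<xi> (fst u) - (1/2 * (ginv p \<bullet> fst u)) *\<^sub>R \<xi> - a *\<^sub>R VT_symbol p \<xi> u"

text \<open>In the first component all terms other than the multiple of \<open>h\<close> are
  symmetrized products with \<xi>. Half of the trace term of the Ricci symbol goes to each side,
  which is the origin of the 1/2 in \<open>B_symbol\<close>.\<close>

definition DP_symbol :: "ten3 \<Rightarrow> real \<Rightarrow> real \<Rightarrow> real \<Rightarrow> vec7 \<Rightarrow> pair7 \<Rightarrow> pair7" where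
  "DP_symbol p a b1 b2 \<xi> u =
    (ip p \<xi> \<xi> *\<^sub>R fst u - (outer \<xi> (B_symbol p a \<xi> u) + outer (B_symbol p a \<xi> u) \<xi>),
     b1 *\<^sub>R (cross p \<xi> (mom p \<xi> (fst u)) + ip p \<xi> \<xi> *\<^sub>R snd u) + (b2 * ip p \<xi> (snd u)) *\<^sub>R \<xi>)"

lemma DP_symbol_sym:
  assumes "u \<in> sym_pairs" shows "DP_symbol p a b1 b2 \<xi> u \<in> sym_pairs"
proof -
  have "transpose (fst u) = fst u" using assms by (auto simp: sym_pairs_def)
  note s = symD[OF this]
  show ?thesis
    unfolding sym_pairs_def DP_symbol_def
    by (simp add: vec_eq_iff transpose_def outer_def) (use s in blast)
qed

locale covector =
  fixes p :: ten3 and \<xi> :: vec7 and h :: ten2 and X :: vec7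
  assumes p: "alternating3 p" "nondegenerate p" and h: "transpose h = h"
begin

text \<open>The formal first and second derivatives of the variation, each partial derivative
  replaced by a component of \<xi>.\<close>

definition "qs = (\<chi> j. \<xi> $ j *\<^sub>R of_pair p (h, X))"
definition "rs = (\<chi> i j. (\<xi> $ i * \<xi> $ j) *\<^sub>R of_pair p (h, X))"

lemma rs_nth: "rs $ i = \<xi> $ i *\<^sub>R qs"
  by (simp add: rs_def qs_def vec_eq_iff)

lemma qs_pair: "qs $ i = of_pair p (\<xi> $ i *\<^sub>R h, \<xi> $ i *\<^sub>R X)"
  using linear_scale[OF linear_of_pair, of p "\<xi> $ i" "(h, X)"] by (simp add: qs_def)

lemma h_scaled: "transpose (c *\<^sub>R h) = c *\<^sub>R h"
  by (simp add: transpose_scalar h)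

text \<open>The skew tensor in \<open>torsion_jet_eq\<close> becomes the antisymmetrized product of
  \<xi> and \<open>h $ m\<close>; both of its halves give the same cross product, which cancels the
  factor 1/2.\<close>

lemma torsion_symbol: "torsion_jet p qs $ m = \<xi> $ m *\<^sub>R X + cross p \<xi> (h $ m)"
proof -
  have "(\<chi> i j. (\<xi> $ i *\<^sub>R h) $ m $ j - (\<xi> $ j *\<^sub>R h) $ m $ i) = outer \<xi> (h $ m) - outer (h $ m) \<xi>"
    by (simp add: vec_eq_iff outer_def)
  then have "contract2 p (\<chi> i j. (\<xi> $ i *\<^sub>R h) $ m $ j - (\<xi> $ j *\<^sub>R h) $ m $ i) = cross p \<xi> (h $ m) - cross p (h $ m) \<xi>"
    by (simp add: cross_def linear_diff[OF linear_contract2])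
  also have "\<dots> = 2 *\<^sub>R cross p \<xi> (h $ m)"
    by (subst (2) cross_commute[OF p(1)]) (simp add: scaleR_2)
  finally show ?thesis
    using torsion_jet_eq[OF p, of "\<lambda>i. \<xi> $ i *\<^sub>R h" qs "\<lambda>i. \<xi> $ i *\<^sub>R X" m, OF h_scaled qs_pair] by simp
qed

lemma VT_jet_symbol: "VT_jet p qs = VT_symbol p \<xi> (h, X)"
proof -
  have "torsion_jet p qs = outer \<xi> X + (\<chi> m. cross p \<xi> (h $ m))"
    by (simp add: vec_eq_iff torsion_symbol outer_def)
  then show ?thesis
    unfolding VT_jet_def VT_symbol_def mom_def
    by (simp add: linear_add[OF linear_contract2] contract2_cross[OF p h] cross_def[of p \<xi> X])
qed

lemma christoffel_symbol:
  "christoffel_jet p qs $ k $ i $ j = \<xi> $ i * (ginv p *v h $ j) $ k + \<xi> $ j * (ginv p *v h $ i) $ k - (ginv p *v \<xi>) $ k * h $ i $ j"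
proof -
  have D: "frechet_derivative metric (at p) (qs $ i) = 2 *\<^sub>R (\<xi> $ i *\<^sub>R h)" for i
    unfolding qs_pair by (rule metric_derivative_of_pair[OF p h_scaled])
  show ?thesis
    by (simp add: christoffel_jet_def D matrix_vector_mult_def sum_distrib_left sum_distrib_right sum.distrib
        sum_subtractf algebra_simps)
qed

lemma row_inner: "(h *v x) $ k = h $ k \<bullet> x"
  by (simp add: matrix_vector_mult_def inner_vec_def)

lemma mom_nth: "\<xi> \<bullet> (ginv p *v h $ k) = mom p \<xi> h $ k" "(\<Sum>i\<in>UNIV. (ginv p *v \<xi>) $ i * h $ i $ k) = mom p \<xi> h $ k"
proof -
  show "\<xi> \<bullet> (ginv p *v h $ k) = mom p \<xi> h $ k"
    using ip_commute[OF p(2), of \<xi> "h $ k"] by (simp add: ip_def mom_def row_inner)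
  show "(\<Sum>i\<in>UNIV. (ginv p *v \<xi>) $ i * h $ i $ k) = mom p \<xi> h $ k"
    by (simp add: mom_def row_inner inner_vec_def symD[OF h, of _ k] mult.commute)
qed

text \<open>Products of Christoffel symbols see only the 1-jet and do not change; the shift of the
  two total derivatives is given by \<open>total_shift\<close>.\<close>

lemma ricci_shift:
  "ricci_jet (p, q, r + s *\<^sub>R rs) = ricci_jet (p, q, r) + s *\<^sub>R (outer \<xi> (mom p \<xi> h) + outer (mom p \<xi> h) \<xi>
     - ip p \<xi> \<xi> *\<^sub>R h - (ginv p \<bullet> h) *\<^sub>R outer \<xi> \<xi>)"
proof -
  note c = linear_christoffel_jet[OF p(2)]
  have t: "total christoffel_jet i (p, q, r + s *\<^sub>R rs) = total christoffel_jet i (p, q, r) + s *\<^sub>R (\<xi> $ i *\<^sub>R christoffel_jet p qs)" for i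
    by (simp add: total_shift[OF smooth_christoffel_jet p(2) c] rs_nth linear_scale[OF c])
  have a: "(\<Sum>i\<in>UNIV. \<xi> $ i * christoffel_jet p qs $ i $ j $ k) =
      \<xi> $ j * mom p \<xi> h $ k + \<xi> $ k * mom p \<xi> h $ j - ip p \<xi> \<xi> * h $ j $ k" for j k
    unfolding christoffel_symbol mom_nth(1)[symmetric] ip_def inner_vec_def inner_real_def
    by (simp add: algebra_simps sum.distrib sum_subtractf sum_distrib_left)
  have "(\<Sum>i\<in>UNIV. (ginv p *v h $ i) $ i) = ginv p \<bullet> h"
    by (simp add: inner_vec_def matrix_vector_mult_def)
  then have b: "(\<Sum>i\<in>UNIV. christoffel_jet p qs $ i $ i $ k) = \<xi> $ k * (ginv p \<bullet> h)" for k
    using mom_nth(1)[of k] mom_nth(2)[of k] unfolding christoffel_symbol inner_vec_def inner_real_def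
    by (simp add: sum.distrib sum_subtractf sum_distrib_left[symmetric])
  have "(\<Sum>i\<in>UNIV. total christoffel_jet i (p, q, r + s *\<^sub>R rs) $ i $ j $ k - total christoffel_jet j (p, q, r + s *\<^sub>R rs) $ i $ i $ k) =
     (\<Sum>i\<in>UNIV. total christoffel_jet i (p, q, r) $ i $ j $ k - total christoffel_jet j (p, q, r) $ i $ i $ k)
     + s * ((\<Sum>i\<in>UNIV. \<xi> $ i * christoffel_jet p qs $ i $ j $ k) - \<xi> $ j * (\<Sum>i\<in>UNIV. christoffel_jet p qs $ i $ i $ k))" for j k
    by (simp add: t sum.distrib sum_subtractf sum_distrib_left algebra_simps)
  then show ?thesis
    unfolding ricci_jet_def a b
    by (simp add: vec_eq_iff outer_def algebra_simps)
qed

text \<open>Second derivatives enter through the derivatives of the vector field alone, and the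
  metric lowers its index back to the covector \<open>VT_symbol\<close>.\<close>

lemma lie_shift:
  "lie_jet (p, q, r + s *\<^sub>R rs) = lie_jet (p, q, r) + s *\<^sub>R (outer \<xi> (VT_symbol p \<xi> (h, X)) + outer (VT_symbol p \<xi> (h, X)) \<xi>)"
proof -
  note c = linear_sharp_jet[OF p(2)]
  let ?W = "sharp_jet p qs"
  have t: "total sharp_jet i (p, q, r + s *\<^sub>R rs) = total sharp_jet i (p, q, r) + s *\<^sub>R (\<xi> $ i *\<^sub>R ?W)" for i
    by (simp add: total_shift[OF smooth_sharp_jet p(2) c] rs_nth linear_scale[OF c])
  have gW: "metric p *v ?W = VT_symbol p \<xi> (h, X)"
    by (simp add: sharp_jet_def matrix_vector_mul_assoc ginv_inverse[OF p(2)] VT_jet_symbol)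
  have W: "(\<Sum>m\<in>UNIV. metric p $ i $ m * ?W $ m) = VT_symbol p \<xi> (h, X) $ i" for i
    using arg_cong[OF gW, of "\<lambda>v. v $ i"] by (simp only: matrix_vector_mult_def vec_lambda_beta)
  have W': "(\<Sum>m\<in>UNIV. metric p $ m $ i * ?W $ m) = VT_symbol p \<xi> (h, X) $ i" for i
    unfolding W[symmetric] by (intro sum.cong refl) (subst symD[OF metric_sym[OF p(2)]], rule refl)
  have "lie_jet (p, q, r + s *\<^sub>R rs) $ i $ j = lie_jet (p, q, r) $ i $ j
     + s * (\<xi> $ i * (\<Sum>m\<in>UNIV. metric p $ m $ j * ?W $ m) + \<xi> $ j * (\<Sum>m\<in>UNIV. metric p $ i $ m * ?W $ m))" for i j
    by (simp add: lie_jet_def t sum.distrib sum_distrib_left algebra_simps)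
  then show ?thesis
    unfolding W W' by (simp add: vec_eq_iff outer_def algebra_simps)
qed

lemma torsion_total: "total torsion_jet i (p, q, r + s *\<^sub>R rs) = total torsion_jet i (p, q, r) + s *\<^sub>R (\<xi> $ i *\<^sub>R torsion_jet p qs)"
  by (simp add: total_shift[OF smooth_torsion_jet p(2) linear_torsion_jet[OF p(2)]] rs_nth
      linear_scale[OF linear_torsion_jet[OF p(2)]])

lemma sharp_sum: "(\<Sum>i\<in>UNIV. ginv p $ i $ j * \<xi> $ i) = (ginv p *v \<xi>) $ j"
  unfolding matrix_vector_mult_def vec_lambda_beta
  by (intro sum.cong refl) (subst symD[OF ginv_sym[OF p(2)]], rule refl)

lemma div_shift:
  "div_jet (p, q, r + s *\<^sub>R rs) = div_jet (p, q, r) + s *\<^sub>R (cross p \<xi> (mom p \<xi> h) + ip p \<xi> \<xi> *\<^sub>R X)"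
proof -
  have m: "mom p \<xi> h = (\<Sum>j\<in>UNIV. (ginv p *v \<xi>) $ j *\<^sub>R h $ j)"
    by (simp add: vec_eq_iff mom_nth(2)[symmetric])
  have "(\<Sum>j\<in>UNIV. (\<Sum>i\<in>UNIV. ginv p $ i $ j * \<xi> $ i) * torsion_jet p qs $ j $ k) =
     (cross p \<xi> (mom p \<xi> h) + ip p \<xi> \<xi> *\<^sub>R X) $ k" for k
    unfolding sharp_sum m linear_sum[OF linear_cross] cross_scaleR ip_def inner_vec_def inner_real_def
    by (simp add: torsion_symbol algebra_simps sum.distrib sum_distrib_left)
  then have e: "(\<Sum>i\<in>UNIV. \<Sum>j\<in>UNIV. ginv p $ i $ j * (\<xi> $ i * torsion_jet p qs $ j $ k)) =
     (cross p \<xi> (mom p \<xi> h) + ip p \<xi> \<xi> *\<^sub>R X) $ k" for k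
    by (subst sum.swap) (simp add: sum_distrib_right mult.assoc)
  have "div_jet (p, q, r + s *\<^sub>R rs) $ k = div_jet (p, q, r) $ k
     + s * (\<Sum>i\<in>UNIV. \<Sum>j\<in>UNIV. ginv p $ i $ j * (\<xi> $ i * torsion_jet p qs $ j $ k))" for k
    unfolding div_jet_def torsion_total
    by (simp add: sum_distrib_left sum.distrib[symmetric] algebra_simps)
  then show ?thesis unfolding e by (simp add: vec_eq_iff)
qed

text \<open>The derivative is contracted with the second index of the torsion, and \<xi> \<times>
  h_k is orthogonal to \<xi>; so \<open>h\<close> disappears and only \<open>X\<close> is
  left.\<close>

lemma div_t_shift:
  "div_t_jet (p, q, r + s *\<^sub>R rs) = div_t_jet (p, q, r) + s *\<^sub>R (ip p \<xi> X *\<^sub>R \<xi>)"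
proof -
  have "(ginv p *v \<xi>) \<bullet> torsion_jet p qs $ k = ip p \<xi> X * \<xi> $ k" for k
    using ip_commute[OF p(2), of \<xi> X] ip_cross[OF p, of \<xi> "h $ k"]
      ip_commute[OF p(2), of \<xi> "cross p \<xi> (h $ k)"]
    by (simp add: torsion_symbol inner_add_right ip_def inner_commute)
  then have "(\<Sum>j\<in>UNIV. (\<Sum>i\<in>UNIV. ginv p $ i $ j * \<xi> $ i) * torsion_jet p qs $ k $ j) = ip p \<xi> X * \<xi> $ k" for k
    unfolding sharp_sum by (simp add: inner_vec_def)
  then have e: "(\<Sum>i\<in>UNIV. \<Sum>j\<in>UNIV. ginv p $ i $ j * (\<xi> $ i * torsion_jet p qs $ k $ j)) = ip p \<xi> X * \<xi> $ k" for k
    by (subst sum.swap) (simp add: sum_distrib_right mult.assoc)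
  have "div_t_jet (p, q, r + s *\<^sub>R rs) $ k = div_t_jet (p, q, r) $ k
     + s * (\<Sum>i\<in>UNIV. \<Sum>j\<in>UNIV. ginv p $ i $ j * (\<xi> $ i * torsion_jet p qs $ k $ j))" for k
    unfolding div_t_jet_def torsion_total
    by (simp add: sum_distrib_left sum.distrib[symmetric] algebra_simps)
  then show ?thesis unfolding e by (simp add: vec_eq_iff)
qed

lemma G2_shift:
  "G2_jet a b1 b2 (p, q, r + s *\<^sub>R rs) = G2_jet a b1 b2 (p, q, r) + s *\<^sub>R of_pair p (DP_symbol p a b1 b2 \<xi> (h, X))"
proof -
  let ?x = "(p, q, r)" and ?x' = "(p, q, r + s *\<^sub>R rs)" and ?S = "DP_symbol p a b1 b2 \<xi> (h, X)"
  have A: "- ricci_jet ?x' + a *\<^sub>R lie_jet ?x' = (- ricci_jet ?x + a *\<^sub>R lie_jet ?x) + s *\<^sub>R fst ?S"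
    unfolding ricci_shift lie_shift
    by (simp add: DP_symbol_def B_symbol_def vec_eq_iff outer_def algebra_simps)
  have B: "b1 *\<^sub>R div_jet ?x' + b2 *\<^sub>R div_t_jet ?x' = (b1 *\<^sub>R div_jet ?x + b2 *\<^sub>R div_t_jet ?x) + s *\<^sub>R snd ?S"
    unfolding div_shift div_t_shift by (simp add: DP_symbol_def algebra_simps)
  show ?thesis
    unfolding G2_jet_def fst_conv A B of_pair_def
    by (simp add: linear_add[OF linear_diamond] linear_scale[OF linear_diamond] linear_add[OF linear_hook_psi]
        linear_scale[OF linear_hook_psi] scaleR_add_right)
qed

end

section \<open>The symbols of the three operators in closed form\<close>

context G2_germ
begin

lemma D_grad: "D1 z = grad \<phi> z" "D2 z = hess \<phi> z"
  by (simp_all add: D1_def D2_def grad_def hess_def)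

lemma jet_part1_symbol: "\<exists>w. jet_part1 y (\<chi> i. \<xi> $ i *\<^sub>R u) = (0, (\<chi> i. \<xi> $ i *\<^sub>R of_pair (\<phi> y) u), w)"
proof -
  have "(\<Sum>b\<in>Basis. ((\<xi> $ i *\<^sub>R u) \<bullet> b) *\<^sub>R coef b y) = \<xi> $ i *\<^sub>R of_pair (\<phi> y) u" for i
    unfolding coef_sum[symmetric] by (rule linear_scale[OF linear_of_pair])
  then show ?thesis by (simp add: jet_part1_def)
qed

lemma symbol_DVT_eq:
  assumes y: "y \<in> V" and u: "u \<in> sym_pairs"
  shows "symbol_DVT V \<phi> y \<xi> u = VT_symbol (\<phi> y) \<xi> u"
proof -
  let ?x = "(\<phi> y, grad \<phi> y, hess \<phi> y)" and ?F = "\<lambda>x. on_jets2 VT_jet x"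
  define D where "D = frechet_derivative ?F (at ?x)"
  note sF = smooth_on_jets2[OF smooth_VT_jet]
  have d: "?F differentiable (at ?x)" using smooth_differentiable[OF sF] nd[OF y] by simp
  have lin: "linear D" unfolding D_def by (rule linear_frechet_derivative[OF d])
  note lV = linear_VT_jet[OF nd[OF y]]
  \<comment> \<open>In these directions the base point is fixed and \<open>VT_jet\<close> is linear
    in the first derivatives, so its derivative is its own value.\<close>
  have shift: "D (0, w1, w2) = VT_jet (\<phi> y) w1" for w1 w2
    unfolding D_def by (rule affine_path_derivative[OF d]) (simp add: linear_add[OF lV] linear_scale[OF lV])
  have eq: "VT \<psi> y = ?F (\<psi> y, grad \<psi> y, hess \<psi> y)" if "G2_germ W \<psi>" "y \<in> W" for W \<psi>
    using G2_germ.VT_eq[OF that] G2_germ.D_grad[OF that(1)] by simp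
  have "principal_symbol 1 V sym_pairs (linearization VT \<phi>) y \<xi> u = D (jet_part1 y (\<chi> i. \<xi> $ i *\<^sub>R u))"
  proof (rule principal_symbol_1[OF opn y subspace_sym_pairs u])
    show "linear (\<lambda>w. D (jet_part0 y w))" "linear (\<lambda>w. D (jet_part1 y w))"
      using linear_compose[OF linear_jet_part0 lin] linear_compose[OF linear_jet_part1 lin] by (simp_all add: o_def)
    fix w :: "vec7 \<Rightarrow> (real^7^7) \<times> vec7" assume w: "smooth V w"
    have "linearization VT \<phi> w y = D (of_pair (\<phi> y) (w y), grad (\<lambda>z. of_pair (\<phi> z) (w z)) y, hess (\<lambda>z. of_pair (\<phi> z) (w z)) y)"
      unfolding D_def by (rule linearization_jet[OF sF _ w y]) (rule eq)
    then show "linearization VT \<phi> w y = D (jet_part0 y (w y)) + D (jet_part1 y (grad w y))"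
      unfolding jet_of_pair[OF w y] linear_add[OF lin]
      by (simp add: jet_part2_def shift linear_0[OF lV])
  qed
  moreover have "(\<chi> i. \<xi> $ i *\<^sub>R of_pair (\<phi> y) u) = covector.qs (\<phi> y) \<xi> (fst u) (snd u)"
    and c: "covector (\<phi> y) (fst u)"
    using covector.qs_def[of "\<phi> y" "fst u" \<xi> "snd u"] alt[OF y] nd[OF y] u
    by (auto simp: covector_def sym_pairs_def)
  ultimately show ?thesis
    unfolding symbol_DVT_def using jet_part1_symbol[of y \<xi> u] shift covector.VT_jet_symbol[OF c, of \<xi> "snd u"] by auto
qed

lemma symbol_DP_eq:
  assumes y: "y \<in> V" and u: "u \<in> sym_pairs"
  shows "symbol_DP a b1 b2 V \<phi> y \<xi> u = DP_symbol (\<phi> y) a b1 b2 \<xi> u"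
proof -
  let ?x = "(\<phi> y, grad \<phi> y, hess \<phi> y)" and ?F = "G2_jet a b1 b2"
  define D where "D = frechet_derivative ?F (at ?x)"
  note sF = smooth_G2_jet[of a b1 b2]
  have d: "?F differentiable (at ?x)" using smooth_differentiable[OF sF] nd[OF y] by simp
  have lin: "linear D" unfolding D_def by (rule linear_frechet_derivative[OF d])
  obtain g where g: "linear g" "\<And>\<omega>. alternating3 \<omega> \<Longrightarrow> to_pair (\<phi> y) \<omega> = g \<omega>"
    "\<And>u. u \<in> sym_pairs \<Longrightarrow> g (of_pair (\<phi> y) u) = u"
    using to_pair_linear[OF alt[OF y] nd[OF y]] by blast
  have eq: "G2_operator a b1 b2 \<psi> y = ?F (\<psi> y, grad \<psi> y, hess \<psi> y)" if "G2_germ W \<psi>" "y \<in> W" for W \<psi>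
    using G2_germ.G2_operator_eq[OF that] G2_germ.D_grad[OF that(1)] by simp
  have c: "covector (\<phi> y) (fst u)"
    using alt[OF y] nd[OF y] u by (auto simp: covector_def sym_pairs_def)
  have "principal_symbol 2 V sym_pairs (\<lambda>u y. to_pair (\<phi> y) (linearization (G2_operator a b1 b2) \<phi> u y)) y \<xi> u
     = g (D (jet_part2 y (\<chi> i j. (\<xi> $ i * \<xi> $ j) *\<^sub>R u)))"
  proof (rule principal_symbol_2[OF opn y subspace_sym_pairs u])
    show "linear (\<lambda>w. g (D (jet_part0 y w)))" "linear (\<lambda>w. g (D (jet_part1 y w)))" "linear (\<lambda>w. g (D (jet_part2 y w)))"
      using linear_compose[OF linear_compose[OF linear_jet_part0 lin] g(1)]
        linear_compose[OF linear_compose[OF linear_jet_part1 lin] g(1)]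
        linear_compose[OF linear_compose[OF linear_jet_part2 lin] g(1)] by (simp_all add: o_def)
    fix w :: "vec7 \<Rightarrow> (real^7^7) \<times> vec7" assume w: "smooth V w"
    let ?\<eta> = "\<lambda>z. of_pair (\<phi> z) (w z)"
    have l: "linearization (G2_operator a b1 b2) \<phi> w y = D (?\<eta> y, grad ?\<eta> y, hess ?\<eta> y)"
      unfolding D_def by (rule linearization_jet[OF sF _ w y]) (rule eq)
    \<comment> \<open>The linearized value must be known to be a 3-form before
      \<open>to_pair\<close> can be replaced by the linear map \<open>g\<close>.\<close>
    have "alternating3 (D (?\<eta> y, grad ?\<eta> y, hess ?\<eta> y))"
      unfolding D_def
      by (rule alternating3_derivative[OF d], rule G2_jet_alternating)
         (simp add: alternating3_add alternating3_scaleR of_pair_alternating alt[OF y])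
    then show "to_pair (\<phi> y) (linearization (G2_operator a b1 b2) \<phi> w y) =
       g (D (jet_part0 y (w y))) + g (D (jet_part1 y (grad w y))) + g (D (jet_part2 y (hess w y)))"
      unfolding l
      by (simp only: g(2)) (simp only: jet_of_pair[OF w y] linear_add[OF lin] linear_add[OF g(1)])
  qed
  also have "jet_part2 y (\<chi> i j. (\<xi> $ i * \<xi> $ j) *\<^sub>R u) = (0, 0, covector.rs (\<phi> y) \<xi> (fst u) (snd u))"
    by (simp add: jet_part2_def covector.rs_def[OF c] linear_scale[OF linear_of_pair] vec_eq_iff)
  also have "D (0, 0, covector.rs (\<phi> y) \<xi> (fst u) (snd u)) = of_pair (\<phi> y) (DP_symbol (\<phi> y) a b1 b2 \<xi> u)"
    unfolding D_def by (rule affine_path_derivative[OF d]) (simp add: covector.G2_shift[OF c])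
  finally show ?thesis
    unfolding symbol_DP_def using g(3)[OF DP_symbol_sym[OF u]] by simp
qed

text \<open>Parametrized by the covector of the vector field, the usual description of the image;
  the metric is inserted in \<open>symbol_delta_star_eq\<close>.\<close>

definition "delta_symbol y \<xi> \<omega> =
  ((1/2) *\<^sub>R (outer \<xi> \<omega> + outer \<omega> \<xi>), (- 1/2) *\<^sub>R cross (\<phi> y) \<xi> \<omega>)"

text \<open>After lowering an index, the product of \<xi> and \<open>v\<close> is split into its
  symmetric and skew parts, and \<open>diamond_skew\<close> moves the skew part to the vector
  slot.\<close>

lemma delta_symbol_pair:
  assumes y: "y \<in> V"
  shows "der (outer \<xi> v) (\<phi> y) = of_pair (\<phi> y) (delta_symbol y \<xi> (metric (\<phi> y) *v v))"
proof -
  let ?p = "\<phi> y" and ?w = "metric (\<phi> y) *v v"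
  note p = alt[OF y] nd[OF y]
  have "(outer \<xi> ?w ** ginv ?p) $ i $ j = \<xi> $ i * (ginv ?p *v ?w) $ j" for i j
    unfolding matrix_matrix_mult_def matrix_vector_mult_def[of "ginv ?p"] vec_lambda_beta sum_distrib_left outer_def
    by (intro sum.cong refl) (subst symD[OF ginv_sym[OF p(2)]], simp add: mult_ac)
  then have "outer \<xi> ?w ** ginv ?p = outer \<xi> v"
    by (simp add: vec_eq_iff matrix_vector_mul_assoc ginv_inverse[OF p(2)] outer_def)
  then have "der (outer \<xi> v) ?p = diamond (outer \<xi> ?w) ?p" by (simp add: diamond_der)
  also have "outer \<xi> ?w = (1/2) *\<^sub>R (outer \<xi> ?w + outer ?w \<xi>) + (1/2) *\<^sub>R (outer \<xi> ?w - outer ?w \<xi>)"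
    by (simp add: vec_eq_iff algebra_simps)
  also have "diamond \<dots> ?p = diamond ((1/2) *\<^sub>R (outer \<xi> ?w + outer ?w \<xi>)) ?p + diamond ((1/2) *\<^sub>R (outer \<xi> ?w - outer ?w \<xi>)) ?p"
    by (rule linear_add[OF linear_diamond])
  also have "diamond ((1/2) *\<^sub>R (outer \<xi> ?w - outer ?w \<xi>)) ?p =
     hook_psi ((- 1/2) *\<^sub>R contract2 ?p ((1/2) *\<^sub>R (outer \<xi> ?w - outer ?w \<xi>))) ?p"
    by (rule diamond_skew[OF p]) (simp add: vec_eq_iff transpose_def outer_def field_simps)
  also have "contract2 ?p ((1/2) *\<^sub>R (outer \<xi> ?w - outer ?w \<xi>)) = (1/2) *\<^sub>R (cross ?p \<xi> ?w - cross ?p ?w \<xi>)"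
    by (simp only: linear_scale[OF linear_contract2] linear_diff[OF linear_contract2] cross_def)
  also have "\<dots> = cross ?p \<xi> ?w"
    by (subst (2) cross_commute[OF p(1)]) (simp flip: scaleR_2)
  finally show ?thesis by (simp add: of_pair_def delta_symbol_def)
qed

lemma delta_symbol_sym: "delta_symbol y \<xi> \<omega> \<in> sym_pairs"
  by (simp add: delta_symbol_def sym_pairs_def vec_eq_iff transpose_def outer_def)

text \<open>In the Lie derivative the derivatives of the field enter as \<open>der\<close> of its
  gradient; the derivative of \<phi> multiplies the undifferentiated field and has lower
  order.\<close>

lemma symbol_delta_star_eq:
  assumes y: "y \<in> V"
  shows "symbol_delta_star V \<phi> y \<xi> v = delta_symbol y \<xi> (metric (\<phi> y) *v v)"
proof -
  obtain g where g: "linear g" "\<And>\<omega>. alternating3 \<omega> \<Longrightarrow> to_pair (\<phi> y) \<omega> = g \<omega>"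
    "\<And>u. u \<in> sym_pairs \<Longrightarrow> g (of_pair (\<phi> y) u) = u"
    using to_pair_linear[OF alt[OF y] nd[OF y]] by blast
  have l0: "linear (\<lambda>w :: vec7. \<Sum>m\<in>UNIV. w $ m *\<^sub>R D1 y $ m)"
    by (rule linearI) (simp_all add: scaleR_add_left sum.distrib scaleR_right.sum)
  have "principal_symbol 1 V UNIV (delta_star \<phi>) y \<xi> v = g (der (\<chi> i. \<xi> $ i *\<^sub>R v) (\<phi> y))"
  proof (rule principal_symbol_1[OF opn y subspace_UNIV UNIV_I])
    show "linear (\<lambda>w. g (\<Sum>m\<in>UNIV. w $ m *\<^sub>R D1 y $ m))" "linear (\<lambda>w. g (der w (\<phi> y)))"
      using linear_compose[OF l0 g(1)] linear_compose[OF linear_der g(1)] by (simp_all add: o_def)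
    fix w :: "vec7 \<Rightarrow> vec7"
    have e: "lie3 w \<phi> y = (\<Sum>m\<in>UNIV. w y $ m *\<^sub>R D1 y $ m) + der (grad w y) (\<phi> y)"
      by (simp add: vec_eq_iff lie3_def der_nth sum.distrib grad_def D1_def)
    moreover have "alternating3 (lie3 w \<phi> y)"
      unfolding e by (intro alternating3_add alternating3_sum alternating3_scaleR alternating_D1[OF y] der_alternating alt[OF y])
    ultimately show "delta_star \<phi> w y = g (\<Sum>m\<in>UNIV. w y $ m *\<^sub>R D1 y $ m) + g (der (grad w y) (\<phi> y))"
      unfolding delta_star_def by (simp add: g(2) linear_add[OF g(1)])
  qed
  also have "(\<chi> i. \<xi> $ i *\<^sub>R v) = outer \<xi> v" by (simp add: vec_eq_iff outer_def)
  finally show ?thesis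
    unfolding symbol_delta_star_def delta_symbol_pair[OF y] by (simp only: g(3)[OF delta_symbol_sym])
qed

end

subsection \<open>The kernel of the symbol\<close>

locale nonzero_covector =
  fixes p :: ten3 and \<xi> :: vec7
  assumes p: "alternating3 p" "nondegenerate p" and nz: "\<xi> \<noteq> 0"
begin

abbreviation "n \<equiv> ip p \<xi> \<xi>"
definition "S \<omega> = (1/2) *\<^sub>R (outer \<xi> \<omega> + outer \<omega> \<xi>)"

lemma n_pos: "n > 0" by (rule ip_pos[OF p(2) nz])

lemma cross_self: "cross p \<xi> \<xi> = 0"
  using cross_commute[OF p(1), of \<xi> \<xi>] by (simp add: eq_neg_iff_add_eq_0 flip: scaleR_2)

lemma mom_S: "mom p \<xi> (S \<omega>) = (1/2) *\<^sub>R (ip p \<xi> \<omega> *\<^sub>R \<xi> + n *\<^sub>R \<omega>)"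
proof -
  have o: "outer x y *v z = (y \<bullet> z) *\<^sub>R x" for x y z
    by (simp add: vec_eq_iff outer_def matrix_vector_mult_def inner_vec_def sum_distrib_left sum_distrib_right mult_ac)
  have "mom p \<xi> (S \<omega>) = (1/2) *\<^sub>R (outer \<xi> \<omega> *v (ginv p *v \<xi>) + outer \<omega> \<xi> *v (ginv p *v \<xi>))"
    by (simp add: mom_def S_def matrix_vector_mult_add_rdistrib vec_eq_iff matrix_vector_mult_def
        distrib_right sum.distrib sum_distrib_left algebra_simps)
  then show ?thesis unfolding o using ip_commute[OF p(2), of \<omega> \<xi>] by (simp add: ip_def)
qed

lemma trace_S: "ginv p \<bullet> S \<omega> = ip p \<xi> \<omega>"
proof -
  have "ginv p \<bullet> outer x y = ip p x y" for x y
    by (simp add: ip_def inner_vec_def outer_def matrix_vector_mult_def sum_distrib_left mult_ac)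
  then show ?thesis using ip_commute[OF p(2), of \<omega> \<xi>] by (simp add: S_def inner_add_right)
qed

text \<open>On the part that comes from vector fields the cross product, trace and contraction terms
  cancel, as diffeomorphism invariance demands. Only the deviation \<open>Y\<close>
  survives.\<close>

lemma VT_symbol_S: "VT_symbol p \<xi> (S \<omega>, (- 1/2) *\<^sub>R cross p \<xi> \<omega> + Y) = cross p \<xi> Y"
proof -
  have "cross p \<xi> ((- 1/2) *\<^sub>R cross p \<xi> \<omega> + Y) = (- 1/2) *\<^sub>R (ip p \<xi> \<omega> *\<^sub>R \<xi> - n *\<^sub>R \<omega>) + cross p \<xi> Y"
    unfolding cross_add cross_scaleR cross_cross[OF p] ..
  then show ?thesis
    unfolding VT_symbol_def fst_conv snd_conv mom_S trace_S by (simp add: vec_eq_iff algebra_simps)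
qed

lemma B_symbol_S:
  "B_symbol p a \<xi> (S \<omega>, (- 1/2) *\<^sub>R cross p \<xi> \<omega> + Y) = (n/2) *\<^sub>R \<omega> - a *\<^sub>R cross p \<xi> Y"
  unfolding B_symbol_def VT_symbol_S fst_conv mom_S trace_S by (simp add: vec_eq_iff algebra_simps)

lemma cross_mom_S:
  "cross p \<xi> (mom p \<xi> (S \<omega>)) + n *\<^sub>R ((- 1/2) *\<^sub>R cross p \<xi> \<omega> + Y) = n *\<^sub>R Y"
  unfolding mom_S cross_scaleR cross_add cross_self by (simp add: vec_eq_iff algebra_simps)

lemma ip_S: "ip p \<xi> ((- 1/2) *\<^sub>R cross p \<xi> \<omega> + Y) = ip p \<xi> Y"
  unfolding ip_linear ip_cross[OF p] by simp

lemma DP_symbol_S: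
  "DP_symbol p a b1 b2 \<xi> (S \<omega>, (- 1/2) *\<^sub>R cross p \<xi> \<omega> + Y) =
    (a *\<^sub>R (outer \<xi> (cross p \<xi> Y) + outer (cross p \<xi> Y) \<xi>), b1 *\<^sub>R (n *\<^sub>R Y) + (b2 * ip p \<xi> Y) *\<^sub>R \<xi>)"
  unfolding DP_symbol_def B_symbol_S fst_conv snd_conv cross_mom_S ip_S
  by (simp add: S_def vec_eq_iff outer_def algebra_simps)

lemma kernel_eq:
  assumes "b1 + b2 \<noteq> 0" "b1 \<noteq> a * (b1 + b2)"
  shows "kernel_on_pairs (DP_symbol p a b1 b2 \<xi>) = range (\<lambda>\<omega>. (S \<omega>, (- 1/2) *\<^sub>R cross p \<xi> \<omega>))"
proof (intro equalityI subsetI)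
  fix u assume u: "u \<in> kernel_on_pairs (DP_symbol p a b1 b2 \<xi>)"
  then have zero: "DP_symbol p a b1 b2 \<xi> u = 0" by (simp add: kernel_on_pairs_def)
  define B where "B = B_symbol p a \<xi> u"
  \<comment> \<open>Chosen by inverting \<open>B_symbol_S\<close> at \<open>Y = 0\<close>;
    \<open>Y\<close> below then measures how far \<open>snd u\<close> is from fitting this
    covector.\<close>
  define \<omega> where "\<omega> = (2/n) *\<^sub>R B"
  define Y where "Y = snd u + (1/2) *\<^sub>R cross p \<xi> \<omega>"
  have B: "B = (n/2) *\<^sub>R \<omega>" using n_pos by (simp add: \<omega>_def)
  have "n *\<^sub>R fst u = outer \<xi> B + outer B \<xi>"
    using arg_cong[OF zero, of fst] by (simp add: DP_symbol_def B_def)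
  also have "\<dots> = n *\<^sub>R S \<omega>" unfolding B by (simp add: S_def vec_eq_iff outer_def algebra_simps)
  finally have fu: "fst u = S \<omega>" using n_pos by simp
  have uS: "u = (S \<omega>, (- 1/2) *\<^sub>R cross p \<xi> \<omega> + Y)" by (simp add: prod_eq_iff fu Y_def)
  have "(n/2) *\<^sub>R \<omega> - a *\<^sub>R cross p \<xi> Y = (n/2) *\<^sub>R \<omega>"
    using B_symbol_S[of a \<omega> Y] unfolding uS[symmetric] B_def[symmetric] B by simp
  then have aY: "a *\<^sub>R cross p \<xi> Y = 0" by simp
  have Z: "b1 *\<^sub>R (n *\<^sub>R Y) + (b2 * ip p \<xi> Y) *\<^sub>R \<xi> = 0"
    using zero DP_symbol_S[of a b1 b2 \<omega> Y] unfolding uS[symmetric] by (simp add: zero_prod_def)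
  \<comment> \<open>Pairing with \<xi> merges the two coefficients into
    \<open>b1 + b2\<close>.\<close>
  from arg_cong[OF Z, of "ip p \<xi>"] have "(b1 + b2) * (n * ip p \<xi> Y) = 0"
    by (simp add: ip_linear algebra_simps)
  then have Y0: "ip p \<xi> Y = 0" using assms(1) n_pos by simp
  have "Y = 0"
  proof (cases "b1 = 0")
    case False
    then show ?thesis using Z Y0 n_pos by simp
  next
    \<comment> \<open>Here \<open>b1 \<noteq> a * (b1 + b2)\<close> excludes \<open>a = 0\<close>,
      so \<xi> \<times> Y vanishes, and the double cross product gives \<open>Y = 0\<close> since Y
      is orthogonal to \<xi>.\<close>
    case True
    then have "a \<noteq> 0" using assms by auto
    then have "cross p \<xi> Y = 0" using aY by simp
    then have "cross p \<xi> (cross p \<xi> Y) = 0" using cross_scaleR(1)[of p \<xi> 0 0] by simp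
    then show ?thesis unfolding cross_cross[OF p] Y0 using n_pos by simp
  qed
  then show "u \<in> range (\<lambda>\<omega>. (S \<omega>, (- 1/2) *\<^sub>R cross p \<xi> \<omega>))" using uS by auto
next
  fix u assume "u \<in> range (\<lambda>\<omega>. (S \<omega>, (- 1/2) *\<^sub>R cross p \<xi> \<omega>))"
  then obtain \<omega> where u: "u = (S \<omega>, (- 1/2) *\<^sub>R cross p \<xi> \<omega> + 0)" by auto
  have c0: "cross p \<xi> 0 = 0" using cross_scaleR(1)[of p \<xi> 0 0] by simp
  have "DP_symbol p a b1 b2 \<xi> u = 0"
    unfolding u DP_symbol_S c0 by (simp add: ip_linear zero_prod_def outer_def vec_eq_iff)
  moreover have "u \<in> sym_pairs"
    by (simp add: u sym_pairs_def S_def vec_eq_iff transpose_def outer_def)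
  ultimately show "u \<in> kernel_on_pairs (DP_symbol p a b1 b2 \<xi>)" by (simp add: kernel_on_pairs_def)
qed

text \<open>With m for the contraction of \<open>h\<close> with \<xi>, crossing B = 0 with \<xi>
  removes the multiples of \<xi> and leaves (1 + a) \<xi> \<times> m = a (<\<xi>, X> \<xi> - n X).
  The term along \<xi> cancels against \<open>b2 = - a\<close>, and (1 + a) n X - a n X = n
  X.\<close>

lemma DP_symbol_special:
  assumes B: "B_symbol p a \<xi> u = 0" shows "DP_symbol p a (1 + a) (- a) \<xi> u = n *\<^sub>R u"
proof -
  let ?m = "mom p \<xi> (fst u)" and ?X = "snd u"
  have "(1 + a) *\<^sub>R ?m = ((1/2 + a) * (ginv p \<bullet> fst u)) *\<^sub>R \<xi> + a *\<^sub>R cross p \<xi> ?X"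
    using B unfolding B_symbol_def VT_symbol_def by (simp add: vec_eq_iff algebra_simps)
  from arg_cong[OF this, of "cross p \<xi>"]
  have "(1 + a) *\<^sub>R cross p \<xi> ?m = a *\<^sub>R (ip p \<xi> ?X *\<^sub>R \<xi> - n *\<^sub>R ?X)"
    unfolding cross_scaleR cross_add cross_self cross_cross[OF p] by simp
  then have "(1 + a) *\<^sub>R (cross p \<xi> ?m + n *\<^sub>R ?X) + (- a * ip p \<xi> ?X) *\<^sub>R \<xi> = n *\<^sub>R ?X"
    by (simp add: vec_eq_iff algebra_simps)
  moreover have "outer \<xi> 0 + outer 0 \<xi> = 0" by (simp add: outer_def vec_eq_iff)
  ultimately show ?thesis unfolding DP_symbol_def B by (simp add: prod_eq_iff)
qed

lemma B_symbol_scaleR: "B_symbol p a \<xi> (c *\<^sub>R u) = c *\<^sub>R B_symbol p a \<xi> u"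
proof -
  have "mom p \<xi> (c *\<^sub>R fst u) = c *\<^sub>R mom p \<xi> (fst u)" by (simp add: mom_def scaleR_matrix_vector_assoc)
  then show ?thesis by (simp add: B_symbol_def VT_symbol_def cross_scaleR algebra_simps)
qed

end

lemma (in G2_germ) B_tilde_eq:
  assumes y: "y \<in> V" and u: "u \<in> sym_pairs"
  shows "B_tilde a V \<phi> y \<xi> u = B_symbol (\<phi> y) a \<xi> u"
proof -
  have "covector (\<phi> y) (fst u)" using alt[OF y] nd[OF y] u by (auto simp: covector_def sym_pairs_def)
  then interpret covector "\<phi> y" \<xi> "fst u" "snd u" .
  have "(\<Sum>i\<in>UNIV. \<Sum>j\<in>UNIV. ginv (\<phi> y) $ i $ j * \<xi> $ i * fst u $ j $ k) = mom (\<phi> y) \<xi> (fst u) $ k" for k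
    unfolding mom_nth(2)[symmetric] sharp_sum[symmetric] sum_distrib_right by (rule sum.swap)
  moreover have "(\<Sum>i\<in>UNIV. \<Sum>j\<in>UNIV. ginv (\<phi> y) $ i $ j * fst u $ i $ j) = ginv (\<phi> y) \<bullet> fst u"
    by (simp add: inner_vec_def)
  ultimately show ?thesis
    unfolding B_tilde_def symbol_DVT_eq[OF assms] B_symbol_def by (simp add: vec_eq_iff)
qed

theorem proposition6p42:
  fixes \<A> :: "'m::{t2_space, second_countable_topology} chart set"
    and \<Phi> :: "'m chart \<Rightarrow> vec7 \<Rightarrow> ten3"
    and c :: "'m chart" and x :: 'm and \<xi> :: vec7
    and a b1 b2 :: real
  assumes "smooth_atlas \<A>" and "G2_structure \<A> \<Phi>"
    and "c \<in> \<A>" and "x \<in> fst c" and "\<xi> \<noteq> 0"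
    and "b1 + b2 \<noteq> 0" and "b1 \<noteq> a * (b1 + b2)"
  defines "U \<equiv> chart_image c" and "\<phi> \<equiv> \<Phi> c" and "y \<equiv> snd c x"
  shows "kernel_on_pairs (symbol_DP a b1 b2 U \<phi> y \<xi>) = range (symbol_delta_star U \<phi> y \<xi>)
    \<and> (b1 + b2 = 1 \<and> a = - b2 \<longrightarrow>
        (\<forall>u \<in> kernel_on_pairs (B_tilde a U \<phi> y \<xi>).
           symbol_DP a b1 b2 U \<phi> y \<xi> u = conorm_sq (\<phi> y) \<xi> *\<^sub>R u) \<and>
        symbol_DP a b1 b2 U \<phi> y \<xi> ` kernel_on_pairs (B_tilde a U \<phi> y \<xi>)
          \<subseteq> kernel_on_pairs (B_tilde a U \<phi> y \<xi>) \<and>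
        (\<forall>z\<in>U. G2_operator a b1 b2 \<phi> z =
           diamond (- ricci \<phi> z + a *\<^sub>R lie_VT_metric \<phi> z) (\<phi> z) +
           hook_psi ((1 + a) *\<^sub>R div_torsion \<phi> z - a *\<^sub>R div_torsion_t \<phi> z) (\<phi> z)))
    \<and> (b1 + b2 = 1 \<and> a = - b2 \<longleftrightarrow> b1 = 1 + a \<and> b2 = - a)"
proof -
  interpret G2_germ U \<phi>
    using assms(1-3) unfolding G2_germ_def smooth_atlas_def G2_structure_def U_def \<phi>_def by blast
  have y: "y \<in> U" using assms(4) by (simp add: U_def y_def)
  interpret nonzero_covector "\<phi> y" \<xi>
    using alt[OF y] nd[OF y] assms(5) by unfold_locales
  have "kernel_on_pairs (symbol_DP a b1 b2 U \<phi> y \<xi>) = kernel_on_pairs (DP_symbol (\<phi> y) a b1 b2 \<xi>)"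
    unfolding kernel_on_pairs_def using symbol_DP_eq[OF y] by auto
  also have "\<dots> = range (delta_symbol y \<xi>)"
    unfolding kernel_eq[OF assms(6,7)] by (simp add: delta_symbol_def S_def)
  also have "\<dots> = range (symbol_delta_star U \<phi> y \<xi>)"
  proof -
    \<comment> \<open>The kernel is parametrized by covectors and the symbol of the Lie derivative
      by vectors; the ranges agree because the metric is invertible.\<close>
    have "metric (\<phi> y) *v (ginv (\<phi> y) *v \<omega>) = \<omega>" for \<omega>
      by (simp add: matrix_vector_mul_assoc ginv_inverse[OF nd[OF y]])
    then have d: "delta_symbol y \<xi> \<omega> = symbol_delta_star U \<phi> y \<xi> (ginv (\<phi> y) *v \<omega>)" for \<omega>
      by (simp add: symbol_delta_star_eq[OF y])
    show ?thesis
    proof (intro equalityI image_subsetI)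
      show "delta_symbol y \<xi> \<omega> \<in> range (symbol_delta_star U \<phi> y \<xi>)" for \<omega>
        by (subst d) (rule rangeI)
      show "symbol_delta_star U \<phi> y \<xi> v \<in> range (delta_symbol y \<xi>)" for v
        unfolding symbol_delta_star_eq[OF y] by (rule rangeI)
    qed
  qed
  finally have kernel: "kernel_on_pairs (symbol_DP a b1 b2 U \<phi> y \<xi>) = range (symbol_delta_star U \<phi> y \<xi>)" .
  have special: "symbol_DP a b1 b2 U \<phi> y \<xi> u = conorm_sq (\<phi> y) \<xi> *\<^sub>R u"
      "conorm_sq (\<phi> y) \<xi> *\<^sub>R u \<in> kernel_on_pairs (B_tilde a U \<phi> y \<xi>)"
    if "b1 + b2 = 1" "a = - b2" "u \<in> kernel_on_pairs (B_tilde a U \<phi> y \<xi>)" for u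
  proof -
    have b: "b1 = 1 + a" "b2 = - a" using that by auto
    have u': "u \<in> sym_pairs" "B_tilde a U \<phi> y \<xi> u = 0"
      using that(3) by (auto simp: kernel_on_pairs_def)
    then have u: "u \<in> sym_pairs" "B_symbol (\<phi> y) a \<xi> u = 0"
      unfolding B_tilde_eq[OF y u'(1)] by simp_all
    show "symbol_DP a b1 b2 U \<phi> y \<xi> u = conorm_sq (\<phi> y) \<xi> *\<^sub>R u"
      unfolding symbol_DP_eq[OF y u(1)] b DP_symbol_special[OF u(2)] by (simp add: conorm_sq_def ip_def)
    have "conorm_sq (\<phi> y) \<xi> *\<^sub>R u \<in> sym_pairs" by (rule subspace_scale[OF subspace_sym_pairs u(1)])
    then show "conorm_sq (\<phi> y) \<xi> *\<^sub>R u \<in> kernel_on_pairs (B_tilde a U \<phi> y \<xi>)"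
      by (simp add: kernel_on_pairs_def B_tilde_eq[OF y] B_symbol_scaleR u(2))
  qed
  have op: "G2_operator a b1 b2 \<phi> z = diamond (- ricci \<phi> z + a *\<^sub>R lie_VT_metric \<phi> z) (\<phi> z) +
      hook_psi ((1 + a) *\<^sub>R div_torsion \<phi> z - a *\<^sub>R div_torsion_t \<phi> z) (\<phi> z)"
    if "b1 + b2 = 1" "a = - b2" for z
  proof -
    have b: "b1 = 1 + a" "b2 = - a" using that by auto
    show ?thesis unfolding G2_operator_def b by simp
  qed
  have iff: "b1 + b2 = 1 \<and> a = - b2 \<longleftrightarrow> b1 = 1 + a \<and> b2 = - a" by auto
  show ?thesis
  proof (intro conjI impI ballI image_subsetI kernel iff)
    fix u assume h: "b1 + b2 = 1 \<and> a = - b2" and u: "u \<in> kernel_on_pairs (B_tilde a U \<phi> y \<xi>)"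
    note h = h[THEN conjunct1] h[THEN conjunct2]
    show "symbol_DP a b1 b2 U \<phi> y \<xi> u = conorm_sq (\<phi> y) \<xi> *\<^sub>R u" by (rule special(1)[OF h u])
    then show "symbol_DP a b1 b2 U \<phi> y \<xi> u \<in> kernel_on_pairs (B_tilde a U \<phi> y \<xi>)"
      using special(2)[OF h u] by simp
  next
    fix z assume h: "b1 + b2 = 1 \<and> a = - b2"
    show "G2_operator a b1 b2 \<phi> z = diamond (- ricci \<phi> z + a *\<^sub>R lie_VT_metric \<phi> z) (\<phi> z) +
        hook_psi ((1 + a) *\<^sub>R div_torsion \<phi> z - a *\<^sub>R div_torsion_t \<phi> z) (\<phi> z)"
      by (rule op[OF h[THEN conjunct1] h[THEN conjunct2]])
  qed
qed

end
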